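(* Let $\ell\ge3$ be a prime, and let $f(\tau)$ be a weakly holomorphic modular form of weight $3/2$ with Fourier expansion $f(\tau)=\sum_{n\ge0}a(n)q^{n-\frac tw}$, $a(n)\in\mathbb Z_{(\ell)}$. Assume: (1) there is an eta-quotient $g(\tau)=\prod_{\delta\mid N}\eta(\delta\tau)^{r_\delta}$ of weight $1/2$ such that $fg$ is a holomorphic modular form in $M_2(\Gamma_0(N))$; (2) $g$ is a holomorphic modular form of weight $1/2$ and level $N$, that is, there is a multiplier $\nu$ such that for any $\gamma=\begin{pmatrix}a&b\\c&d\end{pmatrix}\in\Gamma_0(N)$, $g\left(\frac{a\tau+b}{c\tau+d}\right)=\nu(\gamma)(c\tau+d)^{1/2}g(\tau)$; (3) $s$ is an integer coprime to $w$, the Fourier expansion of $g$ is given by $g(\tau)=\sum_{m\in\mathbb Z}b(m)q^{\frac{sm^2}{w}}$, and it satisfies $b(\ell m)=\chi(\ell)b(m)$ for every $m$. If $\ell\nmid sw$, then $$\chi(\ell)\cdot\prod_{\delta\mid N}(q^{\ell\delta};q^{\ell\delta})_\infty^{r_\delta}\sum_{n\ge0}a\left(\ell n-\tfrac tw(\ell^2-1)\right)q^n\equiv\left(fg-\left(\frac{-sw}{\ell}\right)\cdot[f(\tau),g(\tau)]_{(\ell-1)/2}\right)\Big|\,U_\ell\pmod\ell,$$ and $[f(\tau),g(\tau)]_{(\ell-1)/2}$ is a holomorphic modular form in $M_{\ell+1}(\Gamma_0(N))$. Moreover, if $fg$ is a cusp form, then $[f(\tau),g(\tau)]_{(\ell-1)/2}$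 is also a cusp form in $S_{\ell+1}(\Gamma_0(N))$.
   Context: $q=e^{2\pi i\tau}$ with $\tau$ in the upper half-plane; $\eta(\tau)=q^{1/24}\prod_{n\ge1}(1-q^n)$; $(q^k;q^k)_\infty=\prod_{n\ge1}(1-q^{kn})$. Convention: $a(n)=0$ for $n<0$. $\chi(\ell)$ is a number depending only on $\ell$. $\left(\frac{\cdot}{\ell}\right)$ is the Legendre symbol. $\left(\sum c(n)q^n\right)|U_\ell=\sum c(\ell n)q^n$. With $D=\frac{1}{2\pi i}\frac{d}{d\tau}=q\frac{d}{dq}$, the $v$-th Rankin–Cohen bracket of $f$ (of weight $a$) and $g$ (of weight $b$), $a,b\in\frac12\mathbb Z$, is $$[f,g]_v=\sum_{0\le j\le v}(-1)^j\binom{a+v-1}{v-j}\binom{b+v-1}{j}D^jf\,D^{v-j}g;$$ here $f$ has weight $3/2$ and $g$ has weight $1/2$. $\mathbb Z_{(\ell)}$ is the ring of rationals with denominator prime to $\ell$; congruences modulo $\ell$ of $q$-series are coefficientwise. $M_k(\Gamma_0(N))$ and $S_k(\Gamma_0(N))$ are the spaces of holomorphic modular forms and cusp forms of weight $k$ on $\Gamma_0(N)$.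
   Formalization: The congruence (not the statements on M_{ℓ+1}, S_{ℓ+1}) is asserted under the added normalization t/w = (1/24)∑_{δ|N} δ r_δ, the leading exponent of g; without it, replacing t by t+w and a(n) by a(n−1) makes it false (e.g. g=η, N=2, ℓ=7). *)

theory Defs
  imports "HOL-Complex_Analysis.Complex_Analysis" "HOL-Number_Theory.Number_Theory"
begin

section \<open>Modular forms with multiplier on \<open>\<Gamma>\<^sub>0(N)\<close>\<close>

definition uhp :: "complex set" where
  "uhp = {\<tau>. Im \<tau> > 0}"

definition SL2Z :: "(int^2^2) set" where
  "SL2Z = {A. det A = 1}"

definition Gamma0 :: "nat \<Rightarrow> (int^2^2) set" where
  "Gamma0 N = {A \<in> SL2Z. int N dvd A $ 2 $ 1}"

definition moebius :: "int^2^2 \<Rightarrow> complex \<Rightarrow> complex" where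
  "moebius A \<tau> = (of_int (A $ 1 $ 1) * \<tau> + of_int (A $ 1 $ 2)) / (of_int (A $ 2 $ 1) * \<tau> + of_int (A $ 2 $ 2))"

text \<open>For non-integral \<open>k\<close>, the power is the principal one, with argument in \<open>(-\<pi>, \<pi>]\<close>; for integral \<open>k\<close>
  it is the ordinary power.\<close>
definition autfac :: "real \<Rightarrow> int^2^2 \<Rightarrow> complex \<Rightarrow> complex" where
  "autfac k A \<tau> = (of_int (A $ 2 $ 1) * \<tau> + of_int (A $ 2 $ 2)) powr (of_real k)"

definition slash :: "real \<Rightarrow> int^2^2 \<Rightarrow> (complex \<Rightarrow> complex) \<Rightarrow> complex \<Rightarrow> complex" where
  "slash k A f \<tau> = f (moebius A \<tau>) / autfac k A \<tau>"

definition transforms_under ::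
  "nat \<Rightarrow> real \<Rightarrow> (int^2^2 \<Rightarrow> complex) \<Rightarrow> (complex \<Rightarrow> complex) \<Rightarrow> bool" where
  "transforms_under N k \<nu> f \<longleftrightarrow>
     (\<forall>A \<in> Gamma0 N. \<forall>\<tau> \<in> uhp. f (moebius A \<tau>) = \<nu> A * autfac k A \<tau> * f \<tau>)"

definition at_im_infty :: "complex filter" where
  "at_im_infty = filtercomap Im at_top"

text \<open>The translates by all of \<open>SL\<^sub>2(\<int>)\<close> run through all cusps.  A holomorphic form is bounded at
  each cusp; a weakly holomorphic one is meromorphic there, i.e. grows at most like a negative
  power of \<open>\<bar>q\<bar>\<close>.\<close>
definition holomorphic_modular_form ::
  "nat \<Rightarrow> real \<Rightarrow> (int^2^2 \<Rightarrow> complex) \<Rightarrow> (complex \<Rightarrow> complex) \<Rightarrow> bool" where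
  "holomorphic_modular_form N k \<nu> f \<longleftrightarrow>
     f holomorphic_on uhp \<and> transforms_under N k \<nu> f \<and>
     (\<forall>A \<in> SL2Z. Bfun (slash k A f) at_im_infty)"

definition weakly_holomorphic_modular_form ::
  "nat \<Rightarrow> real \<Rightarrow> (int^2^2 \<Rightarrow> complex) \<Rightarrow> (complex \<Rightarrow> complex) \<Rightarrow> bool" where
  "weakly_holomorphic_modular_form N k \<nu> f \<longleftrightarrow>
     f holomorphic_on uhp \<and> transforms_under N k \<nu> f \<and>
     (\<forall>A \<in> SL2Z. \<exists>c::real.
        Bfun (\<lambda>\<tau>. of_real (exp (- c * Im \<tau>)) * slash k A f \<tau>) at_im_infty)"

definition modular_forms :: "nat \<Rightarrow> nat \<Rightarrow> (complex \<Rightarrow> complex) set" where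
  "modular_forms k N = {f. holomorphic_modular_form N (real k) (\<lambda>_. 1) f}"

definition cusp_forms :: "nat \<Rightarrow> nat \<Rightarrow> (complex \<Rightarrow> complex) set" where
  "cusp_forms k N =
     {f \<in> modular_forms k N. \<forall>A \<in> SL2Z. (slash (real k) A f \<longlongrightarrow> 0) at_im_infty}"

section \<open>Powers of \<open>q\<close>, eta-quotients, Rankin--Cohen brackets\<close>

text \<open>\<open>q\<^sup>x\<close> for \<open>q = e\<^sup>2\<^sup>\<pi>\<^sup>i\<^sup>\<tau>\<close> and real \<open>x\<close>\<close>
definition qpow :: "real \<Rightarrow> complex \<Rightarrow> complex" where
  "qpow x \<tau> = exp (2 * of_real pi * \<i> * of_real x * \<tau>)"

definition dedekind_eta :: "complex \<Rightarrow> complex" where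
  "dedekind_eta \<tau> = qpow (1/24) \<tau> * (\<Prod>n. 1 - qpow (real (Suc n)) \<tau>)"

definition eta_quotient :: "nat \<Rightarrow> (nat \<Rightarrow> int) \<Rightarrow> complex \<Rightarrow> complex" where
  "eta_quotient N r \<tau> = (\<Prod>\<delta> | \<delta> dvd N. dedekind_eta (of_nat \<delta> * \<tau>) powi r \<delta>)"

definition eta_quotient_weight :: "nat \<Rightarrow> (nat \<Rightarrow> int) \<Rightarrow> real" where
  "eta_quotient_weight N r = (\<Sum>\<delta> | \<delta> dvd N. of_int (r \<delta>)) / 2"

definition qderiv :: "(complex \<Rightarrow> complex) \<Rightarrow> complex \<Rightarrow> complex" where
  "qderiv f \<tau> = deriv f \<tau> / (2 * of_real pi * \<i>)"

definition rankin_cohen ::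
  "real \<Rightarrow> real \<Rightarrow> nat \<Rightarrow> (complex \<Rightarrow> complex) \<Rightarrow> (complex \<Rightarrow> complex) \<Rightarrow> complex \<Rightarrow> complex" where
  "rankin_cohen a b v f g \<tau> =
     (\<Sum>j\<le>v. (-1) ^ j * of_real ((a + real v - 1) gchoose (v - j)) * of_real ((b + real v - 1) gchoose j)
             * (qderiv ^^ j) f \<tau> * (qderiv ^^ (v - j)) g \<tau>)"

section \<open>Formal \<open>q\<close>-series\<close>

definition has_q_expansion :: "(complex \<Rightarrow> complex) \<Rightarrow> complex fps \<Rightarrow> bool" where
  "has_q_expansion F P \<longleftrightarrow> (\<forall>\<tau> \<in> uhp. (\<lambda>n. fps_nth P n * qpow (real n) \<tau>) sums F \<tau>)"

definition U_op :: "nat \<Rightarrow> complex fps \<Rightarrow> complex fps" where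
  "U_op l P = Abs_fps (\<lambda>n. fps_nth P (l * n))"

definition fps_qpoch :: "nat \<Rightarrow> complex fps" where
  "fps_qpoch k = (\<Prod>n. 1 - fps_X ^ (k * Suc n))"

text \<open>The value \<open>a(x)\<close> at a rational index, read as \<open>0\<close> when \<open>x\<close> is not a nonnegative integer.\<close>
definition coeff_at :: "(nat \<Rightarrow> complex) \<Rightarrow> rat \<Rightarrow> complex" where
  "coeff_at a x = (if x \<in> \<int> \<and> x \<ge> 0 then a (nat \<lfloor>x\<rfloor>) else 0)"

text \<open>The localisation \<open>\<int>\<^bsub>(l)\<^esub>\<close>, as a subset of the complex numbers.\<close>
definition Z_loc :: "nat \<Rightarrow> complex set" where
  "Z_loc l = {of_int x / of_int y | x y. coprime y (int l)}"

definition fps_cong :: "nat \<Rightarrow> complex fps \<Rightarrow> complex fps \<Rightarrow> bool" where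
  "fps_cong l P Q \<longleftrightarrow>
     (\<forall>n. fps_nth P n \<in> Z_loc l \<and> fps_nth Q n \<in> Z_loc l \<and>
          (\<exists>z \<in> Z_loc l. fps_nth P n - fps_nth Q n = of_nat l * z))"

end

theory Submission
  imports Defs
begin

text \<open>
  \<^emph>\<open>Modularity.\<close>  Collect the derivatives of a form of weight \<open>a\<close> in the generating series
  \<open>\<Sum> D\<^sup>n f / (n! (a)\<^sub>n) X\<^sup>n\<close>.  Under \<open>\<tau> \<mapsto> A\<tau>\<close> it is multiplied by the automorphy
  factor and by an exponential in \<open>X\<close>, and \<open>X\<close> is rescaled.  The bracket is a coefficient of the
  product of the series of \<open>f\<close> in \<open>-X\<close> and of \<open>g\<close> in \<open>X\<close>, where the exponentials cancel.
  At a cusp, \<open>g\<close> is \<open>q\<^sup>x\<close> times a zero-free holomorphic function of \<open>q\<close>; as \<open>fg\<close> is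
  holomorphic there, \<open>f\<close> is \<open>q\<^bsup>-x\<^esup>\<close> times a holomorphic function.  Differentiation preserves these
  shapes, so the bracket is a holomorphic function of \<open>q\<close>, which vanishes at \<open>0\<close> if \<open>fg\<close> does.

  \<^emph>\<open>Congruence.\<close>  Modulo \<open>\<ell> = 2v + 1\<close> all binomial products in the bracket vanish except the one
  of \<open>D\<^sup>v f \<cdot> g\<close>, which is \<open>1\<close>.  In the coefficient of \<open>q\<^bsup>\<ell>M\<^esup>\<close>, a term in which \<open>g\<close> contributes
  \<open>q\<^bsup>sm\<^sup>2/w\<^esup>\<close> carries the factor \<open>(-sm\<^sup>2/w)\<^sup>v\<close>.  By Euler's criterion this is the Legendre symbol
  of \<open>-sw\<close> if \<open>\<ell>\<close> does not divide \<open>m\<close>, and \<open>0\<close> otherwise.  Thus the difference keeps exactly the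
  terms with \<open>\<ell>\<close> dividing \<open>m\<close>, and for those \<open>b(\<ell>m) = \<chi>(\<ell>) b(m)\<close> turns the coefficients of
  \<open>g(\<tau>)\<close> into those of \<open>g(\<ell>\<tau>)\<close>.
\<close>

text \<open>The order \<open>v = (l - 1) div 2\<close> is what makes the binomials collapse: for the
  weights \<open>3/2\<close> and \<open>1/2\<close> their upper entries become \<open>l/2\<close>
  and \<open>l/2 - 1\<close>, which act like \<open>0\<close> and \<open>-1\<close> modulo
  \<open>l\<close>. Half-integral weight is the analytic obstacle. Principal square roots obey the
  cocycle rule only up to sign, so at a cusp \<open>g\<close> is merely multiplied by some unknown
  constant under translation, and the exponent \<open>x\<close> has to be recovered from that
  constant. Three facts that are not among the hypotheses come from the two expansions of
  \<open>g\<close>, as an eta-quotient and as a theta series: \<open>s/w\<close> is positive (by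
  Liouville's theorem), the leading exponent \<open>t/w\<close> is nonnegative, and
  \<open>chi l\<close> is an integer (it is a coefficient of the eta product). The shift by
  \<open>t/w * (l^2 - 1)\<close> in the index of \<open>a\<close> has a simple origin: replacing
  \<open>m\<close> by \<open>l m\<close> multiplies the exponent of \<open>g\<close> by
  \<open>l^2\<close>, and the exponents of \<open>g\<close> are \<open>t/w\<close> plus an
  integer.\<close>

no_notation fps_nth (infixl \<open>$\<close> 75)

section \<open>Rankin--Cohen brackets under \<open>SL\<^sub>2(\<int>)\<close>\<close>

lemma open_uhp: "open uhp"
  unfolding uhp_def by (rule open_halfspace_Im_gt)

lemma convex_uhp: "convex uhp"
  unfolding uhp_def by (rule convex_halfspace_Im_gt)

definition denom :: "int^2^2 \<Rightarrow> complex \<Rightarrow> complex" where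
  "denom A \<tau> = of_int (A $ 2 $ 1) * \<tau> + of_int (A $ 2 $ 2)"

lemma SL2Z_det: "A \<in> SL2Z \<Longrightarrow> A $ 1 $ 1 * A $ 2 $ 2 - A $ 1 $ 2 * A $ 2 $ 1 = 1"
  by (simp add: SL2Z_def det_2)

lemma SL2Z_det_of_int:
  assumes "A \<in> SL2Z"
  shows "(of_int (A $ 1 $ 1) * of_int (A $ 2 $ 2) - of_int (A $ 1 $ 2) * of_int (A $ 2 $ 1) :: 'a::comm_ring_1) = 1"
  using SL2Z_det[OF assms] by (metis of_int_1 of_int_diff of_int_mult)

lemma SL2Z_lower_left_zero:
  assumes "A \<in> SL2Z" "A $ 2 $ 1 = 0"
  shows "A $ 2 $ 2 = 1 \<or> A $ 2 $ 2 = -1"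
  using SL2Z_det[OF assms(1)] assms(2) by (simp add: zmult_eq_1_iff) metis

lemma denom_nonzero:
  assumes "A \<in> SL2Z" "\<tau> \<in> uhp"
  shows "denom A \<tau> \<noteq> 0"
proof
  assume *: "denom A \<tau> = 0"
  hence "Im (denom A \<tau>) = 0" by simp
  hence c: "A $ 2 $ 1 = 0" using assms(2) by (simp add: denom_def uhp_def)
  with * SL2Z_lower_left_zero[OF assms(1) c] show False by (auto simp: denom_def)
qed

lemma Im_moebius:
  assumes "A \<in> SL2Z" "\<tau> \<in> uhp"
  shows "Im (moebius A \<tau>) = Im \<tau> / (cmod (denom A \<tau>))\<^sup>2"
proof -
  have "Im (moebius A \<tau>) = (of_int (A $ 1 $ 1) * of_int (A $ 2 $ 2) - of_int (A $ 1 $ 2) * of_int (A $ 2 $ 1)) * Im \<tau> / (cmod (denom A \<tau>))\<^sup>2"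
    unfolding moebius_def Im_divide cmod_power2 denom_def
    by (simp add: algebra_simps)
  thus ?thesis using SL2Z_det_of_int[OF assms(1), where 'a=real] by simp
qed

lemma moebius_in_uhp:
  assumes "A \<in> SL2Z" "\<tau> \<in> uhp"
  shows "moebius A \<tau> \<in> uhp"
  using Im_moebius[OF assms] denom_nonzero[OF assms] assms(2) by (simp add: uhp_def)

lemma has_field_derivative_denom: "(denom A has_field_derivative of_int (A $ 2 $ 1)) (at \<tau>)"
  unfolding denom_def by (auto intro!: derivative_eq_intros)

lemma has_field_derivative_moebius:
  assumes "A \<in> SL2Z" "\<tau> \<in> uhp"
  shows "(moebius A has_field_derivative 1 / (denom A \<tau>)\<^sup>2) (at \<tau>)"
proof -
  have nz: "of_int (A $ 2 $ 1) * \<tau> + of_int (A $ 2 $ 2) \<noteq> 0"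
    using denom_nonzero[OF assms] by (simp add: denom_def)
  have "of_int (A $ 1 $ 1) * (of_int (A $ 2 $ 1) * \<tau> + of_int (A $ 2 $ 2)) -
        (of_int (A $ 1 $ 1) * \<tau> + of_int (A $ 1 $ 2)) * of_int (A $ 2 $ 1) = (1 :: complex)"
    using SL2Z_det_of_int[OF assms(1), where 'a=complex] by (simp add: algebra_simps)
  thus ?thesis using nz unfolding moebius_def denom_def
    by (auto intro!: derivative_eq_intros simp: power2_eq_square)
qed

lemma autfac_nonzero: "A \<in> SL2Z \<Longrightarrow> \<tau> \<in> uhp \<Longrightarrow> autfac k A \<tau> \<noteq> 0"
  using denom_nonzero[of A \<tau>] by (simp add: autfac_def denom_def)

lemma autfac_add: "autfac (k + k') A \<tau> = autfac k A \<tau> * autfac k' A \<tau>"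
  by (simp add: autfac_def powr_add)

lemma autfac_of_nat: "A \<in> SL2Z \<Longrightarrow> \<tau> \<in> uhp \<Longrightarrow> autfac (real n) A \<tau> = denom A \<tau> ^ n"
  using denom_nonzero[of A \<tau>] by (simp add: autfac_def denom_def powr_nat')

text \<open>The principal power is differentiable off the nonpositive reals. For
  \<open>\<tau>\<close> in the half-plane the base is real only if the lower left entry is
  \<open>0\<close>, and then the factor is constant in \<open>\<tau>\<close>.\<close>

lemma has_field_derivative_autfac:
  assumes "A \<in> SL2Z" "\<tau> \<in> uhp"
  shows "(autfac k A has_field_derivative
           of_real k * of_int (A $ 2 $ 1) * autfac k A \<tau> / denom A \<tau>) (at \<tau>)"
proof (cases "A $ 2 $ 1 = 0")
  case True
  thus ?thesis by (simp add: autfac_def[abs_def])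
next
  case False
  have "denom A \<tau> \<notin> \<real>\<^sub>\<le>\<^sub>0"
    using False assms(2) by (auto simp: denom_def uhp_def complex_nonpos_Reals_iff)
  hence "((\<lambda>\<tau>. denom A \<tau> powr of_real k) has_field_derivative
      of_real k * denom A \<tau> powr (of_real k - 1) * of_int (A $ 2 $ 1)) (at \<tau>)"
    using has_field_derivative_denom
    by (intro DERIV_chain2[of "\<lambda>z. z powr of_real k", OF has_field_derivative_powr]) auto
  thus ?thesis using denom_nonzero[OF assms]
    by (simp add: autfac_def[abs_def] denom_def powr_diff mult_ac)
qed

section \<open>The operator D, the bracket and their transformation law\<close>

lemma holomorphic_qderiv_funpow:
  assumes "f holomorphic_on S" "open S"
  shows "(qderiv ^^ n) f holomorphic_on S"
  by (induction n) (use assms in \<open>auto simp: qderiv_def[abs_def] intro!: holomorphic_intros holomorphic_deriv\<close>)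

lemma qderiv_funpow_cmult:
  assumes "f holomorphic_on S" "open S" "\<tau> \<in> S"
  shows "(qderiv ^^ n) (\<lambda>\<tau>. c * f \<tau>) \<tau> = c * (qderiv ^^ n) f \<tau>"
  using assms(3)
proof (induction n arbitrary: \<tau>)
  case (Suc n)
  have "eventually (\<lambda>z. (qderiv ^^ n) (\<lambda>\<tau>. c * f \<tau>) z = c * (qderiv ^^ n) f z) (nhds \<tau>)"
    using assms(2) Suc.prems Suc.IH by (auto simp: eventually_nhds)
  hence "deriv ((qderiv ^^ n) (\<lambda>\<tau>. c * f \<tau>)) \<tau> = deriv (\<lambda>z. c * (qderiv ^^ n) f z) \<tau>"
    by (intro deriv_cong_ev) auto
  also have "\<dots> = c * deriv ((qderiv ^^ n) f) \<tau>"
    using holomorphic_qderiv_funpow[OF assms(1,2)] assms(2) Suc.prems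
    by (intro deriv_cmult) (auto simp: holomorphic_on_open field_differentiable_def)
  finally show ?case
    by (simp add: qderiv_def[of "(qderiv ^^ n) f"] qderiv_def[of "(qderiv ^^ n) (\<lambda>\<tau>. c * f \<tau>)"])
qed auto

lemma rankin_cohen_cmult:
  assumes "f holomorphic_on S" "g holomorphic_on S" "open S" "\<tau> \<in> S"
  shows "rankin_cohen a b v (\<lambda>\<tau>. c * f \<tau>) (\<lambda>\<tau>. d * g \<tau>) \<tau> = c * d * rankin_cohen a b v f g \<tau>"
  unfolding rankin_cohen_def
  using qderiv_funpow_cmult[OF assms(1,3,4)] qderiv_funpow_cmult[OF assms(2,3,4)]
  by (simp add: sum_distrib_left mult_ac)

lemma holomorphic_rankin_cohen:
  assumes "f holomorphic_on S" "g holomorphic_on S" "open S"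
  shows "rankin_cohen a b v f g holomorphic_on S"
  unfolding rankin_cohen_def[abs_def]
  by (intro holomorphic_intros holomorphic_qderiv_funpow assms)

text \<open>A coefficient of the Cohen-Kuznetsov series of \<open>f\<close>. Where it is used
  \<open>a\<close> is positive, so the Pochhammer symbol in the denominator does not vanish.\<close>

definition normalized_qderiv :: "real \<Rightarrow> (complex \<Rightarrow> complex) \<Rightarrow> nat \<Rightarrow> complex \<Rightarrow> complex" where
  "normalized_qderiv a f n \<tau> = (qderiv ^^ n) f \<tau> / (fact n * pochhammer (of_real a) n)"

lemma pochhammer_of_real_nonzero: "a > 0 \<Longrightarrow> pochhammer (of_real a :: complex) n \<noteq> 0"
  using pochhammer_pos[of a n] by (simp add: pochhammer_of_real)

lemma has_field_derivative_normalized_qderiv: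
  assumes "f holomorphic_on uhp" "\<tau> \<in> uhp" "a > 0"
  shows "(normalized_qderiv a f n has_field_derivative
      2 * of_real pi * \<i> * of_nat (Suc n) * (of_real a + of_nat n) * normalized_qderiv a f (Suc n) \<tau>) (at \<tau>)"
proof -
  define P where "P = pochhammer (complex_of_real a) n"
  have P: "P \<noteq> 0" "complex_of_real a + of_nat n \<noteq> 0"
    using pochhammer_of_real_nonzero[OF assms(3), of n] pochhammer_of_real_nonzero[OF assms(3), of "Suc n"]
    by (auto simp: P_def pochhammer_rec')
  have "((qderiv ^^ n) f has_field_derivative deriv ((qderiv ^^ n) f) \<tau>) (at \<tau>)"
    by (rule holomorphic_derivI[OF holomorphic_qderiv_funpow[OF assms(1) open_uhp] open_uhp assms(2)])
  hence "((\<lambda>\<tau>. (qderiv ^^ n) f \<tau> / (fact n * P)) has_field_derivative deriv ((qderiv ^^ n) f) \<tau> / (fact n * P)) (at \<tau>)"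
    by (rule DERIV_cdivide)
  also have "deriv ((qderiv ^^ n) f) \<tau> / (fact n * P) = 
     2 * of_real pi * \<i> * of_nat (Suc n) * (of_real a + of_nat n) * normalized_qderiv a f (Suc n) \<tau>"
    using P
    by (simp add: normalized_qderiv_def qderiv_def[of "(qderiv ^^ n) f"] pochhammer_rec' P_def[symmetric] del: of_nat_Suc)
  finally show ?thesis by (simp add: normalized_qderiv_def[abs_def] P_def)
qed

text \<open>This is the coefficient of \<open>X^n\<close> in the law that the series of
  \<open>f\<close> at \<open>A\<tau>\<close> equals \<open>autfac a A \<tau>\<close> times
  \<open>exp (\<kappa> j X)\<close> times the series of \<open>F\<close> at \<open>\<tau>\<close> in
  \<open>j^2 X\<close>, where \<open>j = denom A \<tau>\<close>. Allowing \<open>F\<close> to differ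
  from \<open>f\<close> covers both a multiplier on the group and the passage to another cusp. The
  induction differentiates the identity for \<open>n\<close>.\<close>

lemma normalized_qderiv_moebius:
  assumes A: "A \<in> SL2Z" and a: "a > 0" and hol: "f holomorphic_on uhp" "F holomorphic_on uhp"
    and F: "\<And>\<tau>. \<tau> \<in> uhp \<Longrightarrow> f (moebius A \<tau>) = autfac a A \<tau> * F \<tau>"
    and \<tau>: "\<tau> \<in> uhp"
  defines "\<kappa> \<equiv> of_int (A $ 2 $ 1) / (2 * of_real pi * \<i>)"
  shows "normalized_qderiv a f n (moebius A \<tau>) =
    autfac a A \<tau> * (\<Sum>r\<le>n. \<kappa> ^ (n - r) / fact (n - r) * denom A \<tau> ^ (n + r) * normalized_qderiv a F r \<tau>)"
  using \<tau>
proof (induction n arbitrary: \<tau>)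
  case 0
  thus ?case using F by (simp add: normalized_qderiv_def)
next
  case (Suc n)
  define j where "j = denom A \<tau>"
  define J where "J = autfac a A \<tau>"
  define c0 where "c0 = 2 * complex_of_real pi * \<i>"
  define \<phi> where "\<phi> = (\<lambda>r. normalized_qderiv a F r \<tau>)"
  define aa where "aa = complex_of_real a"
  have nz: "j \<noteq> 0" "c0 \<noteq> 0" "aa + of_nat n \<noteq> 0" "of_nat (Suc n) \<noteq> (0::complex)"
    using denom_nonzero[OF A Suc.prems] pochhammer_of_real_nonzero[OF a, of "Suc n"]
    by (auto simp: j_def c0_def aa_def pochhammer_rec' simp del: of_nat_Suc)
  have cc: "of_int (A $ 2 $ 1) = c0 * \<kappa>" using nz(2) by (simp add: \<kappa>_def c0_def)
  \<comment> \<open>Up to the factor \<open>1 / j^2\<close> from the derivative of the Moebius map,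
    this is the derivative of the left side. It contains the wanted coefficient of index
    \<open>Suc n\<close> times a nonzero constant, which is cancelled at the end.\<close>
  define L where "L = c0 * of_nat (Suc n) * (aa + of_nat n) * normalized_qderiv a f (Suc n) (moebius A \<tau>)"
  have d1: "((\<lambda>\<tau>. normalized_qderiv a f n (moebius A \<tau>)) has_field_derivative L * (1 / j\<^sup>2)) (at \<tau>)"
    unfolding L_def c0_def j_def aa_def
    by (rule DERIV_chain2[OF has_field_derivative_normalized_qderiv[OF hol(1) moebius_in_uhp[OF A Suc.prems] a]
          has_field_derivative_moebius[OF A Suc.prems]])
  define E where "E = (\<lambda>r. \<kappa> ^ (n - r) / fact (n - r))"
  have d2: "((\<lambda>\<tau>. autfac a A \<tau> * (\<Sum>r\<le>n. E r * denom A \<tau> ^ (n + r) * normalized_qderiv a F r \<tau>))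
     has_field_derivative
      (aa * (c0 * \<kappa>) * J / j * (\<Sum>r\<le>n. E r * j ^ (n + r) * \<phi> r) +
       (\<Sum>r\<le>n. E r * (of_nat (n + r) * (c0 * \<kappa>) * j ^ (n + r) / j) * \<phi> r
               + c0 * of_nat (Suc r) * (aa + of_nat r) * \<phi> (Suc r) * (E r * j ^ (n + r))) * J)) (at \<tau>)"
  proof -
    have pw: "((\<lambda>\<tau>. E r * denom A \<tau> ^ m) has_field_derivative E r * (of_nat m * (c0 * \<kappa>) * j ^ m / j)) (at \<tau>)" for r m
    proof -
      have "((\<lambda>\<tau>. denom A \<tau> ^ m) has_field_derivative of_nat m * (of_int (A $ 2 $ 1) * denom A \<tau> ^ (m - Suc 0))) (at \<tau>)"
        by (rule DERIV_power[OF has_field_derivative_denom])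
      also have "of_nat m * (of_int (A $ 2 $ 1) * denom A \<tau> ^ (m - Suc 0)) = of_nat m * (c0 * \<kappa>) * j ^ m / j"
        using nz(1) by (cases m) (auto simp: cc j_def)
      finally show ?thesis by (rule DERIV_cmult)
    qed
    show ?thesis
      unfolding J_def \<phi>_def aa_def cc[symmetric] unfolding j_def c0_def
      by (intro DERIV_mult has_field_derivative_autfac[OF A Suc.prems] DERIV_sum
            pw[unfolded cc[symmetric], unfolded j_def] has_field_derivative_normalized_qderiv[OF hol(2) Suc.prems a])
  qed
  have "L * (1 / j\<^sup>2) = aa * (c0 * \<kappa>) * J / j * (\<Sum>r\<le>n. E r * j ^ (n + r) * \<phi> r) +
       (\<Sum>r\<le>n. E r * (of_nat (n + r) * (c0 * \<kappa>) * j ^ (n + r) / j) * \<phi> r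
               + c0 * of_nat (Suc r) * (aa + of_nat r) * \<phi> (Suc r) * (E r * j ^ (n + r))) * J" (is "_ = ?R")
    using DERIV_unique[OF has_field_derivative_transform_within_open[OF d1 open_uhp Suc.prems] d2] Suc.IH
    by (auto simp: E_def)
  moreover have "L = L * (1 / j\<^sup>2) * j\<^sup>2" using nz(1) by simp
  ultimately have "L = ?R * j\<^sup>2" by (simp only:)
  also have "\<dots> = (\<Sum>r\<le>n. c0 * J * (E r * (aa + of_nat (n + r)) * \<kappa> * j ^ (n + r + 1) * \<phi> r
       + E r * j ^ (n + r + 2) * (of_nat (Suc r) * (aa + of_nat r) * \<phi> (Suc r))))"
    unfolding sum_distrib_left sum_distrib_right sum.distrib[symmetric]
  proof (intro sum.cong refl)
    fix r
    define x where "x = j ^ (n + r)"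
    define y where "y = complex_of_nat (Suc r)"
    have "j ^ (n + r + 1) = x * j" "j ^ (n + r + 2) = x * (j * j)"
      by (simp_all add: x_def)
    moreover have "(aa * (c0 * \<kappa>) * J / j * (e * x * p) + (e * (m * (c0 * \<kappa>) * x / j) * p + c0 * y * z * q * (e * x)) * J) * (j * j)
      = c0 * J * (e * (aa + m) * \<kappa> * (x * j) * p + e * (x * (j * j)) * (y * z * q))" for e p m z q
      using nz(1) by (simp add: divide_simps) (simp add: algebra_simps)
    ultimately show "(aa * (c0 * \<kappa>) * J / j * (E r * j ^ (n + r) * \<phi> r) +
          (E r * (of_nat (n + r) * (c0 * \<kappa>) * j ^ (n + r) / j) * \<phi> r + c0 * of_nat (Suc r) * (aa + of_nat r) * \<phi> (Suc r) * (E r * j ^ (n + r))) * J) * j\<^sup>2 =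
         c0 * J * (E r * (aa + of_nat (n + r)) * \<kappa> * j ^ (n + r + 1) * \<phi> r
       + E r * j ^ (n + r + 2) * (of_nat (Suc r) * (aa + of_nat r) * \<phi> (Suc r)))"
      unfolding x_def[symmetric] y_def[symmetric] power2_eq_square by (simp only:)
  qed
  also have "\<dots> = c0 * J * ((\<Sum>r\<le>n. \<kappa> ^ (n - r) / fact (n - r) * (aa + of_nat (n + r)) * \<kappa> * j ^ (n + r + 1) * \<phi> r)
     + (\<Sum>r\<le>n. \<kappa> ^ (n - r) / fact (n - r) * j ^ (n + r + 2) * (of_nat (Suc r) * (aa + of_nat r) * \<phi> (Suc r))))"
    by (simp only: sum_distrib_left sum.distrib E_def distrib_left)
  \<comment> \<open>Both sums are brought to the range \<open>r \<le> Suc n\<close>. The first gains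
    the term \<open>r = Suc n\<close>, killed by the factor \<open>Suc n - r\<close>; the second is
    shifted by one and gains the term \<open>r = 0\<close>, killed by the factor
    \<open>r\<close>.\<close>
  also have "(\<Sum>r\<le>n. \<kappa> ^ (n - r) / fact (n - r) * (aa + of_nat (n + r)) * \<kappa> * j ^ (n + r + 1) * \<phi> r)
     = (\<Sum>r\<le>Suc n. of_nat (Suc n - r) * (aa + of_nat (n + r)) * (\<kappa> ^ (Suc n - r) / fact (Suc n - r) * j ^ (Suc n + r) * \<phi> r))"
  proof -
    have *: "\<kappa> ^ (n - r) / fact (n - r) * \<kappa> = of_nat (Suc n - r) * (\<kappa> ^ (Suc n - r) / fact (Suc n - r))" if "r \<le> n" for r
      using that by (simp add: Suc_diff_le del: of_nat_Suc)
    have "\<kappa> ^ (n - r) / fact (n - r) * (aa + of_nat (n + r)) * \<kappa> * j ^ (n + r + 1) * \<phi> r =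
      of_nat (Suc n - r) * (aa + of_nat (n + r)) * (\<kappa> ^ (Suc n - r) / fact (Suc n - r) * j ^ (Suc n + r) * \<phi> r)"
      if "r \<le> n" for r
    proof -
      have "\<kappa> ^ (n - r) / fact (n - r) * (aa + of_nat (n + r)) * \<kappa> * j ^ (n + r + 1) * \<phi> r =
        (\<kappa> ^ (n - r) / fact (n - r) * \<kappa>) * ((aa + of_nat (n + r)) * j ^ (Suc n + r) * \<phi> r)"
        by (simp only: mult_ac Suc_eq_plus1 add_ac)
      also have "\<dots> = of_nat (Suc n - r) * (\<kappa> ^ (Suc n - r) / fact (Suc n - r)) * ((aa + of_nat (n + r)) * j ^ (Suc n + r) * \<phi> r)"
        by (simp only: * [OF that])
      finally show ?thesis by (simp only: mult_ac)
    qed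
    thus ?thesis by (simp del: of_nat_Suc power_Suc fact_Suc of_nat_diff)
  qed
  also have "(\<Sum>r\<le>n. \<kappa> ^ (n - r) / fact (n - r) * j ^ (n + r + 2) * (of_nat (Suc r) * (aa + of_nat r) * \<phi> (Suc r)))
     = (\<Sum>r\<le>Suc n. of_nat r * (aa + of_nat r - 1) * (\<kappa> ^ (Suc n - r) / fact (Suc n - r) * j ^ (Suc n + r) * \<phi> r))"
    by (subst sum.atMost_Suc_shift) (simp add: mult_ac)
  also have "(\<Sum>r\<le>Suc n. of_nat (Suc n - r) * (aa + of_nat (n + r)) * (\<kappa> ^ (Suc n - r) / fact (Suc n - r) * j ^ (Suc n + r) * \<phi> r))
     + \<dots> = (\<Sum>r\<le>Suc n. of_nat (Suc n) * (aa + of_nat n) * (\<kappa> ^ (Suc n - r) / fact (Suc n - r) * j ^ (Suc n + r) * \<phi> r))"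
    unfolding sum.distrib[symmetric] distrib_right[symmetric]
  proof (intro sum.cong refl)
    fix r assume "r \<in> {..Suc n}"
    hence "of_nat (Suc n - r) = (of_nat n + 1 - of_nat r :: complex)" by (simp add: of_nat_diff)
    \<comment> \<open>The two weights of the \<open>r\<close>-th term add up to a constant
      independent of \<open>r\<close>; exactly this constant stands in front of the coefficient of
      index \<open>Suc n\<close> in \<open>L\<close>.\<close>
    moreover have "(N + 1 - R) * (aa + (N + R)) + R * (aa + R - 1) = (N + 1) * (aa + N)" for N R :: complex
      by (simp add: algebra_simps)
    ultimately have "of_nat (Suc n - r) * (aa + of_nat (n + r)) + of_nat r * (aa + of_nat r - 1) = of_nat (Suc n) * (aa + of_nat n)"
      by (simp only: of_nat_add of_nat_Suc add.commute[of 1])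
    thus "(of_nat (Suc n - r) * (aa + of_nat (n + r)) + of_nat r * (aa + of_nat r - 1)) * (\<kappa> ^ (Suc n - r) / fact (Suc n - r) * j ^ (Suc n + r) * \<phi> r)
     = of_nat (Suc n) * (aa + of_nat n) * (\<kappa> ^ (Suc n - r) / fact (Suc n - r) * j ^ (Suc n + r) * \<phi> r)" by simp
  qed
  finally have "L = c0 * of_nat (Suc n) * (aa + of_nat n) * (J * (\<Sum>r\<le>Suc n. \<kappa> ^ (Suc n - r) / fact (Suc n - r) * j ^ (Suc n + r) * \<phi> r))"
    unfolding sum_distrib_left[symmetric] by (simp only: mult_ac)
  moreover have "c0 * of_nat (Suc n) * (aa + of_nat n) \<noteq> 0" using nz by (simp del: of_nat_Suc)
  ultimately show ?case unfolding L_def J_def j_def \<phi>_def by (rule iffD1[OF mult_left_cancel, rotated])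
qed

text \<open>By \<open>binom(x+v-1, k) = (x)_v / ((x)_(v-k) k!)\<close> the binomial formed with
  \<open>a\<close> supplies \<open>(a)_j\<close> and \<open>(v-j)!\<close>, the one formed with
  \<open>b\<close> supplies \<open>(b)_(v-j)\<close> and \<open>j!\<close>. Exchanging the two
  factorials gives each series its own normalisation.\<close>

lemma rankin_cohen_eq_fps_nth:
  assumes "a > 0" "b > 0"
  shows "rankin_cohen a b v f g \<tau> = pochhammer (of_real a) v * pochhammer (of_real b) v *
     fps_nth (Abs_fps (\<lambda>n. (-1) ^ n * normalized_qderiv a f n \<tau>) * Abs_fps (\<lambda>n. normalized_qderiv b g n \<tau>)) v"
proof -
  have gb: "complex_of_real ((x + real v - 1) gchoose k) = pochhammer (of_real x) v / (pochhammer (of_real x) (v - k) * fact k)"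
    if "x > 0" "k \<le> v" for x k
  proof -
    have "(x + real v - 1) gchoose k = pochhammer (x + real (v - k)) k / fact k"
      using that(2) by (simp add: gbinomial_pochhammer' of_nat_diff algebra_simps)
    moreover have "pochhammer x v = pochhammer x (v - k) * pochhammer (x + real (v - k)) k"
      using pochhammer_product[of "v - k" v x] that(2) by simp
    moreover have "pochhammer x (v - k) \<noteq> 0" using pochhammer_pos[OF that(1), of "v - k"] by simp
    ultimately have "(x + real v - 1) gchoose k = pochhammer x v / (pochhammer x (v - k) * fact k)"
      by simp
    thus ?thesis by (simp add: pochhammer_of_real)
  qed
  show ?thesis unfolding rankin_cohen_def fps_mult_nth sum_distrib_left
    by (intro sum.cong) (auto simp: gb assms normalized_qderiv_def atMost_atLeast0 mult_ac)
qed

text \<open>No relation between \<open>f\<close> and \<open>F\<close>, or \<open>g\<close> and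
  \<open>G\<close>, is required beyond the transformation under the single matrix \<open>A\<close>.
  Hence the theorem serves for modularity and for the expansion at any cusp.\<close>

theorem rankin_cohen_moebius:
  assumes A: "A \<in> SL2Z" and ab: "a > 0" "b > 0"
    and hol: "f holomorphic_on uhp" "F holomorphic_on uhp" "g holomorphic_on uhp" "G holomorphic_on uhp"
    and F: "\<And>\<tau>. \<tau> \<in> uhp \<Longrightarrow> f (moebius A \<tau>) = autfac a A \<tau> * F \<tau>"
    and G: "\<And>\<tau>. \<tau> \<in> uhp \<Longrightarrow> g (moebius A \<tau>) = autfac b A \<tau> * G \<tau>"
    and \<tau>: "\<tau> \<in> uhp"
  shows "rankin_cohen a b v f g (moebius A \<tau>) = autfac (a + b + 2 * real v) A \<tau> * rankin_cohen a b v F G \<tau>"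
proof -
  define j where "j = denom A \<tau>"
  define \<kappa> where "\<kappa> = of_int (A $ 2 $ 1) / (2 * complex_of_real pi * \<i>)"
  define P where "P = Abs_fps (\<lambda>n. (j\<^sup>2) ^ n * ((-1) ^ n * normalized_qderiv a F n \<tau>))"
  define Q where "Q = Abs_fps (\<lambda>n. (j\<^sup>2) ^ n * normalized_qderiv b G n \<tau>)"
  have pw: "j ^ (n + r) = j ^ (n - r) * (j\<^sup>2) ^ r" if "r \<le> n" for n r
    using that by (simp add: add.commute flip: power_mult power_add)
  have nf: "normalized_qderiv a f n (moebius A \<tau>) = autfac a A \<tau> * (\<Sum>r\<le>n. \<kappa> ^ (n - r) / fact (n - r) * j ^ (n + r) * normalized_qderiv a F r \<tau>)" for n
    unfolding \<kappa>_def j_def by (rule normalized_qderiv_moebius) (use A ab hol F \<tau> in auto)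
  have ng: "normalized_qderiv b g n (moebius A \<tau>) = autfac b A \<tau> * (\<Sum>r\<le>n. \<kappa> ^ (n - r) / fact (n - r) * j ^ (n + r) * normalized_qderiv b G r \<tau>)" for n
    unfolding \<kappa>_def j_def by (rule normalized_qderiv_moebius) (use A ab hol G \<tau> in auto)
  have 1: "Abs_fps (\<lambda>n. (-1) ^ n * normalized_qderiv a f n (moebius A \<tau>)) =
      fps_const (autfac a A \<tau>) * (P * fps_exp (- (\<kappa> * j)))"
  proof (rule fps_ext)
    fix n
    have s: "(-1) ^ n = (-1) ^ r * ((-1) ^ (n - r) :: complex)" if "r \<le> n" for r
      using that by (simp flip: power_add)
    have m: "(- (\<kappa> * j)) ^ k = (-1) ^ k * (\<kappa> ^ k * j ^ k)" for k
      by (metis mult_minus1 power_mult_distrib)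
    show "fps_nth (Abs_fps (\<lambda>n. (-1) ^ n * normalized_qderiv a f n (moebius A \<tau>))) n =
      fps_nth (fps_const (autfac a A \<tau>) * (P * fps_exp (- (\<kappa> * j)))) n"
      unfolding fps_mult_left_const_nth unfolding fps_mult_nth fps_nth_Abs_fps P_def fps_exp_nth
        nf sum_distrib_left atMost_atLeast0
      by (intro sum.cong) (auto simp: pw s m)
  qed
  have 2: "Abs_fps (\<lambda>n. normalized_qderiv b g n (moebius A \<tau>)) =
      fps_const (autfac b A \<tau>) * (Q * fps_exp (\<kappa> * j))"
  proof (rule fps_ext)
    fix n
    show "fps_nth (Abs_fps (\<lambda>n. normalized_qderiv b g n (moebius A \<tau>))) n =
      fps_nth (fps_const (autfac b A \<tau>) * (Q * fps_exp (\<kappa> * j))) n"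
      unfolding fps_mult_left_const_nth unfolding fps_mult_nth fps_nth_Abs_fps Q_def fps_exp_nth
        ng sum_distrib_left atMost_atLeast0
      by (intro sum.cong) (auto simp: pw power_mult_distrib)
  qed
  have e: "fps_exp (- (\<kappa> * j)) * fps_exp (\<kappa> * j) = 1"
    by (simp flip: fps_exp_add_mult)
  have "Abs_fps (\<lambda>n. (-1) ^ n * normalized_qderiv a f n (moebius A \<tau>)) * Abs_fps (\<lambda>n. normalized_qderiv b g n (moebius A \<tau>))
     = fps_const (autfac a A \<tau> * autfac b A \<tau>) * (P * Q) * (fps_exp (- (\<kappa> * j)) * fps_exp (\<kappa> * j))"
    unfolding 1 2 by (simp add: mult_ac flip: fps_const_mult)
  hence "fps_nth (Abs_fps (\<lambda>n. (-1) ^ n * normalized_qderiv a f n (moebius A \<tau>)) * Abs_fps (\<lambda>n. normalized_qderiv b g n (moebius A \<tau>))) v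
     = autfac (a + b) A \<tau> * fps_nth (P * Q) v"
    unfolding e by (simp add: autfac_add)
  \<comment> \<open>Rescaling \<open>X\<close> by \<open>j^2\<close> multiplies the coefficient of
    \<open>X^v\<close> by \<open>j^(2v)\<close>, which accounts for the weight \<open>2v\<close>
    gained by the bracket.\<close>
  also have "fps_nth (P * Q) v = (j\<^sup>2) ^ v * fps_nth (Abs_fps (\<lambda>n. (-1) ^ n * normalized_qderiv a F n \<tau>) * Abs_fps (\<lambda>n. normalized_qderiv b G n \<tau>)) v"
    unfolding P_def Q_def fps_mult_nth fps_nth_Abs_fps sum_distrib_left
  proof (intro sum.cong refl)
    fix i assume "i \<in> {0..v}"
    hence "(j\<^sup>2) ^ v = (j\<^sup>2) ^ i * (j\<^sup>2) ^ (v - i)" by (simp flip: power_add)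
    thus "(j\<^sup>2) ^ i * ((- 1) ^ i * normalized_qderiv a F i \<tau>) * ((j\<^sup>2) ^ (v - i) * normalized_qderiv b G (v - i) \<tau>) =
         (j\<^sup>2) ^ v * ((- 1) ^ i * normalized_qderiv a F i \<tau> * normalized_qderiv b G (v - i) \<tau>)"
      by (simp only: mult_ac)
  qed
  also have "autfac (a + b) A \<tau> * ((j\<^sup>2) ^ v * X) = autfac (a + b + 2 * real v) A \<tau> * X" for X
    using autfac_of_nat[OF A \<tau>, of "2 * v"] unfolding autfac_add[of "a + b" "2 * real v"]
    by (simp add: j_def power_mult)
  finally show ?thesis unfolding rankin_cohen_eq_fps_nth[OF ab] by (simp only: mult_ac)
qed

section \<open>Behaviour at the cusps\<close>

lemma norm_qpow: "cmod (qpow x \<tau>) = exp (- (2 * pi * x * Im \<tau>))"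
  by (simp add: qpow_def norm_exp_eq_Re)

lemma qpow_nonzero [simp]: "qpow x \<tau> \<noteq> 0"
  by (simp add: qpow_def)

lemma qpow_add: "qpow (x + y) \<tau> = qpow x \<tau> * qpow y \<tau>"
  by (simp add: qpow_def algebra_simps flip: exp_add)

lemma qpow_0 [simp]: "qpow 0 \<tau> = 1"
  by (simp add: qpow_def)

lemma qpow_of_nat_mult: "qpow (real n * x) \<tau> = qpow x \<tau> ^ n"
  by (simp add: qpow_def mult_ac flip: exp_of_nat_mult)

lemma qpow_minus_mult [simp]: "qpow (- x) \<tau> * qpow x \<tau> = 1"
  by (simp flip: qpow_add)

lemma has_field_derivative_qpow:
  "(qpow x has_field_derivative (2 * of_real pi * \<i> * of_real x) * qpow x \<tau>) (at \<tau>)"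
  unfolding qpow_def[abs_def] by (auto intro!: derivative_eq_intros)

lemma holomorphic_qpow [holomorphic_intros]: "qpow x holomorphic_on S"
  unfolding qpow_def[abs_def] by (intro holomorphic_intros)

lemma norm_qpow_less_1: "x > 0 \<Longrightarrow> \<tau> \<in> uhp \<Longrightarrow> cmod (qpow x \<tau>) < 1"
  by (simp add: norm_qpow uhp_def)

lemma qpow_in_ball: "x > 0 \<Longrightarrow> \<tau> \<in> uhp \<Longrightarrow> qpow x \<tau> \<in> ball 0 1"
  using norm_qpow_less_1 by simp

text \<open>The value of \<open>Im \<tau>\<close> is recorded because it turns bounds near
  \<open>i\<infinity>\<close> into bounds near \<open>0\<close> in the disc.\<close>

lemma qpow_surj:
  assumes "h > 0" "z \<noteq> 0" "cmod z < 1"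
  obtains \<tau> where "\<tau> \<in> uhp" "qpow (1 / h) \<tau> = z" "Im \<tau> = - (h * ln (cmod z)) / (2 * pi)"
proof
  define \<tau> where "\<tau> = of_real (h / (2 * pi)) * (- \<i> * Ln z)"
  have "2 * complex_of_real pi * \<i> * of_real (1 / h) * \<tau> = Ln z"
    using assms(1) by (simp add: \<tau>_def)
  thus "qpow (1 / h) \<tau> = z" using assms(2) by (simp add: qpow_def)
  show im: "Im \<tau> = - (h * ln (cmod z)) / (2 * pi)" using assms(2) by (simp add: \<tau>_def)
  have "ln (cmod z) < 0" using assms by simp
  thus "\<tau> \<in> uhp" using im assms(1) by (simp add: uhp_def mult_pos_neg divide_neg_pos)
qed

lemma qpow_eq_imp_translate:
  assumes "h > 0" "qpow (1 / h) \<tau> = qpow (1 / h) \<tau>'"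
  obtains n :: int where "\<tau> = \<tau>' + of_int n * of_real h"
proof -
  from assms(2) obtain n :: int where
    n: "2 * of_real pi * \<i> * of_real (1 / h) * \<tau> = 2 * of_real pi * \<i> * of_real (1 / h) * \<tau>' + of_int (2 * n) * of_real pi * \<i>"
    by (auto simp: qpow_def exp_eq)
  have "\<tau> = (of_real h / (2 * of_real pi * \<i>)) * (2 * of_real pi * \<i> * of_real (1 / h) * \<tau>)"
    using assms(1) by simp
  also have "\<dots> = \<tau>' + of_int n * of_real h" unfolding n using assms(1) by (simp add: field_simps)
  finally show ?thesis by (rule that)
qed

lemma in_uhp_translate: "\<tau> \<in> uhp \<Longrightarrow> \<tau> + of_int n * of_real h \<in> uhp"
  by (simp add: uhp_def)

lemma multiplier_translate_int:
  fixes F :: "complex \<Rightarrow> complex"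
  assumes "\<And>\<tau>. \<tau> \<in> uhp \<Longrightarrow> F (\<tau> + of_real h) = lam * F \<tau>" "lam \<noteq> 0" "\<tau> \<in> uhp"
  shows "F (\<tau> + of_int n * of_real h) = lam powi n * F \<tau>"
proof (induction n rule: int_induct[where k = 0])
  case (step1 i)
  have "\<tau> + of_int (i + 1) * of_real h = (\<tau> + of_int i * of_real h) + of_real h"
    by (simp add: algebra_simps)
  hence "F (\<tau> + of_int (i + 1) * of_real h) = lam * F (\<tau> + of_int i * of_real h)"
    using assms(1)[OF in_uhp_translate[OF assms(3), of i h]] by (simp only:)
  thus ?case using step1 assms(2) by (simp add: power_int_add)
next
  case (step2 i)
  have "(\<tau> + of_int (i - 1) * of_real h) + of_real h = \<tau> + of_int i * of_real h"
    by (simp add: algebra_simps)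
  hence "F (\<tau> + of_int i * of_real h) = lam * F (\<tau> + of_int (i - 1) * of_real h)"
    using assms(1)[OF in_uhp_translate[OF assms(3), of "i - 1" h]] by (simp only:)
  thus ?case using step2 assms(2) by (simp add: power_int_diff field_simps)
qed auto

lemma eventually_at_im_infty: "eventually P at_im_infty \<longleftrightarrow> (\<exists>Y. \<forall>\<tau>. Im \<tau> > Y \<longrightarrow> P \<tau>)"
  unfolding at_im_infty_def by (rule eventually_filtercomap_at_top_dense)

lemma eventually_uhp_at_im_infty: "eventually (\<lambda>\<tau>. \<tau> \<in> uhp) at_im_infty"
  unfolding eventually_at_im_infty uhp_def by auto

lemma qpow_tendsto_0: "x > 0 \<Longrightarrow> (qpow x \<longlongrightarrow> 0) at_im_infty"
proof (rule tendsto_norm_zero_cancel)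
  assume x: "x > 0"
  have "((\<lambda>y. exp (- (2 * pi * x * y))) \<longlongrightarrow> 0) at_top"
    using x by (intro filterlim_compose[OF exp_at_bot] filterlim_compose[OF filterlim_uminus_at_bot_at_top]
        filterlim_tendsto_pos_mult_at_top[OF tendsto_const] filterlim_ident) auto
  hence "((\<lambda>\<tau>. exp (- (2 * pi * x * Im \<tau>))) \<longlongrightarrow> 0) at_im_infty"
    unfolding at_im_infty_def by (rule filterlim_compose[OF _ filterlim_filtercomap])
  thus "((\<lambda>\<tau>. cmod (qpow x \<tau>)) \<longlongrightarrow> 0) at_im_infty" by (simp add: norm_qpow)
qed

section \<open>Periodic functions on the half-plane as holomorphic functions on the disc\<close>

lemma holomorphic_qpow_tendsto:
  assumes "Q holomorphic_on ball 0 1" "x > 0"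
  shows "((\<lambda>\<tau>. Q (qpow x \<tau>)) \<longlongrightarrow> Q 0) at_im_infty"
proof -
  have "isCont Q 0"
    using holomorphic_on_imp_continuous_on[OF assms(1)] by (simp add: continuous_on_eq_continuous_at)
  thus ?thesis using qpow_tendsto_0[OF assms(2)] by (rule isCont_tendsto_compose)
qed

lemma tendsto_imp_Bfun:
  assumes "(f \<longlongrightarrow> l) F"
  shows "Bfun f F"
proof -
  have "eventually (\<lambda>x. dist (f x) l < 1) F" using assms by (rule tendstoD) auto
  hence "eventually (\<lambda>x. dist (f x) l \<le> 1) F" by eventually_elim auto
  thus ?thesis unfolding Bfun_metric_def by (intro exI[of _ l] exI[of _ 1]) auto
qed

text \<open>Periodicity lets \<open>F\<close> descend to the punctured disc through a logarithm, and
  boundedness near \<open>i\<infinity>\<close> makes the singularity at \<open>0\<close>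
  removable.\<close>

lemma periodic_bounded_eq_holomorphic_qpow:
  assumes h: "h > 0" and hol: "F holomorphic_on uhp"
    and per: "\<And>\<tau>. \<tau> \<in> uhp \<Longrightarrow> F (\<tau> + of_real h) = F \<tau>"
    and bdd: "Bfun F at_im_infty"
  obtains Q where "Q holomorphic_on ball 0 1" "\<And>\<tau>. \<tau> \<in> uhp \<Longrightarrow> F \<tau> = Q (qpow (1 / h) \<tau>)"
proof -
  define L where "L = (\<lambda>z. of_real (h / (2 * pi)) * (- \<i> * z) :: complex)"
  have LLn: "qpow (1 / h) (L w) = exp w" for w
    using h by (simp add: L_def qpow_def)
  have L_uhp: "L w \<in> uhp" if "cmod (exp w) < 1" for w
    using that h by (simp add: L_def uhp_def mult_pos_neg divide_neg_pos)
  define Q0 where "Q0 = (\<lambda>z. F (L (Ln z)))"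
  have key: "Q0 (qpow (1 / h) \<tau>) = F \<tau>" if \<tau>: "\<tau> \<in> uhp" for \<tau>
  proof -
    have "qpow (1 / h) (L (Ln (qpow (1 / h) \<tau>))) = qpow (1 / h) \<tau>"
      by (simp add: LLn)
    then obtain n :: int where "L (Ln (qpow (1 / h) \<tau>)) = \<tau> + of_int n * of_real h"
      using qpow_eq_imp_translate[OF h] by blast
    thus ?thesis using multiplier_translate_int[of F h 1 \<tau> n] per \<tau> by (simp add: Q0_def)
  qed
  \<comment> \<open>A second branch of the logarithm, cut along the nonnegative reals. Both branches
    give the same value by periodicity, and the two slit discs together cover the punctured
    disc.\<close>
  have e: "Q0 z = F (L (Ln (- z) + \<i> * of_real pi))" if "z \<in> ball 0 1 - {0}" for z
  proof -
    have ez: "exp (Ln (- z) + \<i> * of_real pi) = z" using that by (simp add: exp_add)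
    hence "L (Ln (- z) + \<i> * of_real pi) \<in> uhp" using that by (intro L_uhp) auto
    from key[OF this] show ?thesis by (simp add: LLn ez)
  qed
  have h1: "Q0 holomorphic_on (ball 0 1 - \<real>\<^sub>\<le>\<^sub>0)"
    unfolding Q0_def
  proof (rule holomorphic_on_compose_gen[OF _ hol, unfolded o_def])
    show "(\<lambda>z. L (Ln z)) holomorphic_on ball 0 1 - \<real>\<^sub>\<le>\<^sub>0"
      unfolding L_def by (intro holomorphic_intros) auto
    have "L (Ln z) \<in> uhp" if "z \<in> ball 0 1 - \<real>\<^sub>\<le>\<^sub>0" for z
    proof (rule L_uhp)
      have "z \<noteq> 0" using that by auto
      thus "cmod (exp (Ln z)) < 1" using that by (simp del: norm_exp_eq_Re)
    qed
    thus "(\<lambda>z. L (Ln z)) ` (ball 0 1 - \<real>\<^sub>\<le>\<^sub>0) \<subseteq> uhp" by blast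
  qed
  have "(\<lambda>z. F (L (Ln (- z) + \<i> * of_real pi))) holomorphic_on (ball 0 1 - \<real>\<^sub>\<ge>\<^sub>0)"
  proof (rule holomorphic_on_compose_gen[OF _ hol, unfolded o_def])
    show "(\<lambda>z. L (Ln (- z) + \<i> * of_real pi)) holomorphic_on ball 0 1 - \<real>\<^sub>\<ge>\<^sub>0"
      unfolding L_def by (intro holomorphic_intros) auto
    have "L (Ln (- z) + \<i> * of_real pi) \<in> uhp" if "z \<in> ball 0 1 - \<real>\<^sub>\<ge>\<^sub>0" for z
    proof (rule L_uhp)
      have "z \<noteq> 0" using that by auto
      thus "cmod (exp (Ln (- z) + \<i> * of_real pi)) < 1" using that by (simp add: exp_add del: norm_exp_eq_Re)
    qed
    thus "(\<lambda>z. L (Ln (- z) + \<i> * of_real pi)) ` (ball 0 1 - \<real>\<^sub>\<ge>\<^sub>0) \<subseteq> uhp" by blast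
  qed
  also have "?this \<longleftrightarrow> Q0 holomorphic_on (ball 0 1 - \<real>\<^sub>\<ge>\<^sub>0)"
    by (intro holomorphic_cong refl, subst e) auto
  finally have h2: "Q0 holomorphic_on (ball 0 1 - \<real>\<^sub>\<ge>\<^sub>0)" .
  have "(ball 0 1 - \<real>\<^sub>\<le>\<^sub>0) \<union> (ball 0 1 - \<real>\<^sub>\<ge>\<^sub>0) = ball 0 1 - {0 :: complex}"
    by (auto simp: complex_nonpos_Reals_iff complex_nonneg_Reals_iff complex_eq_iff)
  hence h3: "Q0 holomorphic_on ball 0 1 - {0}"
    using holomorphic_on_Un[OF h1 h2] by (simp add: open_Diff closed_nonpos_Reals_complex closed_nonneg_Reals_complex)
  from bdd obtain K Y where KY: "\<And>\<tau>. Im \<tau> > Y \<Longrightarrow> cmod (F \<tau>) \<le> K"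
    by (auto simp: Bfun_def eventually_at_im_infty)
  have "eventually (\<lambda>z. z \<in> ball 0 (min 1 (exp (- (2 * pi * \<bar>Y\<bar> / h)))) - {0 :: complex}) (at 0)"
    by (intro eventually_at_in_open) auto
  hence "eventually (\<lambda>z. cmod (Q0 z) \<le> K) (at 0)"
  proof eventually_elim
    case (elim z)
    hence z: "z \<noteq> 0" "cmod z < 1" "cmod z < exp (- (2 * pi * \<bar>Y\<bar> / h))" by auto
    then obtain \<tau> where \<tau>: "\<tau> \<in> uhp" "qpow (1 / h) \<tau> = z" "Im \<tau> = - (h * ln (cmod z)) / (2 * pi)"
      using qpow_surj[OF h] by blast
    have "ln (cmod z) < - (2 * pi * \<bar>Y\<bar> / h)"
      using z by (metis ln_exp ln_less_cancel_iff exp_gt_zero zero_less_norm_iff)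
    hence "Im \<tau> > \<bar>Y\<bar>" using h by (simp add: \<tau>(3) field_simps)
    hence "Im \<tau> > Y" by simp
    thus ?case using KY key[OF \<tau>(1)] \<tau>(2) by simp
  qed
  hence "\<exists>Q. Q holomorphic_on ball 0 1 \<and> (\<forall>z \<in> ball 0 1 - {0}. Q z = Q0 z)"
    using holomorphic_on_extend_bounded[OF h3] by auto
  then obtain Q where Q: "Q holomorphic_on ball 0 1" "\<And>z. z \<in> ball 0 1 - {0} \<Longrightarrow> Q z = Q0 z" by blast
  show ?thesis
    by (rule that[OF Q(1)]) (use Q(2) key qpow_in_ball[of "1 / h"] h in auto)
qed

text \<open>A zero can only sit at \<open>0\<close>, and its order is finite as \<open>P\<close> is
  not identically \<open>0\<close>. The cofactor \<open>S\<close> is then free of zeros on the whole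
  disc, so that one can later divide by it.\<close>

lemma holomorphic_factor_nonzero_punctured:
  assumes P: "P holomorphic_on ball 0 1" and nz: "\<And>z. z \<in> ball 0 1 - {0} \<Longrightarrow> P z \<noteq> (0 :: complex)"
  obtains m S where "S holomorphic_on ball 0 1" "\<And>z. z \<in> ball 0 1 \<Longrightarrow> S z \<noteq> 0"
    "\<And>z. z \<in> ball 0 1 \<Longrightarrow> P z = z ^ m * S z"
proof (cases "P 0 = 0")
  case False
  show ?thesis by (rule that[of P 0]) (use False nz P in auto)
next
  case True
  have "P (1 / 2) \<noteq> 0" by (intro nz) auto
  moreover have z0: "(0 :: complex) \<in> ball 0 1" and "(1 / 2 :: complex) \<in> ball 0 1" by auto
  ultimately have nc: "\<not> P constant_on ball 0 1" using True unfolding constant_on_def by metis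
  obtain g r n where "0 < n" and g: "0 < r" "ball (0 :: complex) r \<subseteq> ball 0 1" "g holomorphic_on ball 0 r"
    "\<And>w. w \<in> ball 0 r \<Longrightarrow> P w = (w - 0) ^ n * g w" "\<And>w. w \<in> ball 0 r \<Longrightarrow> g w \<noteq> 0"
    by (rule holomorphic_factor_zero_nonconstant[OF P open_ball connected_ball z0 True nc]) blast+
  define S where "S = (\<lambda>z. if z = 0 then g 0 else P z / z ^ n)"
  have Sg: "S z = g z" if "z \<in> ball 0 r" for z
    using g(4)[OF that] by (auto simp: S_def)
  have "isCont g 0"
    using holomorphic_on_imp_continuous_on[OF g(3)] g(1) by (simp add: continuous_on_eq_continuous_at)
  hence "g \<midarrow>0\<rightarrow> g 0" by (simp add: isCont_def)
  moreover have "eventually (\<lambda>z. z \<in> ball 0 r - {0}) (at (0 :: complex))"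
    using g(1) by (intro eventually_at_in_open) auto
  hence "eventually (\<lambda>z. g z = P z / z ^ n) (at 0)"
    by eventually_elim (use g(4) in auto)
  ultimately have "(\<lambda>z. P z / z ^ n) \<midarrow>0\<rightarrow> g 0"
    by (rule Lim_transform_eventually)
  hence "S holomorphic_on ball 0 1" unfolding S_def
    by (intro removable_singularity) (auto intro!: holomorphic_intros holomorphic_on_subset[OF P])
  moreover have "P z = z ^ n * S z" if "z \<in> ball 0 1" for z
    using Sg[of z] g(1) g(4)[of z] by (cases "z = 0") (auto simp: S_def)
  moreover have "S z \<noteq> 0" if "z \<in> ball 0 1" for z
    using g(1,5) nz that by (auto simp: S_def)
  ultimately show ?thesis using that by blast
qed

text \<open>The exponent \<open>x\<close> combines an argument of \<open>lam\<close> with the order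
  of vanishing at \<open>0\<close>. Only its existence matters: in the bracket \<open>g\<close>
  contributes \<open>x\<close> and \<open>f\<close> contributes \<open>-x\<close>.\<close>

lemma multiplier_periodic_bounded_eq_qpow:
  assumes h: "h > 0" and hol: "G holomorphic_on uhp"
    and nz: "\<And>\<tau>. \<tau> \<in> uhp \<Longrightarrow> G \<tau> \<noteq> 0"
    and per: "\<And>\<tau>. \<tau> \<in> uhp \<Longrightarrow> G (\<tau> + of_real h) = lam * G \<tau>"
    and bdd: "Bfun G at_im_infty"
  obtains x S where "S holomorphic_on ball 0 1" "\<And>z. z \<in> ball 0 1 \<Longrightarrow> S z \<noteq> 0"
    "\<And>\<tau>. \<tau> \<in> uhp \<Longrightarrow> G \<tau> = qpow (x / h) \<tau> * S (qpow (1 / h) \<tau>)"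
proof -
  from bdd obtain K Y where KY: "\<And>\<tau>. Im \<tau> > Y \<Longrightarrow> cmod (G \<tau>) \<le> K"
    by (auto simp: Bfun_def eventually_at_im_infty)
  define \<tau>0 where "\<tau>0 = \<i> * of_real (\<bar>Y\<bar> + 1)"
  have \<tau>0: "\<tau>0 \<in> uhp" "Im \<tau>0 > Y" by (auto simp: \<tau>0_def uhp_def)
  have lam: "lam \<noteq> 0" using per[OF \<tau>0(1)] nz[OF in_uhp_translate[OF \<tau>0(1), of 1 h]] by auto
  \<comment> \<open>All translates of \<open>\<tau>0\<close> by multiples of \<open>h\<close> have
    the same imaginary part, so the bound holds for them simultaneously. With \<open>n\<close> of
    both signs this forces \<open>lam\<close> to have absolute value \<open>1\<close>.\<close>
  have bd: "cmod lam powi n * cmod (G \<tau>0) \<le> K" for n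
    using multiplier_translate_int[of G h lam \<tau>0 n] per lam \<tau>0 KY[of "\<tau>0 + of_int n * of_real h"]
    by (simp add: norm_mult norm_power_int)
  have G0: "cmod (G \<tau>0) > 0" using nz[OF \<tau>0(1)] by simp
  have bd1: "\<not> y > 1" if "\<And>n. y ^ n * cmod (G \<tau>0) \<le> K" for y :: real
  proof
    assume "y > 1"
    then obtain n where "K / cmod (G \<tau>0) < y ^ n" using real_arch_pow by blast
    hence "K < y ^ n * cmod (G \<tau>0)" using G0 by (simp add: field_simps)
    with that[of n] show False by simp
  qed
  have "\<not> cmod lam > 1" by (rule bd1) (use bd[of "int _"] in simp)
  moreover have "\<not> inverse (cmod lam) > 1"
    by (rule bd1) (use bd[of "- int _"] in \<open>simp add: power_int_minus power_inverse\<close>)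
  ultimately have "cmod lam = 1" using lam by (simp add: one_less_inverse_iff)
  hence lam_eq: "lam = exp (\<i> * of_real (Arg lam))"
    using lam Arg_eq[of lam] by simp
  \<comment> \<open>Shifting by \<open>-1\<close> makes \<open>\<kappa>\<close> nonpositive, so that dividing by \<open>q\<^sup>\<kappa>\<close> keeps \<open>G\<close> bounded.\<close>
  define \<kappa> where "\<kappa> = Arg lam / (2 * pi) - 1"
  have \<kappa>: "\<kappa> \<le> 0" using order.trans[OF Arg_le_pi[of lam], of "pi * 2"] by (simp add: \<kappa>_def field_simps)
  have lam_\<kappa>: "exp (2 * of_real pi * \<i> * of_real \<kappa>) = lam"
  proof -
    have "2 * of_real pi * \<i> * of_real \<kappa> = \<i> * of_real (Arg lam) - 2 * of_real pi * \<i>"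
      by (simp add: \<kappa>_def field_simps)
    thus ?thesis using lam_eq by (simp add: exp_diff)
  qed
  define G' where "G' = (\<lambda>\<tau>. qpow (- \<kappa> / h) \<tau> * G \<tau>)"
  have "G' holomorphic_on uhp" unfolding G'_def by (intro holomorphic_intros hol)
  moreover have "G' (\<tau> + of_real h) = G' \<tau>" if "\<tau> \<in> uhp" for \<tau>
  proof -
    have "2 * of_real pi * \<i> * of_real (- \<kappa> / h) * (\<tau> + of_real h) =
       2 * of_real pi * \<i> * of_real (- \<kappa> / h) * \<tau> - 2 * of_real pi * \<i> * of_real \<kappa>"
      using h by (simp add: field_simps)
    hence "qpow (- \<kappa> / h) (\<tau> + of_real h) = qpow (- \<kappa> / h) \<tau> / lam"
      unfolding qpow_def by (simp add: exp_diff lam_\<kappa>)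
    thus ?thesis using per[OF that] lam by (simp add: G'_def)
  qed
  moreover have "Bfun G' at_im_infty"
  proof (rule BfunI[of _ K])
    show "\<forall>\<^sub>F \<tau> in at_im_infty. cmod (G' \<tau>) \<le> K"
      unfolding eventually_at_im_infty
    proof (intro exI[of _ "max Y 0"] allI impI)
      fix \<tau> assume \<tau>: "Im \<tau> > max Y 0"
      have "cmod (qpow (- \<kappa> / h) \<tau>) \<le> 1"
        using \<tau> \<kappa> h by (simp add: norm_qpow mult_nonpos_nonneg divide_nonpos_pos mult_nonneg_nonpos)
      hence "cmod (G' \<tau>) \<le> 1 * K" unfolding G'_def norm_mult using KY[of \<tau>] \<tau>
        by (intro mult_mono) auto
      thus "cmod (G' \<tau>) \<le> K" by simp
    qed
  qed
  ultimately obtain P where P: "P holomorphic_on ball 0 1" "\<And>\<tau>. \<tau> \<in> uhp \<Longrightarrow> G' \<tau> = P (qpow (1 / h) \<tau>)"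
    using periodic_bounded_eq_holomorphic_qpow[OF h, of G'] by blast
  have "P z \<noteq> 0" if z: "z \<in> ball 0 1 - {0}" for z
  proof -
    obtain \<tau> where "\<tau> \<in> uhp" "qpow (1 / h) \<tau> = z" using qpow_surj[OF h, of z] z by auto
    thus ?thesis using P(2)[of \<tau>] nz[of \<tau>] by (auto simp: G'_def)
  qed
  then obtain m S where S: "S holomorphic_on ball 0 1" "\<And>z. z \<in> ball 0 1 \<Longrightarrow> S z \<noteq> 0"
    "\<And>z. z \<in> ball 0 1 \<Longrightarrow> P z = z ^ m * S z"
    using holomorphic_factor_nonzero_punctured[OF P(1)] by metis
  show ?thesis
  proof (rule that[OF S(1,2)])
    fix \<tau> assume \<tau>: "\<tau> \<in> uhp"
    have "G \<tau> = qpow (\<kappa> / h) \<tau> * G' \<tau>"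
      by (simp add: G'_def flip: mult.assoc qpow_add)
    also have "G' \<tau> = qpow (1 / h) \<tau> ^ m * S (qpow (1 / h) \<tau>)"
      using P(2)[OF \<tau>] S(3)[OF qpow_in_ball[OF _ \<tau>], of "1 / h"] h by simp
    finally show "G \<tau> = qpow ((\<kappa> + real m) / h) \<tau> * S (qpow (1 / h) \<tau>)"
      using qpow_of_nat_mult[of m "1 / h" \<tau>] by (simp add: qpow_add add_divide_distrib)
  qed
qed

text \<open>The operator D in the coordinate \<open>z = q^(1/h)\<close>, conjugated by
  \<open>q^(x/h)\<close>: applying D to \<open>q^(x/h) R(z)\<close> gives \<open>q^(x/h)\<close>
  times \<open>euler_op h x R z\<close>.\<close>

definition euler_op :: "real \<Rightarrow> real \<Rightarrow> (complex \<Rightarrow> complex) \<Rightarrow> complex \<Rightarrow> complex" where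
  "euler_op h x R z = (of_real x * R z + z * deriv R z) / of_real h"

lemma holomorphic_euler_op_funpow:
  assumes "R holomorphic_on S" "open S"
  shows "(euler_op h x ^^ n) R holomorphic_on S"
proof (induction n)
  case (Suc n)
  have "(\<lambda>z. (of_real x * (euler_op h x ^^ n) R z + z * deriv ((euler_op h x ^^ n) R) z) * inverse (of_real h)) holomorphic_on S"
    by (intro holomorphic_intros holomorphic_deriv Suc assms(2))
  thus ?case by (simp add: euler_op_def[abs_def] field_simps)
qed (use assms in auto)

lemma euler_op_funpow_at_0: "(euler_op h x ^^ n) R 0 = of_real (x / h) ^ n * R 0"
  by (induction n) (auto simp: euler_op_def)

lemma qderiv_funpow_qpow_mult:
  assumes h: "h > 0" and R: "R holomorphic_on ball 0 1"
    and F: "\<And>\<tau>. \<tau> \<in> uhp \<Longrightarrow> F \<tau> = qpow (x / h) \<tau> * R (qpow (1 / h) \<tau>)"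
    and \<tau>: "\<tau> \<in> uhp"
  shows "(qderiv ^^ n) F \<tau> = qpow (x / h) \<tau> * (euler_op h x ^^ n) R (qpow (1 / h) \<tau>)"
  using \<tau>
proof (induction n arbitrary: \<tau>)
  case (Suc n)
  define T where "T = (euler_op h x ^^ n) R"
  have T: "T holomorphic_on ball 0 1" unfolding T_def by (rule holomorphic_euler_op_funpow[OF R]) auto
  define q where "q = qpow (1 / h) \<tau>"
  have "q \<in> ball 0 1" unfolding q_def using h Suc.prems by (intro qpow_in_ball) auto
  hence dT: "(T has_field_derivative deriv T q) (at (qpow (1 / h) \<tau>))"
    unfolding q_def[symmetric] by (intro holomorphic_derivI[OF T]) auto
  have "((\<lambda>\<tau>. qpow (x / h) \<tau> * T (qpow (1 / h) \<tau>)) has_field_derivative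
     (2 * of_real pi * \<i> * of_real (x / h)) * qpow (x / h) \<tau> * T q +
     deriv T q * ((2 * of_real pi * \<i> * of_real (1 / h)) * q) * qpow (x / h) \<tau>) (at \<tau>)"
    unfolding q_def
    by (intro DERIV_mult has_field_derivative_qpow DERIV_chain2[where f = T and g = "qpow (1 / h)", OF dT[unfolded q_def]])
  hence "deriv (\<lambda>\<tau>. qpow (x / h) \<tau> * T (qpow (1 / h) \<tau>)) \<tau> =
     (2 * of_real pi * \<i> * of_real (x / h)) * qpow (x / h) \<tau> * T q +
     deriv T q * ((2 * of_real pi * \<i> * of_real (1 / h)) * q) * qpow (x / h) \<tau>"
    by (rule DERIV_imp_deriv)
  also have "\<dots> = 2 * of_real pi * \<i> * (qpow (x / h) \<tau> * euler_op h x T q)"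
    using h by (simp add: euler_op_def field_simps)
  finally have *: "deriv (\<lambda>\<tau>. qpow (x / h) \<tau> * T (qpow (1 / h) \<tau>)) \<tau> = \<dots>" .
  have "eventually (\<lambda>z. (qderiv ^^ n) F z = qpow (x / h) z * T (qpow (1 / h) z)) (nhds \<tau>)"
    using open_uhp Suc.prems Suc.IH by (auto simp: eventually_nhds T_def)
  hence "deriv ((qderiv ^^ n) F) \<tau> = deriv (\<lambda>\<tau>. qpow (x / h) \<tau> * T (qpow (1 / h) \<tau>)) \<tau>"
    by (intro deriv_cong_ev) auto
  hence "deriv ((qderiv ^^ n) F) \<tau> = 2 * of_real pi * \<i> * (qpow (x / h) \<tau> * euler_op h x T q)"
    using * by simp
  thus ?case by (simp add: qderiv_def[of "(qderiv ^^ n) F"] T_def q_def)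
qed (use F in auto)

text \<open>The bracket after cancelling the opposite powers \<open>q^(-x/h)\<close> and
  \<open>q^(x/h)\<close>. It is an honest function of \<open>z\<close> on the disc, defined at
  \<open>0\<close> as well.\<close>

definition rankin_cohen_disc ::
  "real \<Rightarrow> real \<Rightarrow> nat \<Rightarrow> real \<Rightarrow> real \<Rightarrow> (complex \<Rightarrow> complex) \<Rightarrow> (complex \<Rightarrow> complex) \<Rightarrow> complex \<Rightarrow> complex" where
  "rankin_cohen_disc a b v h x R S z =
     (\<Sum>j\<le>v. (-1) ^ j * of_real ((a + real v - 1) gchoose (v - j)) * of_real ((b + real v - 1) gchoose j)
             * (euler_op h (- x) ^^ j) R z * (euler_op h x ^^ (v - j)) S z)"

lemma holomorphic_rankin_cohen_disc:
  assumes "R holomorphic_on ball 0 1" "S holomorphic_on ball 0 1"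
  shows "rankin_cohen_disc a b v h x R S holomorphic_on ball 0 1"
  unfolding rankin_cohen_disc_def[abs_def]
  by (intro holomorphic_intros holomorphic_euler_op_funpow assms open_ball)

lemma rankin_cohen_eq_disc:
  assumes "h > 0" "R holomorphic_on ball 0 1" "S holomorphic_on ball 0 1"
    and "\<And>\<tau>. \<tau> \<in> uhp \<Longrightarrow> F \<tau> = qpow (- x / h) \<tau> * R (qpow (1 / h) \<tau>)"
    and "\<And>\<tau>. \<tau> \<in> uhp \<Longrightarrow> G \<tau> = qpow (x / h) \<tau> * S (qpow (1 / h) \<tau>)"
    and "\<tau> \<in> uhp"
  shows "rankin_cohen a b v F G \<tau> = rankin_cohen_disc a b v h x R S (qpow (1 / h) \<tau>)"
proof -
  have cancel: "c * (qpow (- x / h) \<tau> * y) * (qpow (x / h) \<tau> * z) = c * y * z" for c y z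
  proof -
    have "c * (qpow (- x / h) \<tau> * y) * (qpow (x / h) \<tau> * z) = (qpow (- (x / h)) \<tau> * qpow (x / h) \<tau>) * (c * y * z)"
      by simp
    thus ?thesis by (simp only: qpow_minus_mult mult_1)
  qed
  have dF: "(qderiv ^^ n) F \<tau> = qpow (- x / h) \<tau> * (euler_op h (- x) ^^ n) R (qpow (1 / h) \<tau>)" for n
    by (rule qderiv_funpow_qpow_mult) (use assms in auto)
  have dG: "(qderiv ^^ n) G \<tau> = qpow (x / h) \<tau> * (euler_op h x ^^ n) S (qpow (1 / h) \<tau>)" for n
    by (rule qderiv_funpow_qpow_mult) (use assms in auto)
  show ?thesis
    unfolding rankin_cohen_def rankin_cohen_disc_def dF dG cancel ..
qed


text \<open>The matrix is the translation by \<open>N\<close> conjugated by \<open>A\<close>. Its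
  lower left entry is \<open>-N c^2\<close>, with \<open>c\<close> that of \<open>A\<close>, so it
  lies in \<open>Gamma0 N\<close> for every \<open>A\<close>; hence \<open>N\<close> serves as a
  period at all cusps at once.\<close>

lemma SL2Z_conj_translation:
  assumes "A \<in> SL2Z"
  obtains B where "B \<in> Gamma0 N"
    "\<And>\<tau>. \<tau> \<in> uhp \<Longrightarrow> moebius A (\<tau> + of_nat N) = moebius B (moebius A \<tau>)"
    "\<And>\<tau>. \<tau> \<in> uhp \<Longrightarrow> denom A (\<tau> + of_nat N) = denom B (moebius A \<tau>) * denom A \<tau>"
proof -
  define a b c d where "a = A $ 1 $ 1" and "b = A $ 1 $ 2" and "c = A $ 2 $ 1" and "d = A $ 2 $ 2"
  define n where "n = int N"
  define B :: "int^2^2" where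
    "B = vector [vector [1 - n * a * c, n * a * a], vector [- n * c * c, 1 + n * a * c]]"
  have B: "B $ 1 $ 1 = 1 - n * a * c" "B $ 1 $ 2 = n * a * a"
    "B $ 2 $ 1 = - n * c * c" "B $ 2 $ 2 = 1 + n * a * c"
    by (simp_all add: B_def)
  have "B \<in> Gamma0 N"
    by (simp add: Gamma0_def SL2Z_def det_2 B n_def algebra_simps)
  define a' b' c' d' n' where "a' = complex_of_int a" and "b' = complex_of_int b"
    and "c' = complex_of_int c" and "d' = complex_of_int d" and "n' = complex_of_int n"
  have det: "a' * d' - b' * c' = 1"
    using SL2Z_det_of_int[OF assms, where 'a=complex] by (simp add: a'_def b'_def c'_def d'_def a_def b_def c_def d_def)
  have num_id: "(1 - n' * a' * c') * (a' * z + b') + n' * a' * a' * (c' * z + d') = a' * (z + n') + b'"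
    and den_id: "- n' * c' * c' * (a' * z + b') + (1 + n' * a' * c') * (c' * z + d') = c' * (z + n') + d'" for z
  proof -
    have "(1 - n' * a' * c') * (a' * z + b') + n' * a' * a' * (c' * z + d') = a' * z + b' + n' * a' * (a' * d' - b' * c')"
      by (simp add: algebra_simps)
    thus "(1 - n' * a' * c') * (a' * z + b') + n' * a' * a' * (c' * z + d') = a' * (z + n') + b'"
      unfolding det by (simp add: algebra_simps)
    have "- n' * c' * c' * (a' * z + b') + (1 + n' * a' * c') * (c' * z + d') = c' * z + d' + n' * c' * (a' * d' - b' * c')"
      by (simp add: algebra_simps)
    thus "- n' * c' * c' * (a' * z + b') + (1 + n' * a' * c') * (c' * z + d') = c' * (z + n') + d'"
      unfolding det by (simp add: algebra_simps)
  qed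
  have nN: "of_nat N = n'" by (simp add: n'_def n_def)
  have dA: "denom A z = c' * z + d'" and mA: "moebius A z = (a' * z + b') / (c' * z + d')" for z
    by (simp_all add: denom_def moebius_def a'_def b'_def c'_def d'_def a_def b_def c_def d_def)
  have dB: "denom B z = - n' * c' * c' * z + (1 + n' * a' * c')"
    and mB: "moebius B z = ((1 - n' * a' * c') * z + n' * a' * a') / (- n' * c' * c' * z + (1 + n' * a' * c'))" for z
    by (simp_all add: denom_def moebius_def B n'_def a'_def c'_def)
  have 1: "denom B (moebius A \<tau>) * denom A \<tau> = denom A (\<tau> + of_nat N)" if "\<tau> \<in> uhp" for \<tau>
  proof -
    have "c' * \<tau> + d' \<noteq> 0" using denom_nonzero[OF assms that] by (simp add: dA)
    hence "denom B (moebius A \<tau>) * denom A \<tau> = - n' * c' * c' * (a' * \<tau> + b') + (1 + n' * a' * c') * (c' * \<tau> + d')"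
      unfolding dB dA mA by (simp add: field_simps)
    thus ?thesis unfolding den_id by (simp add: dA nN)
  qed
  have 2: "moebius A (\<tau> + of_nat N) = moebius B (moebius A \<tau>)" if "\<tau> \<in> uhp" for \<tau>
  proof -
    have nz: "c' * \<tau> + d' \<noteq> 0" using denom_nonzero[OF assms that] by (simp add: dA)
    have "moebius B (moebius A \<tau>) =
      (((1 - n' * a' * c') * moebius A \<tau> + n' * a' * a') * denom A \<tau>) / (denom B (moebius A \<tau>) * denom A \<tau>)"
      using nz unfolding mB dB by (simp add: dA)
    also have "((1 - n' * a' * c') * moebius A \<tau> + n' * a' * a') * denom A \<tau> = a' * (\<tau> + n') + b'"
      unfolding num_id[symmetric] mA dA using nz by (simp add: field_simps)
    finally show ?thesis unfolding 1[OF that] unfolding mA dA nN by (rule sym)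
  qed
  show ?thesis by (rule that[OF \<open>B \<in> Gamma0 N\<close> 2 1[symmetric]])
qed

lemma Gamma0_subset_SL2Z: "Gamma0 N \<subseteq> SL2Z"
  by (auto simp: Gamma0_def)

lemma holomorphic_slash:
  assumes "A \<in> SL2Z" "f holomorphic_on uhp"
  shows "slash k A f holomorphic_on uhp"
proof -
  have "moebius A holomorphic_on uhp" "autfac k A holomorphic_on uhp"
    using has_field_derivative_moebius[OF assms(1)] has_field_derivative_autfac[OF assms(1)]
    by (auto simp: holomorphic_on_open[OF open_uhp])
  thus ?thesis unfolding slash_def[abs_def]
    by (intro holomorphic_on_divide holomorphic_on_compose_gen[OF _ assms(2), unfolded o_def])
       (use moebius_in_uhp autfac_nonzero assms(1) in auto)
qed

lemma slash_eq: "A \<in> SL2Z \<Longrightarrow> \<tau> \<in> uhp \<Longrightarrow> f (moebius A \<tau>) = autfac k A \<tau> * slash k A f \<tau>"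
  using autfac_nonzero by (simp add: slash_def)

lemma slash_modular_form_periodic:
  assumes A: "A \<in> SL2Z" and h: "h \<in> modular_forms k N" and \<tau>: "\<tau> \<in> uhp"
  shows "slash (real k) A h (\<tau> + of_nat N) = slash (real k) A h \<tau>"
proof -
  obtain B where B: "B \<in> Gamma0 N" "moebius A (\<tau> + of_nat N) = moebius B (moebius A \<tau>)"
    "denom A (\<tau> + of_nat N) = denom B (moebius A \<tau>) * denom A \<tau>"
    using SL2Z_conj_translation[OF A] \<tau> by metis
  have BS: "B \<in> SL2Z" using B(1) Gamma0_subset_SL2Z by auto
  have \<tau>': "\<tau> + of_nat N \<in> uhp" using \<tau> by (simp add: uhp_def)
  have "h (moebius B (moebius A \<tau>)) = denom B (moebius A \<tau>) ^ k * h (moebius A \<tau>)"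
    using h B(1) moebius_in_uhp[OF A \<tau>] autfac_of_nat[OF BS moebius_in_uhp[OF A \<tau>]]
    by (auto simp: modular_forms_def holomorphic_modular_form_def transforms_under_def)
  thus ?thesis
    using denom_nonzero[OF BS moebius_in_uhp[OF A \<tau>]] denom_nonzero[OF A \<tau>]
    by (simp add: slash_def autfac_of_nat[OF A \<tau>] autfac_of_nat[OF A \<tau>'] B(2,3) power_mult_distrib)
qed

lemma slash_half_multiplier_periodic:
  assumes A: "A \<in> SL2Z" and g: "g holomorphic_on uhp" "transforms_under N (1/2) \<nu> g"
    and nz: "\<And>\<tau>. \<tau> \<in> uhp \<Longrightarrow> g \<tau> \<noteq> 0"
  obtains lam where "\<And>\<tau>. \<tau> \<in> uhp \<Longrightarrow> slash (1/2) A g (\<tau> + of_nat N) = lam * slash (1/2) A g \<tau>"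
proof -
  obtain B where B: "B \<in> Gamma0 N" "\<And>\<tau>. \<tau> \<in> uhp \<Longrightarrow> moebius A (\<tau> + of_nat N) = moebius B (moebius A \<tau>)"
    "\<And>\<tau>. \<tau> \<in> uhp \<Longrightarrow> denom A (\<tau> + of_nat N) = denom B (moebius A \<tau>) * denom A \<tau>"
    using SL2Z_conj_translation[OF A] by metis
  have BS: "B \<in> SL2Z" using B(1) Gamma0_subset_SL2Z by auto
  define G where "G = slash (1/2) A g"
  have shift: "\<tau> + of_nat N \<in> uhp" if "\<tau> \<in> uhp" for \<tau> using that by (simp add: uhp_def)
  have Gnz: "G \<tau> \<noteq> 0" if "\<tau> \<in> uhp" for \<tau>
    unfolding G_def slash_def using nz[OF moebius_in_uhp[OF A that]] autfac_nonzero[OF A that] by simp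
  have Ghol: "G holomorphic_on uhp" unfolding G_def by (rule holomorphic_slash[OF A g(1)])
  have half: "autfac (1/2) C \<tau> ^ 2 = denom C \<tau>" if "C \<in> SL2Z" "\<tau> \<in> uhp" for C \<tau>
    using autfac_add[of "1/2" "1/2" C \<tau>] autfac_of_nat[OF that, of 1] by (simp add: power2_eq_square)
  \<comment> \<open>The principal branches of the square roots fix the ratio only up to sign; its square is a
    constant, and then so is the holomorphic ratio itself.\<close>
  have sq: "(G (\<tau> + of_nat N) / G \<tau>)\<^sup>2 = (\<nu> B)\<^sup>2" if \<tau>: "\<tau> \<in> uhp" for \<tau>
  proof -
    have G2: "(G \<tau>)\<^sup>2 = (g (moebius A \<tau>))\<^sup>2 / denom A \<tau>"
      by (simp add: G_def slash_def power_divide half[OF A \<tau>])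
    have "(G (\<tau> + of_nat N))\<^sup>2 = (g (moebius B (moebius A \<tau>)))\<^sup>2 / (denom B (moebius A \<tau>) * denom A \<tau>)"
      by (simp add: G_def slash_def power_divide half[OF A shift[OF \<tau>]] B(2,3)[OF \<tau>])
    also have "g (moebius B (moebius A \<tau>)) = \<nu> B * autfac (1/2) B (moebius A \<tau>) * g (moebius A \<tau>)"
      using g(2) B(1) moebius_in_uhp[OF A \<tau>] by (auto simp: transforms_under_def)
    also have "\<dots>\<^sup>2 / (denom B (moebius A \<tau>) * denom A \<tau>) = (\<nu> B)\<^sup>2 * (G \<tau>)\<^sup>2"
      using denom_nonzero[OF BS moebius_in_uhp[OF A \<tau>]]
      by (simp add: power_mult_distrib half[OF BS moebius_in_uhp[OF A \<tau>]] G2)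
    finally show ?thesis using Gnz[OF \<tau>] by (simp add: power_divide)
  qed
  define \<rho> where "\<rho> = (\<lambda>\<tau>. G (\<tau> + of_nat N) / G \<tau>)"
  have \<rho>nz: "\<rho> \<tau> \<noteq> 0" if "\<tau> \<in> uhp" for \<tau>
    using Gnz[OF that] Gnz[OF shift[OF that]] by (simp add: \<rho>_def)
  have \<rho>hol: "\<rho> holomorphic_on uhp" unfolding \<rho>_def
    by (intro holomorphic_on_divide Ghol holomorphic_on_compose_gen[OF _ Ghol, unfolded o_def] holomorphic_intros)
       (use shift Gnz in auto)
  have "\<exists>c. \<forall>\<tau> \<in> uhp. \<rho> \<tau> = c"
  proof (rule has_field_derivative_zero_constant[OF convex_uhp])
    fix \<tau> assume \<tau>: "\<tau> \<in> uhp"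
    have d: "(\<rho> has_field_derivative deriv \<rho> \<tau>) (at \<tau>)"
      by (rule holomorphic_derivI[OF \<rho>hol open_uhp \<tau>])
    have "((\<lambda>\<tau>. (\<rho> \<tau>)\<^sup>2) has_field_derivative of_nat 2 * (deriv \<rho> \<tau> * \<rho> \<tau> ^ (2 - Suc 0))) (at \<tau>)"
      by (rule DERIV_power[OF d])
    moreover have "((\<lambda>\<tau>. (\<rho> \<tau>)\<^sup>2) has_field_derivative 0) (at \<tau>)"
      by (rule has_field_derivative_transform_within_open[OF DERIV_const open_uhp \<tau>, of "(\<nu> B)\<^sup>2"])
         (use sq in \<open>simp add: \<rho>_def\<close>)
    ultimately have "of_nat 2 * (deriv \<rho> \<tau> * \<rho> \<tau> ^ (2 - Suc 0)) = 0" by (rule DERIV_unique)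
    hence "deriv \<rho> \<tau> = 0" using \<rho>nz[OF \<tau>] by simp
    thus "(\<rho> has_field_derivative 0) (at \<tau> within uhp)" using d by (metis has_field_derivative_at_within)
  qed
  then obtain c where "\<And>\<tau>. \<tau> \<in> uhp \<Longrightarrow> \<rho> \<tau> = c" by blast
  hence "G (\<tau> + of_nat N) = c * G \<tau>" if "\<tau> \<in> uhp" for \<tau>
  proof -
    have "G (\<tau> + of_nat N) = \<rho> \<tau> * G \<tau>" using Gnz[OF that] by (simp add: \<rho>_def)
    thus ?thesis using \<open>\<And>\<tau>. \<tau> \<in> uhp \<Longrightarrow> \<rho> \<tau> = c\<close>[OF that] by simp
  qed
  thus ?thesis using that unfolding G_def by blast
qed

section \<open>Modularity and cuspidality of the bracket\<close>

theorem rankin_cohen_modular_form: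
  assumes N: "N \<ge> 1" and f: "f holomorphic_on uhp"
    and g: "holomorphic_modular_form N (1/2) \<nu> g" and nz: "\<And>\<tau>. \<tau> \<in> uhp \<Longrightarrow> g \<tau> \<noteq> 0"
    and fg: "(\<lambda>\<tau>. f \<tau> * g \<tau>) \<in> modular_forms 2 N"
  shows "rankin_cohen (3/2) (1/2) v f g \<in> modular_forms (2 + 2 * v) N"
    and "(\<lambda>\<tau>. f \<tau> * g \<tau>) \<in> cusp_forms 2 N \<Longrightarrow> rankin_cohen (3/2) (1/2) v f g \<in> cusp_forms (2 + 2 * v) N"
proof -
  define RC where "RC = rankin_cohen (3/2) (1/2) v f g"
  have ghol: "g holomorphic_on uhp" and gtr: "transforms_under N (1/2) \<nu> g"
    and gbd: "\<And>A. A \<in> SL2Z \<Longrightarrow> Bfun (slash (1/2) A g) at_im_infty"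
    using g by (auto simp: holomorphic_modular_form_def)
  have RChol: "RC holomorphic_on uhp" unfolding RC_def by (rule holomorphic_rankin_cohen[OF f ghol open_uhp])
  have weight: "(3/2 + 1/2 + 2 * real v) = real (2 + 2 * v)" by simp
  have "RC (moebius A \<tau>) = autfac (real (2 + 2 * v)) A \<tau> * RC \<tau>" if A: "A \<in> Gamma0 N" and \<tau>: "\<tau> \<in> uhp" for A \<tau>
  proof -
    have AS: "A \<in> SL2Z" using A Gamma0_subset_SL2Z by auto
    have gA: "g (moebius A z) = autfac (1/2) A z * (\<nu> A * g z)" if "z \<in> uhp" for z
      using gtr A that by (auto simp: transforms_under_def)
    have \<nu>: "\<nu> A \<noteq> 0" using gA[OF \<tau>] nz[OF moebius_in_uhp[OF AS \<tau>]] by auto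
    \<comment> \<open>Dividing the law of \<open>fg\<close>, which has trivial multiplier, by that
      of the zero-free \<open>g\<close> gives \<open>f\<close> the inverse multiplier. The two
      constants then cancel in the bracket by bilinearity.\<close>
    have fA: "f (moebius A z) = autfac (3/2) A z * (inverse (\<nu> A) * f z)" if z: "z \<in> uhp" for z
    proof -
      have "f (moebius A z) * g (moebius A z) = autfac 2 A z * (f z * g z)"
        using fg A z by (auto simp: modular_forms_def holomorphic_modular_form_def transforms_under_def)
      also have "autfac 2 A z = autfac (3/2) A z * autfac (1/2) A z"
        using autfac_add[of "3/2" "1/2" A z] by simp
      also have "\<dots> * (f z * g z) = autfac (3/2) A z * (inverse (\<nu> A) * f z) * g (moebius A z)"
        using \<nu> by (simp add: gA[OF z])
      finally show ?thesis using nz[OF moebius_in_uhp[OF AS z]] by simp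
    qed
    have "RC (moebius A \<tau>) = autfac (3/2 + 1/2 + 2 * real v) A \<tau> *
       rankin_cohen (3/2) (1/2) v (\<lambda>z. inverse (\<nu> A) * f z) (\<lambda>z. \<nu> A * g z) \<tau>"
      unfolding RC_def
      by (rule rankin_cohen_moebius[OF AS _ _ f _ ghol]) (use fA gA \<tau> f ghol in \<open>auto intro!: holomorphic_intros\<close>)
    also have "rankin_cohen (3/2) (1/2) v (\<lambda>z. inverse (\<nu> A) * f z) (\<lambda>z. \<nu> A * g z) \<tau> = RC \<tau>"
      using \<nu> by (simp add: rankin_cohen_cmult[OF f ghol open_uhp \<tau>] RC_def)
    finally show ?thesis unfolding weight .
  qed
  hence RCtr: "transforms_under N (real (2 + 2 * v)) (\<lambda>_. 1) RC"
    by (simp add: transforms_under_def)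
  \<comment> \<open>A limit at each cusp serves two purposes: its existence gives boundedness, and
    its vanishing together with that of \<open>fg\<close> gives the statement on cusp forms.\<close>
  have "\<exists>T. (slash (real (2 + 2 * v)) A RC \<longlongrightarrow> T) at_im_infty \<and>
        ((slash 2 A (\<lambda>\<tau>. f \<tau> * g \<tau>) \<longlongrightarrow> 0) at_im_infty \<longrightarrow> T = 0)" if A: "A \<in> SL2Z" for A
  proof -
    define F where "F = slash (3/2) A f"
    define G where "G = slash (1/2) A g"
    define H where "H = slash 2 A (\<lambda>\<tau>. f \<tau> * g \<tau>)"
    have hol: "F holomorphic_on uhp" "G holomorphic_on uhp"
      unfolding F_def G_def by (rule holomorphic_slash[OF A f] holomorphic_slash[OF A ghol])+
    have H: "H \<tau> = F \<tau> * G \<tau>" if "\<tau> \<in> uhp" for \<tau>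
      using autfac_add[of "3/2" "1/2" A \<tau>] by (simp add: H_def F_def G_def slash_def)
    have Gnz: "G \<tau> \<noteq> 0" if "\<tau> \<in> uhp" for \<tau>
      unfolding G_def slash_def using nz[OF moebius_in_uhp[OF A that]] autfac_nonzero[OF A that] by simp
    define h where "h = real N"
    have h: "h > 0" using N by (simp add: h_def)
    obtain lam where lam: "\<And>\<tau>. \<tau> \<in> uhp \<Longrightarrow> G (\<tau> + of_real h) = lam * G \<tau>"
      using slash_half_multiplier_periodic[OF A ghol gtr nz] unfolding G_def h_def by auto
    obtain x S where S: "S holomorphic_on ball 0 1" "\<And>z. z \<in> ball 0 1 \<Longrightarrow> S z \<noteq> 0"
      "\<And>\<tau>. \<tau> \<in> uhp \<Longrightarrow> G \<tau> = qpow (x / h) \<tau> * S (qpow (1 / h) \<tau>)"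
      by (rule multiplier_periodic_bounded_eq_qpow[OF h hol(2) Gnz lam gbd[OF A, folded G_def]]) blast+
    have Hhol: "H holomorphic_on uhp" unfolding H_def
      by (rule holomorphic_slash[OF A]) (intro holomorphic_intros f ghol)
    have Hper: "H (\<tau> + of_real h) = H \<tau>" if "\<tau> \<in> uhp" for \<tau>
      using slash_modular_form_periodic[OF A fg that] by (simp add: H_def h_def)
    have Hbd: "Bfun H at_im_infty"
      using fg A by (auto simp: modular_forms_def holomorphic_modular_form_def H_def)
    obtain Q where Q: "Q holomorphic_on ball 0 1" "\<And>\<tau>. \<tau> \<in> uhp \<Longrightarrow> H \<tau> = Q (qpow (1 / h) \<tau>)"
      by (rule periodic_bounded_eq_holomorphic_qpow[OF h Hhol Hper Hbd]) blast+
    define R where "R = (\<lambda>z. Q z / S z)"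
    have R: "R holomorphic_on ball 0 1" unfolding R_def by (intro holomorphic_intros Q S)
    have FR: "F \<tau> = qpow (- x / h) \<tau> * R (qpow (1 / h) \<tau>)" if \<tau>: "\<tau> \<in> uhp" for \<tau>
    proof -
      have "qpow (- x / h) \<tau> * R (qpow (1 / h) \<tau>) * G \<tau> = (qpow (- (x / h)) \<tau> * qpow (x / h) \<tau>) * H \<tau>"
        using S(2)[OF qpow_in_ball[OF _ \<tau>], of "1 / h"] h by (simp add: R_def S(3)[OF \<tau>] Q(2)[OF \<tau>])
      hence "qpow (- x / h) \<tau> * R (qpow (1 / h) \<tau>) * G \<tau> = F \<tau> * G \<tau>"
        by (simp only: qpow_minus_mult mult_1 H[OF \<tau>])
      thus ?thesis using Gnz[OF \<tau>] by simp
    qed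
    define T where "T = rankin_cohen_disc (3/2) (1/2) v h x R S"
    have "slash (real (2 + 2 * v)) A RC \<tau> = T (qpow (1 / h) \<tau>)" if \<tau>: "\<tau> \<in> uhp" for \<tau>
    proof -
      have "RC (moebius A \<tau>) = autfac (3/2 + 1/2 + 2 * real v) A \<tau> * rankin_cohen (3/2) (1/2) v F G \<tau>"
        unfolding RC_def
        by (rule rankin_cohen_moebius[OF A _ _ f hol(1) ghol hol(2)])
           (use slash_eq[OF A] \<tau> in \<open>auto simp: F_def G_def\<close>)
      also have "rankin_cohen (3/2) (1/2) v F G \<tau> = T (qpow (1 / h) \<tau>)"
        unfolding T_def by (rule rankin_cohen_eq_disc[OF h R S(1) _ _ \<tau>]) (use FR S(3) in auto)
      finally show ?thesis unfolding weight using autfac_nonzero[OF A \<tau>] by (simp add: slash_def)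
    qed
    hence ev: "eventually (\<lambda>\<tau>. T (qpow (1 / h) \<tau>) = slash (real (2 + 2 * v)) A RC \<tau>) at_im_infty"
      using eventually_uhp_at_im_infty by (auto elim: eventually_mono)
    have Thol: "T holomorphic_on ball 0 1" unfolding T_def by (rule holomorphic_rankin_cohen_disc[OF R S(1)])
    have "((\<lambda>\<tau>. T (qpow (1 / h) \<tau>)) \<longlongrightarrow> T 0) at_im_infty"
      by (rule holomorphic_qpow_tendsto[OF Thol]) (use h in auto)
    hence "(slash (real (2 + 2 * v)) A RC \<longlongrightarrow> T 0) at_im_infty"
      using ev by (rule Lim_transform_eventually)
    moreover have "T 0 = 0" if lim: "(H \<longlongrightarrow> 0) at_im_infty"
    proof -
      have "((\<lambda>\<tau>. Q (qpow (1 / h) \<tau>)) \<longlongrightarrow> Q 0) at_im_infty"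
        by (rule holomorphic_qpow_tendsto[OF Q(1)]) (use h in auto)
      moreover have "eventually (\<lambda>\<tau>. Q (qpow (1 / h) \<tau>) = H \<tau>) at_im_infty"
        using eventually_uhp_at_im_infty Q(2) by (auto elim: eventually_mono)
      ultimately have "(H \<longlongrightarrow> Q 0) at_im_infty" by (rule Lim_transform_eventually)
      moreover have "at_im_infty \<noteq> bot"
      proof
        assume "at_im_infty = bot"
        hence "eventually (\<lambda>_. False) at_im_infty" by simp
        then obtain Y where "\<And>\<tau>. \<not> Im \<tau> > Y" by (auto simp: eventually_at_im_infty)
        from this[of "\<i> * of_real (Y + 1)"] show False by simp
      qed
      ultimately have "Q 0 = 0" using lim tendsto_unique by blast
      \<comment> \<open>At \<open>z = 0\<close> each Euler operator is multiplication by a constant,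
        so \<open>T 0\<close> is a multiple of \<open>R 0 * S 0\<close>, that is, of
        \<open>Q 0\<close>.\<close>
      thus ?thesis by (simp add: T_def rankin_cohen_disc_def euler_op_funpow_at_0 R_def)
    qed
    ultimately show ?thesis unfolding H_def by blast
  qed
  hence cusp: "\<And>A. A \<in> SL2Z \<Longrightarrow> \<exists>T. (slash (real (2 + 2 * v)) A RC \<longlongrightarrow> T) at_im_infty \<and>
        ((slash 2 A (\<lambda>\<tau>. f \<tau> * g \<tau>) \<longlongrightarrow> 0) at_im_infty \<longrightarrow> T = 0)" by blast
  show 1: "rankin_cohen (3/2) (1/2) v f g \<in> modular_forms (2 + 2 * v) N"
    unfolding modular_forms_def holomorphic_modular_form_def RC_def[symmetric]
    using RChol RCtr cusp tendsto_imp_Bfun by blast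
  show "rankin_cohen (3/2) (1/2) v f g \<in> cusp_forms (2 + 2 * v) N" if "(\<lambda>\<tau>. f \<tau> * g \<tau>) \<in> cusp_forms 2 N"
  proof -
    have "(slash (real (2 + 2 * v)) A RC \<longlongrightarrow> 0) at_im_infty" if A: "A \<in> SL2Z" for A
    proof -
      have "(slash 2 A (\<lambda>\<tau>. f \<tau> * g \<tau>) \<longlongrightarrow> 0) at_im_infty"
        using \<open>_ \<in> cusp_forms 2 N\<close> A by (simp add: cusp_forms_def)
      with cusp[OF A] show ?thesis by auto
    qed
    thus ?thesis unfolding cusp_forms_def using 1 by (simp add: RC_def)
  qed
qed

section \<open>Eta-quotients\<close>

definition euler_fn :: "complex \<Rightarrow> complex" where
  "euler_fn z = (\<Prod>n. 1 - z ^ Suc n)"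

text \<open>The partial product with \<open>n\<close> factors already determines the coefficient of
  index \<open>n\<close>, since every further factor changes only coefficients of index above
  \<open>n\<close>.\<close>

definition euler_fps :: "complex fps" where
  "euler_fps = Abs_fps (\<lambda>n. fps_nth (\<Prod>i<n. 1 - fps_X ^ Suc i) n)"

lemma convergent_prod_euler:
  assumes "cmod z < 1"
  shows "convergent_prod (\<lambda>n. 1 - z ^ Suc n)"
proof (rule abs_convergent_prod_imp_convergent_prod, rule summable_imp_abs_convergent_prod)
  have "summable (\<lambda>n. cmod z * cmod z ^ n)"
    using assms by (intro summable_mult summable_geometric) auto
  thus "summable (\<lambda>n. cmod (1 - z ^ Suc n - 1))" by (simp add: norm_mult norm_power)
qed

lemma euler_fn_nonzero:
  assumes "cmod z < 1"
  shows "euler_fn z \<noteq> 0"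
  unfolding euler_fn_def
proof (rule prodinf_nonzero[OF convergent_prod_euler[OF assms]])
  fix n
  have "cmod (z ^ Suc n) < 1" unfolding norm_power using assms by (subst power_less_one_iff) auto
  hence "z ^ Suc n \<noteq> 1" by (metis norm_one less_irrefl)
  thus "1 - z ^ Suc n \<noteq> 0" by (metis right_minus_eq)
qed

lemma uniform_limit_euler_fn:
  assumes "0 \<le> r" "r < 1"
  shows "uniform_limit (cball 0 r) (\<lambda>n z. \<Prod>i<n. 1 - z ^ Suc i) euler_fn sequentially"
proof -
  have "uniformly_convergent_on (cball 0 r) (\<lambda>N z. \<Sum>n<N. norm (- (z ^ Suc n) :: complex))"
  proof (rule Weierstrass_m_test')
    fix n :: nat and z :: complex
    assume "z \<in> cball 0 r"
    thus "norm (norm (- (z ^ Suc n))) \<le> \<bar>r\<bar> ^ Suc n"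
      unfolding norm_minus_cancel norm_power by (auto intro!: power_mono simp del: power_Suc)
  next
    show "summable (\<lambda>n. \<bar>r\<bar> ^ Suc n)"
      using assms by (subst summable_Suc_iff) (intro summable_geometric, auto)
  qed
  hence "uniformly_convergent_on (cball 0 r) (\<lambda>N z. \<Prod>n<N. 1 + - (z ^ Suc n) :: complex)"
    by (intro uniformly_convergent_on_prod continuous_intros compact_cball)
  then obtain L where L: "uniform_limit (cball 0 r) (\<lambda>n z. \<Prod>i<n. 1 - z ^ Suc i :: complex) L sequentially"
    by (auto simp: uniformly_convergent_on_def)
  moreover have "L z = euler_fn z" if z: "z \<in> cball 0 r" for z
  proof (rule LIMSEQ_unique)
    show "(\<lambda>n. \<Prod>i<n. 1 - z ^ Suc i) \<longlonglongrightarrow> L z" by (rule tendsto_uniform_limitI[OF L z])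
    have "cmod z < 1" using z assms by simp
    from convergent_prod_euler[OF this] show "(\<lambda>n. \<Prod>i<n. 1 - z ^ Suc i) \<longlonglongrightarrow> euler_fn z"
      unfolding euler_fn_def using convergent_prod_has_prod has_prod_imp_tendsto' by blast
  qed
  ultimately show ?thesis by (metis (no_types, lifting) uniform_limit_cong')
qed

lemma holomorphic_euler_fn: "euler_fn holomorphic_on ball 0 1"
proof (rule holomorphic_uniform_sequence)
  show "(\<lambda>z. \<Prod>i<n. 1 - z ^ Suc i) holomorphic_on ball 0 1" for n
    by (intro holomorphic_intros)
  fix z :: complex assume z: "z \<in> ball 0 1"
  define d where "d = (1 - cmod z) / 2"
  have d: "d > 0" "cmod z + d < 1" using z by (auto simp: d_def field_simps)
  have sub: "cball z d \<subseteq> cball 0 (cmod z + d)"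
  proof
    fix x assume "x \<in> cball z d"
    thus "x \<in> cball 0 (cmod z + d)"
      using norm_triangle_sub[of x z] by (simp add: dist_norm norm_minus_commute)
  qed
  show "\<exists>d>0. cball z d \<subseteq> ball 0 1 \<and> uniform_limit (cball z d) (\<lambda>n z. \<Prod>i<n. 1 - z ^ Suc i) euler_fn sequentially"
  proof (intro exI[of _ d] conjI)
    show "cball z d \<subseteq> ball 0 1" using sub d(2) by (force simp: subset_iff)
    show "uniform_limit (cball z d) (\<lambda>n z. \<Prod>i<n. 1 - z ^ Suc i) euler_fn sequentially"
      by (rule uniform_limit_on_subset[OF uniform_limit_euler_fn[OF _ d(2)] sub]) (use d in auto)
  qed (use d in auto)
qed auto

lemma fps_nth_euler_partial:
  assumes "n \<le> N"
  shows "fps_nth (\<Prod>i<N. 1 - fps_X ^ Suc i) n = fps_nth euler_fps n"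
  using assms
proof (induction N rule: dec_induct)
  case (step N)
  have "(\<Prod>i<Suc N. 1 - fps_X ^ Suc i) = (\<Prod>i<N. 1 - fps_X ^ Suc i) - (\<Prod>i<N. 1 - fps_X ^ Suc i) * (fps_X ^ Suc N :: complex fps)"
    by (simp add: algebra_simps)
  moreover have "fps_nth ((\<Prod>i<N. 1 - fps_X ^ Suc i) * (fps_X ^ Suc N :: complex fps)) n = 0"
    using step(1) by (simp only: fps_X_power_mult_right_nth) auto
  ultimately show ?case using step by (simp del: power_Suc prod.lessThan_Suc)
qed (simp add: euler_fps_def)

text \<open>Locally uniform convergence carries over to derivatives at \<open>0\<close>, and the
  Taylor coefficients of the partial products are eventually constant.\<close>

lemma euler_fn_has_fps_expansion: "euler_fn has_fps_expansion euler_fps"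
proof -
  have "euler_fn has_fps_expansion fps_expansion euler_fn 0"
    by (rule has_fps_expansion_fps_expansion[OF open_ball _ holomorphic_euler_fn]) auto
  moreover have "fps_expansion euler_fn 0 = euler_fps"
  proof (rule fps_ext)
    fix n
    define P :: "nat \<Rightarrow> complex \<Rightarrow> complex" where "P = (\<lambda>N z. \<Prod>i<N. 1 - z ^ Suc i)"
    have PN: "P N has_fps_expansion (\<Prod>i<N. 1 - fps_X ^ Suc i)" for N
      unfolding P_def by (intro fps_expansion_intros)
    have "(\<lambda>N. (deriv ^^ n) (P N) 0) \<longlonglongrightarrow> (deriv ^^ n) euler_fn 0"
    proof (rule higher_deriv_complex_uniform_limit)
      show "uniform_limit (ball 0 (1/2)) P euler_fn sequentially"
        unfolding P_def by (rule uniform_limit_on_subset[OF uniform_limit_euler_fn[of "1/2"]]) auto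
      show "\<forall>\<^sub>F N in sequentially. P N holomorphic_on ball 0 (1 / 2)"
        unfolding P_def by (intro always_eventually allI holomorphic_intros)
    qed auto
    hence "(\<lambda>N. (deriv ^^ n) (P N) 0 / fact n) \<longlonglongrightarrow> (deriv ^^ n) euler_fn 0 / fact n"
      by (intro tendsto_intros) auto
    moreover have "eventually (\<lambda>N. (deriv ^^ n) (P N) 0 / fact n = fps_nth euler_fps n) sequentially"
      using eventually_ge_at_top[of n]
      by eventually_elim (use fps_nth_fps_expansion[OF PN] fps_nth_euler_partial in metis)
    ultimately have "(\<lambda>_. fps_nth euler_fps n) \<longlonglongrightarrow> (deriv ^^ n) euler_fn 0 / fact n"
      by (rule Lim_transform_eventually)
    hence "fps_nth euler_fps n = (deriv ^^ n) euler_fn 0 / fact n"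
      by (simp add: LIMSEQ_const_iff)
    thus "fps_nth (fps_expansion euler_fn 0) n = fps_nth euler_fps n"
      by (simp add: fps_expansion_def)
  qed
  ultimately show ?thesis by simp
qed

lemma euler_fps_nth_0: "fps_nth euler_fps 0 = 1"
  by (simp add: euler_fps_def)

text \<open>The bridge from the formal infinite product of the statement, a limit in the topology of
  power series, to the Taylor series of the analytic Euler product at \<open>z^k\<close>.\<close>

lemma fps_qpoch_eq_compose:
  assumes "k > 0"
  shows "fps_qpoch k = fps_compose euler_fps (fps_X ^ k)"
proof -
  have X0: "fps_nth (fps_X ^ k :: complex fps) 0 = 0" using assms by simp
  have partial: "(\<Prod>i\<le>N. 1 - fps_X ^ (k * Suc i)) = fps_compose (\<Prod>i<Suc N. 1 - fps_X ^ Suc i) (fps_X ^ k :: complex fps)" for N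
  proof -
    have "fps_compose (1 - fps_X ^ Suc i) (fps_X ^ k) = (1 - fps_X ^ (k * Suc i) :: complex fps)" for i
    proof -
      have "fps_compose (fps_X ^ Suc i) (fps_X ^ k) = (fps_compose fps_X (fps_X ^ k :: complex fps)) ^ Suc i"
        by (rule fps_compose_power[OF X0, symmetric])
      also have "fps_compose fps_X (fps_X ^ k) = (fps_X ^ k :: complex fps)"
        by (rule fps_X_fps_compose_startby0[OF X0])
      finally show ?thesis by (simp add: fps_compose_sub_distrib del: power_Suc flip: power_mult)
    qed
    thus ?thesis by (simp only: fps_compose_prod_distrib[OF X0] lessThan_Suc_atMost)
  qed
  have "(\<lambda>N. \<Prod>i\<le>N. 1 - fps_X ^ (k * Suc i)) \<longlonglongrightarrow> fps_compose euler_fps (fps_X ^ k)"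
  proof (rule tendsto_fpsI)
    fix n
    show "\<forall>\<^sub>F N in sequentially. fps_nth (\<Prod>i\<le>N. 1 - fps_X ^ (k * Suc i)) n = fps_nth (fps_compose euler_fps (fps_X ^ k)) n"
      using eventually_ge_at_top[of n]
    proof eventually_elim
      case (elim N)
      show ?case unfolding partial fps_compose_nth
        by (intro sum.cong refl arg_cong2[of _ _ _ _ "(*)"] fps_nth_euler_partial) (use elim in auto)
    qed
  qed
  \<comment> \<open>Convergence of the infinite product in the sense of \<open>has_prod\<close> asks
    for a nonzero limit here; the constant term \<open>1\<close> guarantees it.\<close>
  moreover have "fps_nth (fps_compose euler_fps (fps_X ^ k)) 0 \<noteq> 0"
    by (simp add: euler_fps_nth_0)
  hence "fps_compose euler_fps (fps_X ^ k) \<noteq> 0" by (metis fps_zero_nth)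
  ultimately have "(\<lambda>n. 1 - fps_X ^ (k * Suc n)) has_prod fps_compose euler_fps (fps_X ^ k)"
    by (simp add: has_prod_def raw_has_prod_def)
  thus ?thesis unfolding fps_qpoch_def by (rule has_prod_unique[symmetric])
qed

lemma fps_qpoch_nth_0: "k > 0 \<Longrightarrow> fps_nth (fps_qpoch k) 0 = 1"
  by (simp add: fps_qpoch_eq_compose euler_fps_nth_0)

lemma has_fps_expansion_power_int:
  fixes F :: "complex fps"
  assumes "f has_fps_expansion F" "fps_nth F 0 \<noteq> 0"
  shows "(\<lambda>z. f z powi n) has_fps_expansion F powi n"
  unfolding power_int_def using assms by (cases "n \<ge> 0") (auto intro!: fps_expansion_intros)

text \<open>The eta-quotient at \<open>m\<tau>\<close> without its power of \<open>q\<close>, as a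
  function of \<open>z = q\<close>. The case \<open>m = 1\<close> belongs to
  \<open>g(\<tau>)\<close>, the case \<open>m = l\<close> to \<open>g(l\<tau>)\<close>.\<close>

definition eta_disc :: "nat \<Rightarrow> nat \<Rightarrow> (nat \<Rightarrow> int) \<Rightarrow> complex \<Rightarrow> complex" where
  "eta_disc m N r z = (\<Prod>\<delta> | \<delta> dvd N. euler_fn (z ^ (m * \<delta>)) powi r \<delta>)"

definition eta_fps :: "nat \<Rightarrow> nat \<Rightarrow> (nat \<Rightarrow> int) \<Rightarrow> complex fps" where
  "eta_fps m N r = (\<Prod>\<delta> | \<delta> dvd N. fps_qpoch (m * \<delta>) powi r \<delta>)"

lemma eta_disc_has_fps_expansion:
  assumes "N \<ge> 1" "m \<ge> 1"
  shows "eta_disc m N r has_fps_expansion eta_fps m N r"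
  unfolding eta_disc_def[abs_def] eta_fps_def
proof (intro has_fps_expansion_prod has_fps_expansion_power_int)
  fix \<delta> assume "\<delta> \<in> {\<delta>. \<delta> dvd N}"
  hence "m * \<delta> > 0" using assms by (auto intro: Nat.gr0I)
  thus "fps_nth (fps_qpoch (m * \<delta>)) 0 \<noteq> 0" by (simp add: fps_qpoch_nth_0)
  have "(\<lambda>z :: complex. z ^ (m * \<delta>)) has_fps_expansion fps_X ^ (m * \<delta>)"
    by (rule has_fps_expansion_fps_X_power)
  from has_fps_expansion_compose[OF euler_fn_has_fps_expansion this]
  show "(\<lambda>z. euler_fn (z ^ (m * \<delta>))) has_fps_expansion fps_qpoch (m * \<delta>)"
    using \<open>m * \<delta> > 0\<close> by (simp add: fps_qpoch_eq_compose o_def)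
qed

text \<open>On the analytic side the identity is immediate, and uniqueness of Taylor series
  transfers it; no formal rule for composing negative powers is called for.\<close>

lemma eta_fps_eq_compose:
  assumes "N \<ge> 1" "m \<ge> 1"
  shows "eta_fps m N r = fps_compose (eta_fps 1 N r) (fps_X ^ m)"
proof -
  have "(\<lambda>z :: complex. z ^ m) has_fps_expansion fps_X ^ m"
    by (rule has_fps_expansion_fps_X_power)
  from has_fps_expansion_compose[OF eta_disc_has_fps_expansion[of N 1 r] this]
  have "(eta_disc 1 N r \<circ> (\<lambda>z. z ^ m)) has_fps_expansion fps_compose (eta_fps 1 N r) (fps_X ^ m)"
    using assms by simp
  also have "eta_disc 1 N r \<circ> (\<lambda>z. z ^ m) = eta_disc m N r"
    by (simp add: fun_eq_iff eta_disc_def power_mult)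
  finally show ?thesis using fps_expansion_unique_complex eta_disc_has_fps_expansion[OF assms] by blast
qed

lemma power_in_ball: "m > 0 \<Longrightarrow> z \<in> ball 0 1 \<Longrightarrow> z ^ m \<in> ball (0 :: complex) 1"
  by (simp add: norm_power power_less_one_iff)

lemma eta_disc_arg:
  assumes "N \<ge> 1" "m \<ge> 1" "\<delta> dvd N" "cmod z < 1"
  shows "cmod (z ^ (m * \<delta>)) < 1"
proof -
  have "m * \<delta> > 0" using assms by (auto intro: Nat.gr0I)
  thus ?thesis using power_in_ball[of "m * \<delta>" z] assms(4) by simp
qed

lemma holomorphic_eta_disc:
  assumes "N \<ge> 1" "m \<ge> 1"
  shows "eta_disc m N r holomorphic_on ball 0 1"
  unfolding eta_disc_def[abs_def]
proof (intro holomorphic_on_prod holomorphic_on_power_int)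
  fix \<delta> assume \<delta>: "\<delta> \<in> {\<delta>. \<delta> dvd N}"
  show "(\<lambda>z. euler_fn (z ^ (m * \<delta>))) holomorphic_on ball 0 1"
    by (rule holomorphic_on_compose_gen[OF _ holomorphic_euler_fn, unfolded o_def])
       (use eta_disc_arg[OF assms] \<delta> in \<open>auto intro!: holomorphic_intros\<close>)
  show "0 \<le> r \<delta> \<or> (\<forall>z\<in>ball 0 1. euler_fn (z ^ (m * \<delta>)) \<noteq> 0)"
    using eta_disc_arg[OF assms, of \<delta>] \<delta> euler_fn_nonzero by auto
qed

lemma eta_disc_nonzero:
  assumes "N \<ge> 1" "m \<ge> 1" "z \<in> ball 0 1"
  shows "eta_disc m N r z \<noteq> 0"
proof -
  have "euler_fn (z ^ (m * \<delta>)) powi r \<delta> \<noteq> 0" if "\<delta> dvd N" for \<delta>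
    using eta_disc_arg[OF assms(1,2) that, of z] assms(3) euler_fn_nonzero by (simp add: power_int_not_zero)
  thus ?thesis using assms unfolding eta_disc_def by (subst prod_zero_iff) auto
qed

lemma qpow_powi: "qpow x \<tau> powi n = qpow (of_int n * x) \<tau>"
proof (cases "n \<ge> 0")
  case True
  thus ?thesis using qpow_of_nat_mult[of "nat n" x \<tau>] by (simp add: power_int_def)
next
  case False
  hence "qpow x \<tau> powi n = inverse (qpow (real (nat (- n)) * x) \<tau>)"
    unfolding qpow_of_nat_mult by (simp add: power_int_def power_inverse)
  also have "real (nat (- n)) * x = - (of_int n * x)" using False by simp
  also have "inverse (qpow (- (of_int n * x)) \<tau>) = qpow (of_int n * x) \<tau>"
    using qpow_minus_mult[of "of_int n * x" \<tau>] by (simp add: field_simps)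
  finally show ?thesis .
qed

lemma qpow_sum: "finite A \<Longrightarrow> qpow (\<Sum>i\<in>A. x i) \<tau> = (\<Prod>i\<in>A. qpow (x i) \<tau>)"
  by (induction A rule: finite_induct) (auto simp: qpow_add)

lemma qpow_of_nat: "qpow (real n) \<tau> = qpow 1 \<tau> ^ n"
  using qpow_of_nat_mult[of n 1 \<tau>] by simp

lemma dedekind_eta_of_nat_mult:
  "dedekind_eta (of_nat \<delta> * \<tau>) = qpow (real \<delta> / 24) \<tau> * euler_fn (qpow 1 \<tau> ^ \<delta>)"
proof -
  have scale: "qpow x (of_nat \<delta> * \<tau>) = qpow (real \<delta> * x) \<tau>" for x
    by (simp add: qpow_def mult_ac)
  have "qpow (real (Suc n)) (of_nat \<delta> * \<tau>) = (qpow 1 \<tau> ^ \<delta>) ^ Suc n" for n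
    by (simp only: scale qpow_of_nat of_nat_mult[symmetric] power_mult)
  thus ?thesis unfolding dedekind_eta_def scale euler_fn_def by simp
qed

lemma eta_quotient_eq:
  assumes "N \<ge> 1"
  shows "eta_quotient N r \<tau> = qpow ((\<Sum>\<delta> | \<delta> dvd N. real \<delta> * of_int (r \<delta>)) / 24) \<tau> * eta_disc 1 N r (qpow 1 \<tau>)"
proof -
  have "eta_quotient N r \<tau> = (\<Prod>\<delta> | \<delta> dvd N. qpow (of_int (r \<delta>) * (real \<delta> / 24)) \<tau> * euler_fn (qpow 1 \<tau> ^ \<delta>) powi r \<delta>)"
    unfolding eta_quotient_def dedekind_eta_of_nat_mult power_int_mult_distrib qpow_powi ..
  also have "\<dots> = qpow (\<Sum>\<delta> | \<delta> dvd N. of_int (r \<delta>) * (real \<delta> / 24)) \<tau> * eta_disc 1 N r (qpow 1 \<tau>)"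
    using assms by (simp add: prod.distrib qpow_sum eta_disc_def)
  also have "(\<Sum>\<delta> | \<delta> dvd N. of_int (r \<delta>) * (real \<delta> / 24)) = (\<Sum>\<delta> | \<delta> dvd N. real \<delta> * of_int (r \<delta>)) / 24"
    by (simp add: sum_divide_distrib mult.commute)
  finally show ?thesis .
qed

lemma eta_quotient_nonzero: "N \<ge> 1 \<Longrightarrow> \<tau> \<in> uhp \<Longrightarrow> eta_quotient N r \<tau> \<noteq> 0"
  using eta_disc_nonzero[of N 1 "qpow 1 \<tau>" r] qpow_in_ball[of 1 \<tau>] by (simp add: eta_quotient_eq)

section \<open>Integrality of the coefficients of eta products\<close>

definition int_fps :: "complex fps \<Rightarrow> bool" where
  "int_fps P \<longleftrightarrow> (\<forall>n. fps_nth P n \<in> \<int>)"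

lemma int_fps_mult: "int_fps P \<Longrightarrow> int_fps Q \<Longrightarrow> int_fps (P * Q)"
  by (auto simp: int_fps_def fps_mult_nth)

lemma int_fps_prod: "(\<And>i. i \<in> A \<Longrightarrow> int_fps (P i)) \<Longrightarrow> int_fps (prod P A)"
proof (induction A rule: infinite_finite_induct)
  case (insert x F)
  thus ?case by (auto intro: int_fps_mult)
qed (auto simp: int_fps_def)

lemma int_fps_power: "int_fps P \<Longrightarrow> int_fps (P ^ n)"
proof (induction n)
  case (Suc n)
  thus ?case by (auto intro: int_fps_mult)
qed (auto simp: int_fps_def)

lemma int_fps_compose: "int_fps P \<Longrightarrow> int_fps Q \<Longrightarrow> int_fps (fps_compose P Q)"
  using int_fps_power[of Q] by (auto simp: int_fps_def fps_compose_nth)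

lemma int_fps_inverse:
  assumes "int_fps P" "fps_nth P 0 = 1"
  shows "int_fps (inverse P)"
  unfolding int_fps_def
proof
  fix n
  have e: "P * inverse P = 1" using assms(2) by (intro inverse_mult_eq_1') auto
  show "fps_nth (inverse P) n \<in> \<int>"
  proof (induction n rule: less_induct)
    case (less n)
    show ?case
    proof (cases n)
      case 0
      thus ?thesis using assms(2) by simp
    next
      case (Suc m)
      have "0 = fps_nth (P * inverse P) n" unfolding e by (simp add: Suc)
      also have "\<dots> = fps_nth (inverse P) n + (\<Sum>i=Suc 0..n. fps_nth P i * fps_nth (inverse P) (n - i))"
        unfolding fps_mult_nth using assms(2) by (simp add: sum.atLeast_Suc_atMost)
      finally have "fps_nth (inverse P) n = - (\<Sum>i=Suc 0..n. fps_nth P i * fps_nth (inverse P) (n - i))"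
        by (simp add: add_eq_0_iff)
      also have "\<dots> \<in> \<int>"
        using assms(1) less.IH by (intro Ints_minus Ints_sum Ints_mult) (auto simp: int_fps_def)
      finally show ?thesis .
    qed
  qed
qed

lemma int_fps_eta_fps:
  assumes "N \<ge> 1" "m \<ge> 1"
  shows "int_fps (eta_fps m N r)"
  unfolding eta_fps_def
proof (rule int_fps_prod)
  fix \<delta> assume "\<delta> \<in> {\<delta>. \<delta> dvd N}"
  hence pos: "m * \<delta> > 0" using assms by (auto intro: Nat.gr0I)
  have "int_fps (1 - fps_X ^ k)" for k
    by (auto simp: int_fps_def fps_X_power_nth)
  hence "int_fps (\<Prod>i<n. 1 - fps_X ^ Suc i)" for n by (intro int_fps_prod)
  hence "int_fps euler_fps" by (simp add: int_fps_def euler_fps_def)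
  hence q: "int_fps (fps_qpoch (m * \<delta>))" unfolding fps_qpoch_eq_compose[OF pos]
    by (intro int_fps_compose int_fps_power) (auto simp: int_fps_def fps_X_def)
  show "int_fps (fps_qpoch (m * \<delta>) powi r \<delta>)"
    unfolding power_int_def using int_fps_power int_fps_inverse[OF q fps_qpoch_nth_0[OF pos]] q by auto
qed

lemma eta_fps_nth_0:
  assumes "N \<ge> 1" "m \<ge> 1"
  shows "fps_nth (eta_fps m N r) 0 = 1"
proof -
  have "fps_nth (fps_qpoch (m * \<delta>) powi r \<delta>) 0 = 1" if "\<delta> dvd N" for \<delta>
  proof -
    have "m * \<delta> > 0" using assms that by (auto intro: Nat.gr0I)
    thus ?thesis by (simp add: power_int_def fps_qpoch_nth_0 fps_nth_power_0)
  qed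
  moreover have "fps_nth (prod P A) 0 = (\<Prod>i\<in>A. fps_nth (P i) 0)" for P :: "nat \<Rightarrow> complex fps" and A
    by (induction A rule: infinite_finite_induct) auto
  ultimately show ?thesis by (simp add: eta_fps_def)
qed

section \<open>Theta expansions\<close>

text \<open>The coefficient of \<open>q^(k/w)\<close> in the theta series, with all \<open>m\<close>
  of the same square collected.\<close>

definition theta_coeff :: "(int \<Rightarrow> complex) \<Rightarrow> int \<Rightarrow> nat \<Rightarrow> complex" where
  "theta_coeff b s k = (\<Sum>m | s * m\<^sup>2 = int k. b m)"

lemma finite_square_fibre:
  assumes "(s :: int) > 0"
  shows "finite {m. s * m\<^sup>2 = int k}"
proof (rule finite_subset)
  show "{m. s * m\<^sup>2 = int k} \<subseteq> {- int k..int k}"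
  proof
    fix m assume "m \<in> {m. s * m\<^sup>2 = int k}"
    hence k: "s * m\<^sup>2 = int k" by simp
    have "1 * m\<^sup>2 \<le> s * m\<^sup>2" using assms by (intro mult_right_mono) auto
    moreover have "\<bar>m\<bar> \<le> m\<^sup>2"
      by (metis abs_ge_zero abs_mult_self_eq mult_left_mono mult.right_neutral power2_eq_square
          int_one_le_iff_zero_less linorder_le_less_linear mult_zero_left order_antisym order_refl)
    ultimately show "m \<in> {- int k..int k}" using k by auto
  qed
qed auto

text \<open>The unordered sum over \<open>m\<close> is regrouped along the finite fibres of
  \<open>m \<mapsto> s m^2\<close> and becomes an ordinary power series.\<close>

lemma theta_has_sum_imp_sums:
  assumes s: "s > 0" and sum: "((\<lambda>m. b m * z ^ nat (s * m\<^sup>2)) has_sum X) UNIV"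
  shows "(\<lambda>k. theta_coeff b s k * z ^ k) sums X"
proof (rule has_sum_imp_sums)
  define B where "B = (\<lambda>k. {m. s * m\<^sup>2 = int k})"
  have nn: "s * m\<^sup>2 \<ge> 0" for m using s by simp
  have "bij_betw snd (Sigma UNIV B) UNIV"
    by (rule bij_betwI[of _ _ _ "\<lambda>m. (nat (s * m\<^sup>2), m)"]) (use nn in \<open>auto simp: B_def\<close>)
  from has_sum_reindex_bij_betw[OF this, of "\<lambda>m. b m * z ^ nat (s * m\<^sup>2)"] sum
  have "((\<lambda>p. b (snd p) * z ^ nat (s * (snd p)\<^sup>2)) has_sum X) (Sigma UNIV B)" by simp
  thus "((\<lambda>k. theta_coeff b s k * z ^ k) has_sum X) UNIV"
  proof (rule has_sum_SigmaD)
    fix k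
    have fin: "finite (B k)" unfolding B_def by (rule finite_square_fibre[OF s])
    have "((\<lambda>m. b m * z ^ nat (s * m\<^sup>2)) has_sum (\<Sum>m\<in>B k. b m * z ^ nat (s * m\<^sup>2))) (B k)"
      by (rule has_sum_finite[OF fin])
    also have "(\<Sum>m\<in>B k. b m * z ^ nat (s * m\<^sup>2)) = theta_coeff b s k * z ^ k"
      unfolding theta_coeff_def sum_distrib_right by (intro sum.cong) (auto simp: B_def)
    finally show "((\<lambda>y. b (snd (k, y)) * z ^ nat (s * (snd (k, y))\<^sup>2)) has_sum theta_coeff b s k * z ^ k) (B k)"
      by simp
  qed
qed

text \<open>As \<open>l\<close> does not divide \<open>s\<close>, every \<open>m\<close> with
  \<open>s m^2 = l^2 k\<close> is divisible by \<open>l\<close>, so the fibre over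
  \<open>l^2 k\<close> is \<open>l\<close> times the fibre over \<open>k\<close>.\<close>

lemma theta_coeff_mult_square:
  assumes s: "s > 0" and l: "prime l" "\<not> int l dvd s" and b: "\<And>m. b (int l * m) = c * b m"
  shows "theta_coeff b s (l\<^sup>2 * k) = c * theta_coeff b s k"
proof -
  have pl: "prime (int l)" using l by simp
  have l0: "int l \<noteq> 0" using l(1) prime_gt_0_nat by force
  have "{m. s * m\<^sup>2 = int (l\<^sup>2 * k)} = (\<lambda>m. int l * m) ` {m. s * m\<^sup>2 = int k}"
  proof (intro equalityI subsetI)
    fix m assume "m \<in> {m. s * m\<^sup>2 = int (l\<^sup>2 * k)}"
    hence m: "s * m\<^sup>2 = int l ^ 2 * int k" by simp
    hence "int l dvd s * m\<^sup>2" by (simp add: power2_eq_square)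
    hence "int l dvd m" using pl l(2) by (meson prime_dvd_multD prime_dvd_power)
    then obtain m' where m': "m = int l * m'" by blast
    have "int l ^ 2 * (s * m'\<^sup>2) = int l ^ 2 * int k" using m by (simp add: m' power2_eq_square mult_ac)
    hence "s * m'\<^sup>2 = int k" using l0 by simp
    thus "m \<in> (\<lambda>m. int l * m) ` {m. s * m\<^sup>2 = int k}" using m' by auto
  qed (auto simp: power_mult_distrib)
  hence "theta_coeff b s (l\<^sup>2 * k) = (\<Sum>m\<in>(\<lambda>m. int l * m) ` {m. s * m\<^sup>2 = int k}. b m)"
    by (simp add: theta_coeff_def)
  also have "\<dots> = (\<Sum>m | s * m\<^sup>2 = int k. b (int l * m))"
    by (subst sum.reindex) (use l0 in \<open>auto simp: inj_on_def\<close>)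
  finally show ?thesis by (simp add: b theta_coeff_def sum_distrib_left)
qed

lemma qpow_eq_power_root:
  assumes "w > 0" "k \<ge> 0"
  shows "qpow (of_int k / of_int w) \<tau> = qpow (1 / of_int w) \<tau> ^ nat k"
  using qpow_of_nat_mult[of "nat k" "1 / of_int w" \<tau>] assms by simp

text \<open>Every nonzero point of the disc is a value of \<open>qpow (1 / h)\<close>, so
  convergence on the half-plane already means convergence on the whole disc.\<close>

lemma qpow_series_disc:
  assumes h: "h > 0"
    and sums: "\<And>\<tau>. \<tau> \<in> uhp \<Longrightarrow> (\<lambda>k. c k * qpow (1 / h) \<tau> ^ k) sums F \<tau>"
  obtains B where "B holomorphic_on ball 0 1" "B has_fps_expansion Abs_fps c"
    "\<And>\<tau>. \<tau> \<in> uhp \<Longrightarrow> B (qpow (1 / h) \<tau>) = F \<tau>"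
proof
  define B where "B = (\<lambda>z. \<Sum>k. c k * z ^ k)"
  have Bsums: "(\<lambda>k. c k * z ^ k) sums B z" if "z \<in> ball 0 1" for z
  proof (cases "z = 0")
    case False
    have "cmod z < 1" using that by simp
    then obtain \<tau> where "\<tau> \<in> uhp" "z = qpow (1 / h) \<tau>"
      using qpow_surj[OF h False] by blast
    thus ?thesis using sums unfolding B_def by (auto simp: sums_iff)
  next
    case True
    thus ?thesis unfolding B_def by (auto intro!: summable_sums)
  qed
  show "B holomorphic_on ball 0 1"
    by (rule power_series_holomorphic[where a = c]) (use Bsums in simp)
  show "B has_fps_expansion Abs_fps c"
  proof (rule has_fps_expansionI)
    have "eventually (\<lambda>u. u \<in> ball 0 1) (nhds (0 :: complex))"
      by (intro eventually_nhds_in_open) auto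
    thus "\<forall>\<^sub>F u in nhds 0. (\<lambda>n. fps_nth (Abs_fps c) n * u ^ n) sums B u"
      by eventually_elim (use Bsums in simp)
  qed
  show "B (qpow (1 / h) \<tau>) = F \<tau>" if "\<tau> \<in> uhp" for \<tau>
    using sums[OF that] by (simp add: B_def sums_iff)
qed

text \<open>The theta series and the eta product are compared as power series in
  \<open>z = q^(1/w)\<close>, where \<open>q = z^W\<close>.\<close>

lemma theta_expansion_coeffs:
  fixes s t w :: int
  assumes w: "w > 0" and s: "s > 0"
    and G: "G has_fps_expansion Gf" "fps_nth Gf 0 = 1"
    and g: "\<And>\<tau>. \<tau> \<in> uhp \<Longrightarrow> g \<tau> = qpow (of_int t / of_int w) \<tau> * G (qpow 1 \<tau>)"
    and g_exp: "\<And>\<tau>. \<tau> \<in> uhp \<Longrightarrow> ((\<lambda>m. b m * qpow (of_int (s * m\<^sup>2) / of_int w) \<tau>) has_sum g \<tau>) UNIV"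
  shows "t \<ge> 0"
    and "theta_coeff b s k = (if int k \<ge> t \<and> w dvd (int k - t) then fps_nth Gf (nat ((int k - t) div w)) else 0)"
proof -
  define h where "h = real_of_int w"
  have h: "h > 0" using w by (simp add: h_def)
  define W where "W = nat w"
  have W: "W > 0" "real W = h" "int W = w" using w by (simp_all add: W_def h_def)
  have root1: "qpow 1 \<tau> = qpow (1 / h) \<tau> ^ W" for \<tau>
    using qpow_of_nat_mult[of W "1 / h" \<tau>] h W by simp
  define Bf where "Bf = Abs_fps (theta_coeff b s)"
  have sums: "(\<lambda>k. theta_coeff b s k * qpow (1 / h) \<tau> ^ k) sums g \<tau>" if "\<tau> \<in> uhp" for \<tau>
  proof (rule theta_has_sum_imp_sums[OF s])
    have "qpow (of_int (s * m\<^sup>2) / of_int w) \<tau> = qpow (1 / h) \<tau> ^ nat (s * m\<^sup>2)" for m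
      unfolding h_def by (rule qpow_eq_power_root[OF w]) (use s in auto)
    thus "((\<lambda>m. b m * qpow (1 / h) \<tau> ^ nat (s * m\<^sup>2)) has_sum g \<tau>) UNIV"
      using g_exp[OF that] by simp
  qed
  obtain B where Bexp: "B has_fps_expansion Bf" and Bg: "\<And>\<tau>. \<tau> \<in> uhp \<Longrightarrow> B (qpow (1 / h) \<tau>) = g \<tau>"
    using qpow_series_disc[OF h sums] unfolding Bf_def by blast
  \<comment> \<open>The sign of \<open>t\<close> is still open, so \<open>t = tp - tm\<close> is
    split to keep all exponents natural. The extra factor \<open>z\<close> supplied by
    \<open>Suc\<close> makes the identity below true at \<open>z = 0\<close> too, a point that no
    \<open>\<tau>\<close> reaches.\<close>
  define tp tm where "tp = nat t" and "tm = nat (- t)"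
  have key: "z ^ Suc tm * B z = z ^ Suc tp * G (z ^ W)" if z: "z \<in> ball 0 1" for z
  proof (cases "z = 0")
    case False
    then obtain \<tau> where \<tau>: "\<tau> \<in> uhp" "z = qpow (1 / h) \<tau>"
      using z qpow_surj[OF h False] by auto
    have "z ^ tm * qpow (of_int t / h) \<tau> = z ^ tp"
    proof (cases "t \<ge> 0")
      case True
      thus ?thesis using qpow_eq_power_root[OF w True, of \<tau>] by (simp add: tp_def tm_def \<tau>(2) h_def)
    next
      case False
      hence "z ^ tm = qpow (of_int (- t) / h) \<tau>"
        using qpow_eq_power_root[OF w, of "- t" \<tau>] by (simp add: tm_def \<tau>(2) h_def)
      also have "\<dots> * qpow (of_int t / h) \<tau> = 1" using qpow_minus_mult[of "of_int t / h" \<tau>] by simp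
      finally show ?thesis using False by (simp add: tp_def)
    qed
    moreover have "B z = qpow (of_int t / h) \<tau> * G (z ^ W)"
      using Bg[OF \<tau>(1)] g[OF \<tau>(1)] by (simp add: \<tau>(2) root1 h_def)
    ultimately show ?thesis by (simp add: mult.assoc)
  qed auto
  have "(\<lambda>z :: complex. z ^ W) has_fps_expansion fps_X ^ W"
    by (rule has_fps_expansion_fps_X_power)
  from has_fps_expansion_compose[OF G(1) this] have GW: "(\<lambda>z. G (z ^ W)) has_fps_expansion fps_compose Gf (fps_X ^ W)"
    using W by (simp add: o_def)
  have "(\<lambda>z. z ^ Suc tm * B z) has_fps_expansion fps_X ^ Suc tm * Bf"
    by (intro has_fps_expansion_mult has_fps_expansion_fps_X_power Bexp)
  also have "?this \<longleftrightarrow> (\<lambda>z. z ^ Suc tp * G (z ^ W)) has_fps_expansion fps_X ^ Suc tm * Bf"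
  proof (intro has_fps_expansion_cong refl)
    have "eventually (\<lambda>u. u \<in> ball 0 1) (nhds (0 :: complex))"
      by (intro eventually_nhds_in_open) auto
    thus "\<forall>\<^sub>F z in nhds 0. z ^ Suc tm * B z = z ^ Suc tp * G (z ^ W)"
      by eventually_elim (use key in auto)
  qed
  finally have "fps_X ^ Suc tm * Bf = fps_X ^ Suc tp * fps_compose Gf (fps_X ^ W)"
    by (rule fps_expansion_unique_complex) (intro has_fps_expansion_mult has_fps_expansion_fps_X_power GW)
  hence eq: "fps_X ^ tm * Bf = fps_X ^ tp * fps_compose Gf (fps_X ^ W)"
    by (simp add: mult.assoc)
  \<comment> \<open>For negative \<open>t\<close> the constant coefficient would be \<open>0\<close>
    on the left and \<open>1\<close> on the right.\<close>
  show t: "t \<ge> 0"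
  proof (rule ccontr)
    assume "\<not> t \<ge> 0"
    hence "tm > 0" "tp = 0" by (auto simp: tm_def tp_def)
    with arg_cong[OF eq, of "\<lambda>F. fps_nth F 0"] show False
      by (simp add: G(2))
  qed
  hence "Bf = fps_X ^ tp * fps_compose Gf (fps_X ^ W)" using eq by (simp add: tm_def)
  hence "theta_coeff b s k = fps_nth (fps_X ^ tp * fps_compose Gf (fps_X ^ W)) k"
    by (metis Bf_def fps_nth_Abs_fps)
  also have "\<dots> = (if int k \<ge> t \<and> w dvd (int k - t) then fps_nth Gf (nat ((int k - t) div w)) else 0)"
  proof (cases "int k \<ge> t")
    case True
    hence "int (k - tp) = int k - t" using t by (simp add: tp_def of_nat_diff)
    moreover have "\<not> k < tp" using True by (simp add: tp_def)
    moreover have "W dvd (k - tp) \<longleftrightarrow> w dvd (int k - t)"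
      using calculation(1) W(3) by (metis int_dvd_int_iff)
    moreover have "(k - tp) div W = nat ((int k - t) div w)"
      using calculation(1) W(3) by (metis nat_int zdiv_int)
    ultimately show ?thesis using True W by (simp add: fps_X_power_mult_nth fps_nth_compose_X_power)
  next
    case False
    hence "k < tp" by (simp add: tp_def)
    thus ?thesis using False by (simp add: fps_X_power_mult_nth)
  qed
  finally show "theta_coeff b s k = (if int k \<ge> t \<and> w dvd (int k - t) then fps_nth Gf (nat ((int k - t) div w)) else 0)" .
qed

text \<open>If \<open>s\<close> were negative, \<open>g\<close> would be a power series in
  \<open>y = q^(-1/w)\<close>. It would converge for \<open>|y| > 1\<close>, hence be entire, and
  boundedness at \<open>i\<infinity>\<close> would make it bounded. By Liouville's theorem
  \<open>g\<close> would be constant, and a nonzero constant cannot have weight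
  \<open>1/2\<close>.\<close>

lemma theta_series_exponent_positive:
  fixes s w :: int
  assumes w: "w > 0" and s: "s \<noteq> 0" and N: "N \<ge> 1"
    and g: "holomorphic_modular_form N (1/2) \<nu> g" and nz: "\<And>\<tau>. \<tau> \<in> uhp \<Longrightarrow> g \<tau> \<noteq> 0"
    and g_exp: "\<And>\<tau>. \<tau> \<in> uhp \<Longrightarrow> ((\<lambda>m. b m * qpow (of_int (s * m\<^sup>2) / of_int w) \<tau>) has_sum g \<tau>) UNIV"
  shows "s > 0"
proof (rule ccontr)
  assume "\<not> s > 0"
  hence s': "- s > 0" using s by simp
  define h where "h = real_of_int w"
  have h: "h > 0" using w by (simp add: h_def)
  have sums: "(\<lambda>k. theta_coeff b (- s) k * inverse (qpow (1 / h) \<tau>) ^ k) sums g \<tau>" if "\<tau> \<in> uhp" for \<tau>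
  proof (rule theta_has_sum_imp_sums[OF s'])
    have "qpow (of_int (s * m\<^sup>2) / of_int w) \<tau> = inverse (qpow (1 / h) \<tau>) ^ nat (- s * m\<^sup>2)" for m
    proof -
      have "qpow (of_int (s * m\<^sup>2) / of_int w) \<tau> = inverse (qpow (of_int (- s * m\<^sup>2) / of_int w) \<tau>)"
        using qpow_minus_mult[of "of_int (s * m\<^sup>2) / of_int w" \<tau>] by (simp add: field_simps)
      also have "qpow (of_int (- s * m\<^sup>2) / of_int w) \<tau> = qpow (1 / of_int w) \<tau> ^ nat (- s * m\<^sup>2)"
        by (rule qpow_eq_power_root[OF w]) (use s' in \<open>auto intro: mult_nonpos_nonneg\<close>)
      finally show ?thesis by (simp add: h_def power_inverse)
    qed
    thus "((\<lambda>m. b m * inverse (qpow (1 / h) \<tau>) ^ nat (- s * m\<^sup>2)) has_sum g \<tau>) UNIV"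
      using g_exp[OF that] by simp
  qed
  define E where "E = (\<lambda>y. \<Sum>k. theta_coeff b (- s) k * y ^ k)"
  have outside: "\<exists>\<tau> \<in> uhp. y = inverse (qpow (1 / h) \<tau>) \<and> Im \<tau> = h * ln (cmod y) / (2 * pi)" if y: "cmod y > 1" for y
  proof -
    have "inverse y \<noteq> 0" "cmod (inverse y) < 1" using y by (auto simp: norm_inverse inverse_less_1_iff)
    then obtain \<tau> where \<tau>: "\<tau> \<in> uhp" "qpow (1 / h) \<tau> = inverse y" "Im \<tau> = - (h * ln (cmod (inverse y))) / (2 * pi)"
      using qpow_surj[OF h] by blast
    moreover have "cmod y > 0" using y by linarith
    hence "ln (cmod (inverse y)) = - ln (cmod y)" by (simp add: norm_inverse ln_inverse)
    ultimately show ?thesis by (intro bexI[of _ \<tau>]) auto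
  qed
  have Eg: "E (inverse (qpow (1 / h) \<tau>)) = g \<tau>" if "\<tau> \<in> uhp" for \<tau>
    using sums[OF that] by (simp add: E_def sums_iff)
  \<comment> \<open>The auxiliary point \<open>cmod y + 2\<close> lies outside the closed unit disc,
    where the series is known to converge, and is farther from \<open>0\<close> than
    \<open>y\<close>.\<close>
  have summ: "summable (\<lambda>k. theta_coeff b (- s) k * y ^ k)" for y
  proof (rule powser_inside)
    have "cmod (of_real (cmod y + 2)) > 1"
      using norm_ge_zero[of y] by (simp del: of_real_add norm_ge_zero)
    from outside[OF this] sums show "summable (\<lambda>k. theta_coeff b (- s) k * of_real (cmod y + 2) ^ k)"
      by (auto simp: sums_iff)
    show "cmod y < cmod (of_real (cmod y + 2))" by (simp del: of_real_add)
  qed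
  have E: "E holomorphic_on UNIV"
  proof -
    have "E field_differentiable at y" for y
      unfolding E_def field_differentiable_def
      using termdiffs_strong_converges_everywhere[of "theta_coeff b (- s)" y] summ by blast
    thus ?thesis by (simp add: holomorphic_on_def)
  qed
  define I :: "int^2^2" where "I = mat 1"
  have I: "I $ 1 $ 1 = 1" "I $ 1 $ 2 = 0" "I $ 2 $ 1 = 0" "I $ 2 $ 2 = 1"
    by (simp_all add: I_def mat_def)
  have "I \<in> SL2Z" by (simp add: SL2Z_def det_2 I)
  hence "Bfun (slash (1/2) I g) at_im_infty" using g by (auto simp: holomorphic_modular_form_def)
  moreover have "slash (1/2) I g = g"
    by (simp add: fun_eq_iff slash_def moebius_def autfac_def I)
  ultimately obtain K Y where KY: "\<And>\<tau>. Im \<tau> > Y \<Longrightarrow> cmod (g \<tau>) \<le> K"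
    by (auto simp: Bfun_def eventually_at_im_infty)
  define R where "R = exp (2 * pi * \<bar>Y\<bar> / h)"
  have R: "R \<ge> 1" using h by (simp add: R_def)
  have out: "cmod (E y) \<le> K" if y: "cmod y > R" for y
  proof -
    have y1: "cmod y > 1" using y R by linarith
    obtain \<tau> where \<tau>: "\<tau> \<in> uhp" "y = inverse (qpow (1 / h) \<tau>)" "Im \<tau> = h * ln (cmod y) / (2 * pi)"
      using outside[OF y1] by blast
    have "ln R < ln (cmod y)" using y R by (subst ln_less_cancel_iff) auto
    hence "Im \<tau> > \<bar>Y\<bar>" using h by (simp add: \<tau>(3) R_def field_simps)
    hence "Im \<tau> > Y" by simp
    thus ?thesis using KY Eg[OF \<tau>(1)] \<tau>(2) by simp
  qed
  have "compact (E ` cball 0 R)"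
    by (intro compact_continuous_image holomorphic_on_imp_continuous_on holomorphic_on_subset[OF E]) auto
  hence "bounded (E ` cball 0 R)" by (rule compact_imp_bounded)
  then obtain K' where "\<forall>x \<in> E ` cball 0 R. cmod x \<le> K'"
    unfolding bounded_iff by blast
  hence K': "\<And>y. cmod y \<le> R \<Longrightarrow> cmod (E y) \<le> K'" by simp
  have "bounded (range E)" unfolding bounded_iff
  proof (intro exI[of _ "max K K'"] ballI)
    fix x assume "x \<in> range E"
    then obtain y where "x = E y" by auto
    thus "cmod x \<le> max K K'" using out[of y] K'[of y] by (cases "cmod y > R") auto
  qed
  then obtain c where c: "\<And>y. E y = c" using Liouville_theorem[OF E] by (auto simp: constant_on_def)
  hence gc: "g \<tau> = c" if "\<tau> \<in> uhp" for \<tau> using Eg[OF that] by simp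
  \<comment> \<open>An element of the group with nonzero lower left entry. Squaring its
    transformation law removes the square root and makes \<open>denom A\<close> constant, which
    fails at \<open>\<i>\<close> and \<open>2 * \<i>\<close>.\<close>
  define A :: "int^2^2" where "A = vector [vector [1, 0], vector [int N, 1]]"
  have A: "A $ 1 $ 1 = 1" "A $ 1 $ 2 = 0" "A $ 2 $ 1 = int N" "A $ 2 $ 2 = 1"
    by (simp_all add: A_def)
  have AG: "A \<in> Gamma0 N" by (simp add: Gamma0_def SL2Z_def det_2 A)
  hence AS: "A \<in> SL2Z" using Gamma0_subset_SL2Z by auto
  have sq: "1 = (\<nu> A)\<^sup>2 * denom A \<tau>" if \<tau>: "\<tau> \<in> uhp" for \<tau>
  proof -
    have "g (moebius A \<tau>) = \<nu> A * autfac (1/2) A \<tau> * g \<tau>"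
      using g AG \<tau> by (auto simp: holomorphic_modular_form_def transforms_under_def)
    hence "c = \<nu> A * autfac (1/2) A \<tau> * c" using gc[OF \<tau>] gc[OF moebius_in_uhp[OF AS \<tau>]] by simp
    hence "1 = \<nu> A * autfac (1/2) A \<tau>" using nz[OF \<tau>] gc[OF \<tau>] by simp
    hence "1 = (\<nu> A * autfac (1/2) A \<tau>)\<^sup>2" by simp
    also have "\<dots> = (\<nu> A)\<^sup>2 * autfac (1/2 + 1/2) A \<tau>"
      unfolding autfac_add by (simp add: power2_eq_square)
    finally show ?thesis using autfac_of_nat[OF AS \<tau>, of 1] by simp
  qed
  have "denom A \<i> = denom A (2 * \<i>)"
    using sq[of \<i>] sq[of "2 * \<i>"] by (auto simp: uhp_def) (metis mult_cancel_left zero_neq_one mult_zero_left)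
  thus False using N by (simp add: denom_def A)
qed

section \<open>Congruences in \<open>\<int>\<^bsub>(\<ell>)\<^esub>\<close>\<close>

text \<open>Only the difference is constrained, not \<open>x\<close> and \<open>y\<close>
  themselves; therefore the product and power rules carry memberships in \<open>Z_loc l\<close>
  separately.\<close>

definition cong_loc :: "nat \<Rightarrow> complex \<Rightarrow> complex \<Rightarrow> bool" where
  "cong_loc l x y \<longleftrightarrow> (\<exists>z \<in> Z_loc l. x - y = of_nat l * z)"

lemma Z_locI: "coprime y (int l) \<Longrightarrow> of_int x / of_int y \<in> Z_loc l"
  unfolding Z_loc_def by blast

lemma Z_locE:
  assumes "z \<in> Z_loc l" "prime l"
  obtains x y where "z = of_int x / of_int y" "coprime y (int l)" "y \<noteq> 0"
proof -
  from assms(1) obtain x y where xy: "z = of_int x / of_int y" "coprime y (int l)"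
    by (auto simp: Z_loc_def)
  have "y \<noteq> 0" using xy(2) assms(2) prime_gt_1_nat by fastforce
  with xy show ?thesis by (rule that)
qed

lemma Z_loc_of_int [simp, intro]: "of_int x \<in> Z_loc l"
  using Z_locI[of 1 l x] by simp

lemma Z_loc_of_nat [simp, intro]: "of_nat x \<in> Z_loc l"
  using Z_loc_of_int[of "int x" l] by simp

lemma Z_loc_0 [simp, intro]: "0 \<in> Z_loc l"
  using Z_loc_of_int[of 0 l] by simp

lemma Z_loc_1 [simp, intro]: "1 \<in> Z_loc l"
  using Z_loc_of_int[of 1 l] by simp

lemma Z_loc_Ints: "x \<in> \<int> \<Longrightarrow> x \<in> Z_loc l"
  by (elim Ints_cases) auto

lemma Z_loc_uminus: "x \<in> Z_loc l \<Longrightarrow> - x \<in> Z_loc l"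
proof -
  assume "x \<in> Z_loc l"
  then obtain a b where "x = of_int a / of_int b" "coprime b (int l)" by (auto simp: Z_loc_def)
  thus ?thesis using Z_locI[of b l "- a"] by simp
qed

lemma cong_loc_refl [simp]: "cong_loc l x x"
  by (auto simp: cong_loc_def intro!: bexI[of _ 0])

definition rc_coeff :: "nat \<Rightarrow> nat \<Rightarrow> complex" where
  "rc_coeff v j = (-1) ^ j * of_real ((3/2 + real v - 1) gchoose (v - j)) * of_real ((1/2 + real v - 1) gchoose j)"

lemma of_real_gbinomial:
  "complex_of_real (y gchoose k) = (\<Prod>i<k. of_real y - of_nat i) / fact k"
  by (simp add: gbinomial_prod_rev atLeast0LessThan)

context
  fixes l :: nat
  assumes l: "prime l"
begin

lemma Z_loc_add: "x \<in> Z_loc l \<Longrightarrow> y \<in> Z_loc l \<Longrightarrow> x + y \<in> Z_loc l"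
proof -
  assume "x \<in> Z_loc l" "y \<in> Z_loc l"
  then obtain a b c d where "x = of_int a / of_int b" "coprime b (int l)" "b \<noteq> 0"
    "y = of_int c / of_int d" "coprime d (int l)" "d \<noteq> 0" using l by (metis Z_locE)
  moreover from this have "x + y = of_int (a * d + c * b) / of_int (b * d)"
    by (simp add: field_simps)
  ultimately show ?thesis using Z_locI[of "b * d" l "a * d + c * b"] by simp
qed

lemma Z_loc_mult: "x \<in> Z_loc l \<Longrightarrow> y \<in> Z_loc l \<Longrightarrow> x * y \<in> Z_loc l"
proof -
  assume "x \<in> Z_loc l" "y \<in> Z_loc l"
  then obtain a b c d where "x = of_int a / of_int b" "coprime b (int l)"
    "y = of_int c / of_int d" "coprime d (int l)" using l by (metis Z_locE)
  thus ?thesis using Z_locI[of "b * d" l "a * c"] by simp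
qed

lemma Z_loc_diff: "x \<in> Z_loc l \<Longrightarrow> y \<in> Z_loc l \<Longrightarrow> x - y \<in> Z_loc l"
  using Z_loc_add[of x "- y"] Z_loc_uminus by simp

lemma Z_loc_sum: "(\<And>i. i \<in> A \<Longrightarrow> f i \<in> Z_loc l) \<Longrightarrow> sum f A \<in> Z_loc l"
  by (induction A rule: infinite_finite_induct) (auto intro: Z_loc_add)

lemma Z_loc_prod: "(\<And>i. i \<in> A \<Longrightarrow> f i \<in> Z_loc l) \<Longrightarrow> prod f A \<in> Z_loc l"
  by (induction A rule: infinite_finite_induct) (auto intro: Z_loc_mult)

lemma Z_loc_power: "x \<in> Z_loc l \<Longrightarrow> x ^ n \<in> Z_loc l"
  by (induction n) (auto intro: Z_loc_mult)

lemma Z_loc_divide_int: "x \<in> Z_loc l \<Longrightarrow> \<not> int l dvd y \<Longrightarrow> x / of_int y \<in> Z_loc l"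
proof -
  assume x: "x \<in> Z_loc l" and y: "\<not> int l dvd y"
  have "coprime y (int l)"
    using l y prime_imp_coprime[of "int l" y] by (simp add: coprime_commute)
  from Z_loc_mult[OF x Z_locI[OF this, of 1]] show ?thesis by simp
qed

lemma cong_loc_sym: "cong_loc l x y \<Longrightarrow> cong_loc l y x"
  unfolding cong_loc_def by (metis Z_loc_uminus minus_diff_eq mult_minus_right)

lemma cong_loc_add: "cong_loc l x x' \<Longrightarrow> cong_loc l y y' \<Longrightarrow> cong_loc l (x + y) (x' + y')"
proof -
  assume "cong_loc l x x'" "cong_loc l y y'"
  then obtain z z' where "z \<in> Z_loc l" "x - x' = of_nat l * z" "z' \<in> Z_loc l" "y - y' = of_nat l * z'"
    unfolding cong_loc_def by blast
  moreover from this have "(x + y) - (x' + y') = of_nat l * (z + z')" by (simp add: algebra_simps)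
  ultimately show ?thesis unfolding cong_loc_def using Z_loc_add by blast
qed

lemma cong_loc_trans [trans]: "cong_loc l x y \<Longrightarrow> cong_loc l y z \<Longrightarrow> cong_loc l x z"
proof -
  assume "cong_loc l x y" "cong_loc l y z"
  then obtain u u' where "u \<in> Z_loc l" "x - y = of_nat l * u" "u' \<in> Z_loc l" "y - z = of_nat l * u'"
    unfolding cong_loc_def by blast
  moreover from this have "x - z = of_nat l * (u + u')" by (simp add: algebra_simps)
  ultimately show ?thesis unfolding cong_loc_def using Z_loc_add by blast
qed

lemma cong_loc_cmult: "cong_loc l x x' \<Longrightarrow> c \<in> Z_loc l \<Longrightarrow> cong_loc l (c * x) (c * x')"
proof -
  assume "cong_loc l x x'" "c \<in> Z_loc l"
  then obtain z where "z \<in> Z_loc l" "x - x' = of_nat l * z" unfolding cong_loc_def by blast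
  moreover from this have "c * x - c * x' = of_nat l * (c * z)" by (simp add: algebra_simps)
  ultimately show ?thesis unfolding cong_loc_def using Z_loc_mult \<open>c \<in> Z_loc l\<close> by blast
qed

lemma cong_loc_mult:
  "cong_loc l x x' \<Longrightarrow> cong_loc l y y' \<Longrightarrow> x \<in> Z_loc l \<Longrightarrow> y' \<in> Z_loc l \<Longrightarrow> cong_loc l (x * y) (x' * y')"
  using cong_loc_trans[OF cong_loc_cmult[of y y' x] cong_loc_cmult[of x x' y', unfolded mult.commute[of y']]] by simp

lemma cong_loc_diff: "cong_loc l x x' \<Longrightarrow> cong_loc l y y' \<Longrightarrow> cong_loc l (x - y) (x' - y')"
  using cong_loc_add[of x x' "- y" "- y'"] cong_loc_cmult[of y y' "- 1"] Z_loc_of_int[of "-1" l] by simp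

lemma cong_loc_sum: "(\<And>i. i \<in> A \<Longrightarrow> cong_loc l (f i) (g i)) \<Longrightarrow> cong_loc l (sum f A) (sum g A)"
  by (induction A rule: infinite_finite_induct) (auto intro: cong_loc_add)

lemma cong_loc_prod:
  "(\<And>i. i \<in> A \<Longrightarrow> cong_loc l (f i) (g i) \<and> f i \<in> Z_loc l \<and> g i \<in> Z_loc l) \<Longrightarrow> cong_loc l (prod f A) (prod g A)"
  by (induction A rule: infinite_finite_induct) (auto intro!: cong_loc_mult Z_loc_prod)

lemma cong_loc_power:
  "cong_loc l x y \<Longrightarrow> x \<in> Z_loc l \<Longrightarrow> y \<in> Z_loc l \<Longrightarrow> cong_loc l (x ^ n) (y ^ n)"
  by (induction n) (auto intro!: cong_loc_mult Z_loc_power)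

lemma cong_loc_of_int: "[x = y] (mod int l) \<Longrightarrow> cong_loc l (of_int x) (of_int y)"
proof -
  assume "[x = y] (mod int l)"
  then obtain k where "x - y = int l * k" by (auto simp: cong_iff_dvd_diff)
  hence "complex_of_int (x - y) = of_int (int l * k)" by simp
  thus ?thesis unfolding cong_loc_def by (intro bexI[of _ "of_int k"]) auto
qed

lemma cong_loc_0I: "z \<in> Z_loc l \<Longrightarrow> cong_loc l (of_nat l * z) 0"
  by (auto simp: cong_loc_def)

lemma not_dvd_fact: "m < l \<Longrightarrow> \<not> int l dvd fact m"
  using l by (metis of_nat_fact int_dvd_int_iff prime_dvd_fact_iff not_le)

text \<open>The upper entries are \<open>l/2\<close> and \<open>l/2 - 1\<close>. A falling factorial
  of \<open>l/2\<close> of positive length contains the factor \<open>l/2\<close>, hence is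
  \<open>0\<close> modulo \<open>l\<close>; the factors \<open>l/2 - 1 - i\<close> are congruent to
  \<open>-(i+1)\<close>, so the remaining binomial for \<open>j = v\<close> is congruent to
  \<open>(-1)^v\<close> and cancels the sign. The denominators are powers of \<open>2\<close> and
  factorials of numbers below \<open>l\<close>.\<close>

lemma rc_coeff_cong:
  assumes v: "l = 2 * v + 1" and j: "j \<le> v"
  shows "rc_coeff v j \<in> Z_loc l" and "cong_loc l (rc_coeff v j) (if j = v then 1 else 0)"
proof -
  have v0: "v > 0" using l v prime_gt_1_nat[of l] by (cases v) auto
  have two: "\<not> int l dvd 2" using v v0 by (auto dest!: zdvd_imp_le)
  have half: "of_int x / 2 \<in> Z_loc l" for x using Z_loc_divide_int[OF Z_loc_of_int two] by simp
  have f: "z / fact m \<in> Z_loc l" if "z \<in> Z_loc l" "m < l" for z m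
    using Z_loc_divide_int[OF that(1) not_dvd_fact[OF that(2)]] by simp
  have e1: "complex_of_real (3/2 + real v - 1) - of_nat i = of_int (int l - 2 * int i) / 2" for i
    by (simp add: v field_simps)
  have e2: "complex_of_real (1/2 + real v - 1) - of_nat i = of_int (int l - 2 - 2 * int i) / 2" for i
    by (simp add: v field_simps)
  have A: "complex_of_real ((3/2 + real v - 1) gchoose m) \<in> Z_loc l" if "m < l" for m
    unfolding of_real_gbinomial e1 by (intro f Z_loc_prod half that)
  have B: "complex_of_real ((1/2 + real v - 1) gchoose m) \<in> Z_loc l" if "m < l" for m
    unfolding of_real_gbinomial e2 by (intro f Z_loc_prod half that)
  have sg: "(-1) ^ j \<in> Z_loc l" for j using Z_loc_of_int[of "(-1) ^ j" l] by simp
  show "rc_coeff v j \<in> Z_loc l" unfolding rc_coeff_def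
    by (intro Z_loc_mult A B sg) (use v j in auto)
  show "cong_loc l (rc_coeff v j) (if j = v then 1 else 0)"
  proof (cases "j = v")
    case False
    define m where "m = v - j"
    have m: "m > 0" "m < l" using False j v by (auto simp: m_def)
    have "complex_of_real ((3/2 + real v - 1) gchoose m) =
      of_nat l * ((1 / of_int 2) * (\<Prod>i\<in>{..<m} - {0}. of_int (int l - 2 * int i) / 2) / fact m)"
      unfolding of_real_gbinomial e1
      by (subst prod.remove[of _ 0]) (use m in auto)
    hence "rc_coeff v j = of_nat l * ((-1) ^ j * ((1 / of_int 2) * (\<Prod>i\<in>{..<m} - {0}. of_int (int l - 2 * int i) / 2) / fact m)
       * of_real ((1/2 + real v - 1) gchoose j))"
      by (simp add: rc_coeff_def m_def[symmetric])
    also have "cong_loc l \<dots> 0"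
      by (intro cong_loc_0I Z_loc_mult sg f Z_loc_prod half Z_loc_divide_int Z_loc_1 two m B) (use v j in auto)
    finally show ?thesis using False by simp
  next
    case True
    have "cong_loc l (\<Prod>i<v. complex_of_int (int l - 2 - 2 * int i) / 2) (\<Prod>i<v. - of_nat (Suc i))"
    proof (intro cong_loc_prod conjI half)
      fix i
      have "complex_of_int (int l - 2 - 2 * int i) / 2 - - of_nat (Suc i) = of_nat l * (of_int 1 / 2)"
        by (simp add: field_simps)
      thus "cong_loc l (complex_of_int (int l - 2 - 2 * int i) / 2) (- of_nat (Suc i))"
        unfolding cong_loc_def using half by blast
      show "- complex_of_nat (Suc i) \<in> Z_loc l" by (intro Z_loc_uminus Z_loc_of_nat)
    qed
    also have "(\<Prod>i<v. - complex_of_nat (Suc i)) = (-1) ^ v * fact v"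
    proof -
      have "(\<Prod>i<v. - complex_of_nat (Suc i)) = (\<Prod>i<v. (-1) * complex_of_nat (Suc i))" by simp
      also have "\<dots> = (-1) ^ v * (\<Prod>i<v. complex_of_nat (Suc i))" by (simp only: prod.distrib prod_constant card_lessThan)
      also have "(\<Prod>i<v. complex_of_nat (Suc i)) = fact v"
        by (simp only: fact_prod_Suc of_nat_prod atLeast0LessThan)
      finally show ?thesis .
    qed
    finally have "cong_loc l ((-1) ^ v / fact v * (\<Prod>i<v. complex_of_int (int l - 2 - 2 * int i) / 2))
       ((-1) ^ v / fact v * ((-1) ^ v * fact v))"
      by (rule cong_loc_cmult) (use f sg v in auto)
    also have "(-1) ^ v / fact v * ((-1) ^ v * fact v) = (1 :: complex)"
      by (simp flip: power_mult_distrib)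
    finally show ?thesis using True unfolding rc_coeff_def of_real_gbinomial e2 by simp
  qed
qed

lemma fermat_int:
  assumes "\<not> int l dvd x" "even (l - 1)"
  shows "[x ^ (l - 1) = 1] (mod int l)"
proof -
  have "\<not> l dvd nat \<bar>x\<bar>" using assms(1) by (simp flip: int_dvd_int_iff)
  from fermat_theorem[OF l this] have "[int (nat \<bar>x\<bar> ^ (l - 1)) = int 1] (mod int l)"
    by (simp only: cong_int_iff)
  thus ?thesis using assms(2) by (simp add: power_even_abs)
qed

text \<open>The case \<open>j = v\<close> leaves \<open>(i - x)^v\<close>. Since
  \<open>i + n'\<close> is a multiple of \<open>l\<close>, this is congruent to
  \<open>(-(n' + x))^v\<close>, which depends only on the exponent contributed by \<open>g\<close>.
  The hypothesis \<open>rep\<close> says that this exponent occurs in the theta series.\<close>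

lemma bracket_coeff_cong:
  fixes s t w :: int
  assumes v: "l = 2 * v + 1" and w: "w > 0" and lsw: "\<not> int l dvd s * w"
    and rep: "\<exists>m. s * m\<^sup>2 = w * int n' + t" and i: "i + n' = l * M"
  defines "x \<equiv> complex_of_int t / of_int w"
  shows "cong_loc l (1 - of_int (Legendre (- s * w) (int l)) *
            (\<Sum>j\<le>v. rc_coeff v j * (of_nat i - x) ^ j * (of_nat n' + x) ^ (v - j)))
          (if int l dvd w * int n' + t then 1 else 0)"
    and "(of_nat i - x) \<in> Z_loc l" and "(of_nat n' + x) \<in> Z_loc l"
proof -
  have pl: "prime (int l)" using l by simp
  have lw: "\<not> int l dvd w" and ls: "\<not> int l dvd s" using lsw by auto
  have v0: "v > 0" using l v prime_gt_1_nat[of l] by (cases v) auto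
  have x: "x \<in> Z_loc l" unfolding x_def by (rule Z_loc_divide_int[OF Z_loc_of_int lw])
  define y where "y = complex_of_nat i - x"
  show y: "complex_of_nat i - x \<in> Z_loc l" and y': "complex_of_nat n' + x \<in> Z_loc l"
    by (intro Z_loc_diff Z_loc_add x Z_loc_of_nat)+
  define \<epsilon> where "\<epsilon> = Legendre (- s * w) (int l)"
  have "cong_loc l (\<Sum>j\<le>v. rc_coeff v j * y ^ j * (of_nat n' + x) ^ (v - j))
     (\<Sum>j\<le>v. (if j = v then 1 else 0) * y ^ j * (of_nat n' + x) ^ (v - j))"
    unfolding mult.assoc using y y'
    by (intro cong_loc_sum cong_loc_mult rc_coeff_cong[OF v] cong_loc_refl Z_loc_mult Z_loc_power)
       (auto simp: y_def)
  also have "(\<Sum>j\<le>v. (if j = v then 1 else 0) * y ^ j * (of_nat n' + x) ^ (v - j)) = y ^ v"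
    by (subst sum.remove[of _ v]) (auto intro!: sum.neutral)
  finally have "cong_loc l (of_int \<epsilon> * (\<Sum>j\<le>v. rc_coeff v j * y ^ j * (of_nat n' + x) ^ (v - j))) (of_int \<epsilon> * y ^ v)"
    by (rule cong_loc_cmult) auto
  also have "cong_loc l (of_int \<epsilon> * y ^ v) (if int l dvd w * int n' + t then 0 else 1)"
  proof -
    \<comment> \<open>The exponent \<open>n' + x\<close> of \<open>g\<close> with its denominator
      cleared; it equals \<open>s m^2\<close>.\<close>
    define u where "u = w * int n' + t"
    have yu: "y = of_nat l * of_nat M - of_int u / of_int w"
    proof -
      have "complex_of_nat i = of_nat (l * M) - of_nat n'" using i by (metis add_diff_cancel_right' of_nat_add)
      moreover have "of_int u / of_int w = of_nat n' + x" using w by (simp add: x_def u_def field_simps)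
      ultimately show ?thesis by (simp add: y_def)
    qed
    have uw: "of_int u / of_int w \<in> Z_loc l" by (rule Z_loc_divide_int[OF Z_loc_of_int lw])
    show ?thesis
    proof (cases "int l dvd u")
      case True
      then obtain k where k: "u = int l * k" by blast
      have "y = of_nat l * (of_nat M - of_int k / of_int w)"
        using yu k by (simp add: algebra_simps)
      moreover have "of_nat M - of_int k / of_int w \<in> Z_loc l"
        by (intro Z_loc_diff Z_loc_of_nat Z_loc_divide_int Z_loc_of_int lw)
      ultimately have "cong_loc l y 0" by (simp add: cong_loc_0I)
      from cong_loc_power[OF this, of v] have "cong_loc l (y ^ v) (0 ^ v)" using y by (simp add: y_def)
      from cong_loc_cmult[OF this Z_loc_of_int[of \<epsilon>]] show ?thesis using True v0 by (simp add: u_def zero_power)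
    next
      case False
      obtain m where m: "s * m\<^sup>2 = u" using rep by (auto simp: u_def)
      have lm: "\<not> int l dvd s * m"
      proof
        assume "int l dvd s * m"
        hence "int l dvd s * m * m" by (rule dvd_mult2)
        thus False using False m by (simp add: power2_eq_square mult.assoc)
      qed
      have "cong_loc l y (- (of_int u / of_int w))"
        using cong_loc_diff[OF cong_loc_0I[OF Z_loc_of_nat[of M]] cong_loc_refl[of l "of_int u / of_int w"]]
        by (simp add: yu)
      from cong_loc_power[OF this, of v] have 1: "cong_loc l (y ^ v) ((- (of_int u / of_int w)) ^ v)"
        using y Z_loc_uminus[OF uw] by (simp add: y_def)
      have "[\<epsilon> = (- s * w) ^ v] (mod int l)"
        unfolding \<epsilon>_def using euler_criterion[of l "- s * w"] l v v0 by simp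
      hence 2: "cong_loc l (of_int \<epsilon>) (of_int ((- s * w) ^ v))" by (rule cong_loc_of_int)
      have "cong_loc l (of_int \<epsilon> * y ^ v) (of_int ((- s * w) ^ v) * (- (of_int u / of_int w)) ^ v)"
        by (rule cong_loc_mult[OF 2 1]) (use uw in \<open>auto intro: Z_loc_power Z_loc_uminus\<close>)
      also have "of_int ((- s * w) ^ v) * (- (of_int u / of_int w)) ^ v = complex_of_int ((s * m) ^ (l - 1))"
      proof -
        \<comment> \<open>The Legendre symbol is taken at \<open>-sw\<close> so that this product is
          the perfect square \<open>(s m)^2\<close>; its power \<open>v\<close> is
          \<open>(s m)^(l-1)\<close>, and Fermat's theorem applies.\<close>
        have "of_int (- s * w) * (- (of_int u / of_int w)) = complex_of_int ((s * m)\<^sup>2)"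
          unfolding m[symmetric] using w by (simp add: power2_eq_square field_simps)
        hence "of_int ((- s * w) ^ v) * (- (of_int u / of_int w)) ^ v = complex_of_int ((s * m)\<^sup>2) ^ v"
          by (metis of_int_power power_mult_distrib)
        thus ?thesis by (simp add: v power_mult flip: of_int_power)
      qed
      also have "cong_loc l \<dots> (of_int 1)"
        by (intro cong_loc_of_int fermat_int lm) (simp add: v)
      finally show ?thesis using False by (simp add: u_def)
    qed
  qed
  finally have "cong_loc l (1 - of_int \<epsilon> * (\<Sum>j\<le>v. rc_coeff v j * y ^ j * (of_nat n' + x) ^ (v - j)))
     (1 - (if int l dvd w * int n' + t then 0 else 1))"
    by (intro cong_loc_diff cong_loc_refl)
  thus "cong_loc l (1 - of_int (Legendre (- s * w) (int l)) *
            (\<Sum>j\<le>v. rc_coeff v j * (of_nat i - x) ^ j * (of_nat n' + x) ^ (v - j)))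
          (if int l dvd w * int n' + t then 1 else 0)"
    by (simp add: \<epsilon>_def y_def split: if_splits)
qed

end

section \<open>The coefficients of the bracket\<close>

lemma euler_op_has_fps_expansion:
  assumes "R has_fps_expansion F"
  shows "(euler_op 1 x ^^ n) R has_fps_expansion Abs_fps (\<lambda>k. (of_nat k + of_real x) ^ n * fps_nth F k)"
proof (induction n)
  case 0
  have "Abs_fps (fps_nth F) = F" by (rule fps_ext) simp
  thus ?case using assms by simp
next
  case (Suc n)
  define T Tf where "T = (euler_op 1 x ^^ n) R" and "Tf = Abs_fps (\<lambda>k. (of_nat k + of_real x) ^ n * fps_nth F k)"
  have T: "T has_fps_expansion Tf" using Suc by (simp add: T_def Tf_def)
  have "(\<lambda>z. of_real x * T z + z * deriv T z) has_fps_expansion fps_const (of_real x) * Tf + fps_X * fps_deriv Tf"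
    by (intro fps_expansion_intros T)
  also have "(\<lambda>z. of_real x * T z + z * deriv T z) = (euler_op 1 x ^^ Suc n) R"
    by (simp add: fun_eq_iff euler_op_def T_def)
  also have "fps_const (of_real x) * Tf + fps_X * fps_deriv Tf = Abs_fps (\<lambda>k. (of_nat k + of_real x) ^ Suc n * fps_nth F k)"
  proof (rule fps_ext)
    fix k
    show "fps_nth (fps_const (of_real x) * Tf + fps_X * fps_deriv Tf) k = fps_nth (Abs_fps (\<lambda>k. (of_nat k + of_real x) ^ Suc n * fps_nth F k)) k"
      by (cases k) (simp_all add: Tf_def algebra_simps)
  qed
  finally show ?case .
qed

text \<open>On the term of \<open>f\<close> with exponent \<open>i - x\<close> the operator D acts
  as \<open>i - x\<close>, on the term of \<open>g\<close> with exponent \<open>k + x\<close> as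
  \<open>k + x\<close>. The inner sum collects these eigenvalues.\<close>

lemma rankin_cohen_disc_has_fps_expansion:
  assumes "R has_fps_expansion F" "S has_fps_expansion G"
  shows "rankin_cohen_disc (3/2) (1/2) v 1 x R S has_fps_expansion
    Abs_fps (\<lambda>n. \<Sum>i=0..n. fps_nth F i * fps_nth G (n - i) *
       (\<Sum>j\<le>v. rc_coeff v j * (of_nat i - of_real x) ^ j * (of_nat (n - i) + of_real x) ^ (v - j)))"
proof -
  define E where "E = (\<lambda>y k H. Abs_fps (\<lambda>i. (of_nat i + of_real y) ^ k * fps_nth (H :: complex fps) i))"
  have "(\<lambda>z. \<Sum>j\<le>v. rc_coeff v j * ((euler_op 1 (- x) ^^ j) R z * (euler_op 1 x ^^ (v - j)) S z)) has_fps_expansion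
     (\<Sum>j\<le>v. fps_const (rc_coeff v j) * (E (- x) j F * E x (v - j) G))"
    unfolding E_def
    by (intro has_fps_expansion_sum has_fps_expansion_cmult_left has_fps_expansion_mult
        euler_op_has_fps_expansion assms)
  also have "(\<lambda>z. \<Sum>j\<le>v. rc_coeff v j * ((euler_op 1 (- x) ^^ j) R z * (euler_op 1 x ^^ (v - j)) S z))
     = rankin_cohen_disc (3/2) (1/2) v 1 x R S"
    unfolding fun_eq_iff rankin_cohen_disc_def rc_coeff_def by (simp only: mult.assoc) simp
  also have "(\<Sum>j\<le>v. fps_const (rc_coeff v j) * (E (- x) j F * E x (v - j) G)) =
    Abs_fps (\<lambda>n. \<Sum>i=0..n. fps_nth F i * fps_nth G (n - i) *
       (\<Sum>j\<le>v. rc_coeff v j * (of_nat i - of_real x) ^ j * (of_nat (n - i) + of_real x) ^ (v - j)))"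
  proof (rule fps_ext)
    fix n
    have "fps_nth (\<Sum>j\<le>v. fps_const (rc_coeff v j) * (E (- x) j F * E x (v - j) G)) n =
      (\<Sum>j\<le>v. \<Sum>i=0..n. rc_coeff v j * ((of_nat i - of_real x) ^ j * fps_nth F i * ((of_nat (n - i) + of_real x) ^ (v - j) * fps_nth G (n - i))))"
      unfolding fps_sum_nth fps_mult_left_const_nth
      unfolding fps_mult_nth E_def fps_nth_Abs_fps sum_distrib_left by simp
    also have "\<dots> = (\<Sum>i=0..n. \<Sum>j\<le>v. rc_coeff v j * ((of_nat i - of_real x) ^ j * fps_nth F i * ((of_nat (n - i) + of_real x) ^ (v - j) * fps_nth G (n - i))))"
      by (rule sum.swap)
    also have "\<dots> = (\<Sum>i=0..n. fps_nth F i * fps_nth G (n - i) *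
       (\<Sum>j\<le>v. rc_coeff v j * (of_nat i - of_real x) ^ j * (of_nat (n - i) + of_real x) ^ (v - j)))"
      unfolding sum_distrib_left by (intro sum.cong refl) (simp only: mult_ac)
    finally show "fps_nth (\<Sum>j\<le>v. fps_const (rc_coeff v j) * (E (- x) j F * E x (v - j) G)) n = fps_nth (Abs_fps (\<lambda>n. \<Sum>i=0..n. fps_nth F i * fps_nth G (n - i) *
       (\<Sum>j\<le>v. rc_coeff v j * (of_nat i - of_real x) ^ j * (of_nat (n - i) + of_real x) ^ (v - j)))) n"
      by simp
  qed
  finally show ?thesis .
qed

text \<open>On the right stand the terms whose \<open>g\<close>-exponent, in units of
  \<open>1/W\<close>, is divisible by \<open>l\<close>; on the left stands a coefficient of
  \<open>c\<close> times the eta product at \<open>q^l\<close> times the shifted series of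
  \<open>a\<close>. The hypotheses \<open>d1\<close> and \<open>d2\<close> express the index of
  \<open>a\<close> by an equation in natural numbers, cleared of denominators and free of
  subtraction.\<close>

lemma sieved_sum_eq:
  fixes G a d \<beta> :: "nat \<Rightarrow> complex" and W T l M :: nat
  assumes W: "W > 0" and l: "l > 0"
    and G: "\<And>i. \<beta> (T + W * i) = G i" and supp: "\<And>k. \<beta> k \<noteq> 0 \<Longrightarrow> \<exists>i. k = T + W * i"
    and mult: "\<And>k. \<beta> (l\<^sup>2 * k) = c * \<beta> k" and sq: "\<And>k. \<beta> k \<noteq> 0 \<Longrightarrow> l dvd k \<Longrightarrow> l\<^sup>2 dvd k"
    and d1: "\<And>p n. p \<le> M \<Longrightarrow> W * n + W * (l * p) + T * l\<^sup>2 = W * (l * M) + T \<Longrightarrow> d p = a n"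
    and d2: "\<And>p. p \<le> M \<Longrightarrow> d p \<noteq> 0 \<Longrightarrow> \<exists>n. W * n + W * (l * p) + T * l\<^sup>2 = W * (l * M) + T"
  shows "(\<Sum>p=0..M. (if l dvd p then c * G (p div l) else 0) * d p) =
         (\<Sum>n'=0..l*M. if l dvd W * n' + T then a (l * M - n') * G n' else 0)"
proof -
  define L where "L = (\<lambda>p. (if l dvd p then c * G (p div l) else 0) * d p)"
  define R where "R = (\<lambda>n'. if l dvd W * n' + T then a (l * M - n') * G n' else 0)"
  \<comment> \<open>The correspondence is a bijection only between nonzero terms: elsewhere the
    index of \<open>a\<close> may fail to be a natural number, or \<open>T + W n'\<close> may not
    come from any \<open>i\<close>.\<close>
  define S1 where "S1 = {p \<in> {0..M}. L p \<noteq> 0}"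
  define S2 where "S2 = {n' \<in> {0..l*M}. R n' \<noteq> 0}"
  define f where "f = (\<lambda>p. (l\<^sup>2 * (T + W * (p div l)) - T) div W)"
  define g where "g = (\<lambda>n'. l * (((T + W * n') div l\<^sup>2 - T) div W))"
  \<comment> \<open>The terms \<open>p = li\<close> and \<open>n'\<close> correspond if their exponents differ by the factor \<open>l\<^sup>2\<close>.\<close>
  have rel: "f (l * i) = n'" "g n' = l * i" if "T + W * n' = l\<^sup>2 * (T + W * i)" for i n'
  proof -
    show "f (l * i) = n'" using l W by (simp add: f_def flip: that)
    show "g n' = l * i" using l W by (simp add: g_def that)
  qed
  have GG: "G n' = c * G i" if "T + W * n' = l\<^sup>2 * (T + W * i)" for i n'
    using mult[of "T + W * i"] G by (simp flip: that)
  have LR: "L (l * i) = R n'"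
    if e: "T + W * n' = l\<^sup>2 * (T + W * i)" and le: "l * i \<le> M" "n' \<le> l * M" for i n'
  proof -
    have "W * (l * M - n') + W * n' = W * (l * M)" using le(2) by (simp flip: add_mult_distrib2)
    moreover have "l\<^sup>2 * (T + W * i) = W * (l * (l * i)) + T * l\<^sup>2"
      by (simp add: power2_eq_square algebra_simps)
    ultimately have "W * (l * M - n') + W * (l * (l * i)) + T * l\<^sup>2 = W * (l * M) + T"
      using e by linarith
    from d1[OF le(1) this] have "d (l * i) = a (l * M - n')" .
    moreover have "l dvd W * n' + T"
      using e by (simp add: add.commute power2_eq_square mult.assoc)
    ultimately show ?thesis using l GG[OF e] by (simp add: L_def R_def)
  qed
  have F1: "\<exists>i n'. p = l * i \<and> T + W * n' = l\<^sup>2 * (T + W * i) \<and> n' \<le> l * M" if p: "p \<in> S1" for p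
  proof -
    have pM: "p \<le> M" and nz: "l dvd p" "d p \<noteq> 0" using p by (auto simp: S1_def L_def split: if_splits)
    obtain i where i: "p = l * i" using nz(1) by blast
    obtain n where n: "W * n + W * (l * p) + T * l\<^sup>2 = W * (l * M) + T" using d2[OF pM nz(2)] by blast
    have "T * 1 \<le> T * l\<^sup>2" using l by (intro mult_le_mono) auto
    hence "W * n \<le> W * (l * M)" using n by linarith
    hence nM: "n \<le> l * M" using W by simp
    hence "W * (l * M - n) + W * n = W * (l * M)" by (simp flip: add_mult_distrib2)
    moreover have "l\<^sup>2 * (T + W * i) = W * (l * p) + T * l\<^sup>2"
      by (simp add: i power2_eq_square algebra_simps)
    ultimately have "T + W * (l * M - n) = l\<^sup>2 * (T + W * i)" using n by linarith
    thus ?thesis using i by (intro exI[of _ i] exI[of _ "l * M - n"]) auto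
  qed
  have F2: "\<exists>i. T + W * n' = l\<^sup>2 * (T + W * i) \<and> l * i \<le> M" if n': "n' \<in> S2" for n'
  proof -
    have le: "n' \<le> l * M" and nz: "l dvd T + W * n'" "\<beta> (T + W * n') \<noteq> 0"
      using n' by (auto simp: S2_def R_def G add.commute split: if_splits)
    \<comment> \<open>Divisibility by \<open>l\<close> improves to \<open>l^2\<close> because the
      exponent is \<open>s\<close> times a square. The quotient \<open>k\<close> is again in the
      support of \<open>\<beta>\<close>, as \<open>\<beta> (l^2 k) = c \<beta> k\<close> is
      nonzero.\<close>
    obtain k where k: "T + W * n' = l\<^sup>2 * k" using sq[OF nz(2,1)] by blast
    have "\<beta> k \<noteq> 0" using nz(2) mult[of k] by (auto simp: k)
    then obtain i where i: "k = T + W * i" using supp by blast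
    have "T * 1 \<le> T * l\<^sup>2" using l by (intro mult_le_mono) auto
    moreover have "l\<^sup>2 * (T + W * i) = W * (l * (l * i)) + T * l\<^sup>2"
      by (simp add: power2_eq_square algebra_simps)
    moreover have e: "T + W * n' = l\<^sup>2 * (T + W * i)" using k i by simp
    ultimately have "W * (l * (l * i)) \<le> W * n'" by linarith
    also have "W * n' \<le> W * (l * M)" using le by simp
    finally have "l * i \<le> M" using W l by simp
    thus ?thesis using e by blast
  qed
  have "sum L {0..M} = sum L S1" unfolding S1_def by (rule sum.mono_neutral_right) auto
  also have "\<dots> = sum R S2"
  proof (rule sum.reindex_bij_witness[of S1 g f S2 R L])
    fix p assume p: "p \<in> S1"
    obtain i n' where h: "p = l * i" "T + W * n' = l\<^sup>2 * (T + W * i)" "n' \<le> l * M" using F1[OF p] by blast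
    have fp: "f p = n'" using rel(1)[OF h(2)] h(1) by simp
    show "g (f p) = p" using rel(2)[OF h(2)] fp h(1) by simp
    have LRp: "L p = R n'" using LR[OF h(2) _ h(3)] p h(1) by (simp add: S1_def)
    thus "R (f p) = L p" using fp by simp
    show "f p \<in> S2" using LRp fp p h(3) by (simp add: S1_def S2_def)
  next
    fix n' assume n': "n' \<in> S2"
    obtain i where h: "T + W * n' = l\<^sup>2 * (T + W * i)" "l * i \<le> M" using F2[OF n'] by blast
    have gn: "g n' = l * i" by (rule rel(2)[OF h(1)])
    show "f (g n') = n'" using rel(1)[OF h(1)] gn by simp
    have "L (l * i) = R n'" using LR[OF h] n' by (simp add: S2_def)
    thus "g n' \<in> S1" using gn h(2) n' by (simp add: S1_def S2_def)
  qed
  also have "\<dots> = sum R {0..l*M}" unfolding S2_def by (rule sum.mono_neutral_left) auto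
  finally show ?thesis by (simp add: L_def R_def)
qed

section \<open>The congruence for the coefficients at infinity\<close>

lemma coeff_at_of_nat: "coeff_at a (of_nat n) = a n"
  by (simp add: coeff_at_def)

lemma coeff_at_nonzeroE:
  assumes "coeff_at a y \<noteq> 0"
  obtains n where "y = of_nat n"
proof -
  from assms have y: "y \<in> \<int>" "y \<ge> 0" by (auto simp: coeff_at_def split: if_splits)
  then obtain k where k: "y = of_int k" by (auto elim: Ints_cases)
  with y(2) have "y = of_nat (nat k)" by simp
  thus ?thesis by (rule that)
qed

text \<open>Everything takes place at the cusp at infinity in the coordinate \<open>z = q\<close>,
  of width \<open>1\<close>. The factors \<open>q^(-t/w)\<close> of \<open>f\<close> and
  \<open>q^(t/w)\<close> of \<open>g\<close> cancel, so \<open>fg\<close> and the bracket are power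
  series in \<open>q\<close> with explicit coefficients.\<close>

lemma rankin_cohen_congruence:
  fixes l N :: nat and s t w :: int and r :: "nat \<Rightarrow> int"
    and f g :: "complex \<Rightarrow> complex"
    and a :: "nat \<Rightarrow> complex" and b :: "int \<Rightarrow> complex" and c :: complex
  assumes l: "prime l" "l = 2 * v + 1"
    and N: "N \<ge> 1" and w: "w > 0" and s: "s > 0"
    and f_exp: "\<And>\<tau>. \<tau> \<in> uhp \<Longrightarrow> (\<lambda>n. a n * qpow (real n - of_int t / of_int w) \<tau>) sums f \<tau>"
    and a_int: "\<And>n. a n \<in> Z_loc l"
    and g: "\<And>\<tau>. \<tau> \<in> uhp \<Longrightarrow> g \<tau> = qpow (of_int t / of_int w) \<tau> * eta_disc 1 N r (qpow 1 \<tau>)"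
    and g_exp: "\<And>\<tau>. \<tau> \<in> uhp \<Longrightarrow> ((\<lambda>m. b m * qpow (of_int (s * m\<^sup>2) / of_int w) \<tau>) has_sum g \<tau>) UNIV"
    and b_mult: "\<And>m. b (int l * m) = c * b m"
    and l_sw: "\<not> int l dvd s * w"
  shows "\<exists>P. has_q_expansion
              (\<lambda>\<tau>. f \<tau> * g \<tau> - of_int (Legendre (- s * w) (int l)) * rankin_cohen (3/2) (1/2) v f g \<tau>) P
          \<and> fps_cong l
              (fps_const c * eta_fps l N r
                * Abs_fps (\<lambda>n. coeff_at a (of_nat (l * n) - of_int t / of_int w * (of_nat l ^ 2 - 1))))
              (U_op l P)"
proof -
  define G where "G = fps_nth (eta_fps 1 N r)"
  define x where "x = real_of_int t / of_int w"
  define X where "X = complex_of_int t / of_int w"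
  have Xx: "complex_of_real x = X" by (simp add: x_def X_def)
  define \<epsilon> where "\<epsilon> = Legendre (- s * w) (int l)"
  define S where "S = eta_disc 1 N r"
  have S: "S holomorphic_on ball 0 1" "S has_fps_expansion eta_fps 1 N r"
    unfolding S_def using N by (auto intro: holomorphic_eta_disc eta_disc_has_fps_expansion)
  have sumsR: "(\<lambda>n. a n * qpow (1 / 1) \<tau> ^ n) sums (qpow x \<tau> * f \<tau>)" if "\<tau> \<in> uhp" for \<tau>
  proof -
    have "qpow x \<tau> * (a n * qpow (real n - x) \<tau>) = a n * qpow (1 / 1) \<tau> ^ n" for n
      using qpow_add[of x "real n - x" \<tau>] qpow_of_nat[of n \<tau>] by simp
    with sums_mult[OF f_exp[OF that], of "qpow x \<tau>"] show ?thesis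
      unfolding x_def[symmetric] by (simp only:)
  qed
  obtain R where R: "R holomorphic_on ball 0 1" "R has_fps_expansion Abs_fps a"
    "\<And>\<tau>. \<tau> \<in> uhp \<Longrightarrow> R (qpow (1 / 1) \<tau>) = qpow x \<tau> * f \<tau>"
    by (rule qpow_series_disc[of 1 a "\<lambda>\<tau>. qpow x \<tau> * f \<tau>"]) (use sumsR in auto)
  have fR: "f \<tau> = qpow (- x / 1) \<tau> * R (qpow (1 / 1) \<tau>)" if "\<tau> \<in> uhp" for \<tau>
    using R(3)[OF that] by (simp flip: mult.assoc)
  have gS: "g \<tau> = qpow (x / 1) \<tau> * S (qpow (1 / 1) \<tau>)" if "\<tau> \<in> uhp" for \<tau>
    using g[OF that] by (simp add: S_def x_def)
  define K where "K = (\<lambda>i k. \<Sum>j\<le>v. rc_coeff v j * (of_nat i - X) ^ j * (of_nat k + X) ^ (v - j))"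
  define P where "P = Abs_fps (\<lambda>n. \<Sum>i=0..n. a i * G (n - i) * (1 - of_int \<epsilon> * K i (n - i)))"
  define Q where "Q = (\<lambda>z. R z * S z - of_int \<epsilon> * rankin_cohen_disc (3/2) (1/2) v 1 x R S z)"
  have Qhol: "Q holomorphic_on eball 0 1"
    unfolding Q_def using R(1) S(1)
    by (auto intro!: holomorphic_intros holomorphic_rankin_cohen_disc simp: one_ereal_def)
  have "Q has_fps_expansion Abs_fps a * eta_fps 1 N r - fps_const (of_int \<epsilon>) *
    Abs_fps (\<lambda>n. \<Sum>i=0..n. fps_nth (Abs_fps a) i * fps_nth (eta_fps 1 N r) (n - i) * K i (n - i))"
    unfolding Q_def K_def Xx[symmetric]
    by (intro has_fps_expansion_diff has_fps_expansion_mult has_fps_expansion_cmult_left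
        rankin_cohen_disc_has_fps_expansion R(2) S(2))
  also have "Abs_fps a * eta_fps 1 N r - fps_const (of_int \<epsilon>) *
    Abs_fps (\<lambda>n. \<Sum>i=0..n. fps_nth (Abs_fps a) i * fps_nth (eta_fps 1 N r) (n - i) * K i (n - i)) = P"
    unfolding fps_eq_iff fps_sub_nth fps_mult_left_const_nth
    unfolding fps_mult_nth fps_nth_Abs_fps P_def G_def sum_distrib_left sum_subtractf[symmetric]
    by (auto intro!: sum.cong simp: algebra_simps)
  finally have QP: "Q has_fps_expansion P" .
  have "has_q_expansion (\<lambda>\<tau>. f \<tau> * g \<tau> - of_int \<epsilon> * rankin_cohen (3/2) (1/2) v f g \<tau>) P"
    unfolding has_q_expansion_def
  proof
    fix \<tau> assume \<tau>: "\<tau> \<in> uhp"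
    have rc: "rankin_cohen (3/2) (1/2) v f g \<tau> = rankin_cohen_disc (3/2) (1/2) v 1 x R S (qpow (1 / 1) \<tau>)"
      by (rule rankin_cohen_eq_disc[OF _ R(1) S(1) _ _ \<tau>]) (use fR gS in auto)
    have "qpow (- x) \<tau> * R (qpow 1 \<tau>) * (qpow x \<tau> * S (qpow 1 \<tau>)) =
      (qpow (- x) \<tau> * qpow x \<tau>) * (R (qpow 1 \<tau>) * S (qpow 1 \<tau>))" by (simp only: mult_ac)
    hence "f \<tau> * g \<tau> = R (qpow 1 \<tau>) * S (qpow 1 \<tau>)"
      using fR[OF \<tau>] gS[OF \<tau>] by simp
    hence val: "f \<tau> * g \<tau> - of_int \<epsilon> * rankin_cohen (3/2) (1/2) v f g \<tau> = Q (qpow 1 \<tau>)"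
      by (simp add: Q_def rc)
    have "(\<lambda>n. fps_nth P n * qpow 1 \<tau> ^ n) sums Q (qpow 1 \<tau>)"
      by (rule has_fps_expansion_imp_sums_complex[OF QP Qhol])
         (use norm_qpow_less_1[OF _ \<tau>, of 1] in \<open>auto simp: one_ereal_def\<close>)
    thus "(\<lambda>n. fps_nth P n * qpow (real n) \<tau>) sums (f \<tau> * g \<tau> - of_int \<epsilon> * rankin_cohen (3/2) (1/2) v f g \<tau>)"
      by (simp add: val qpow_of_nat)
  qed
  moreover have "fps_cong l (fps_const c * eta_fps l N r
     * Abs_fps (\<lambda>n. coeff_at a (of_nat (l * n) - of_int t / of_int w * (of_nat l ^ 2 - 1)))) (U_op l P)"
  proof -
    note theta = theta_expansion_coeffs[OF w s S(2), of g t b]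
    have G0: "fps_nth (eta_fps 1 N r) 0 = 1" using N by (intro eta_fps_nth_0) auto
    have t: "t \<ge> 0" by (rule theta) (use G0 g g_exp in \<open>auto simp: S_def\<close>)
    \<comment> \<open>The coefficients of \<open>g\<close> in powers of \<open>q^(1/w)\<close>,
      which are seen in two ways: as an eta product they live on the exponents
      \<open>T + W i\<close> and are integers, as a theta series they live on the exponents
      \<open>s m^2\<close> and are multiplied by \<open>c\<close> under
      \<open>k \<mapsto> l^2 k\<close>.\<close>
    define \<beta> where "\<beta> = theta_coeff b s"
    have \<beta>: "\<beta> k = (if int k \<ge> t \<and> w dvd (int k - t) then G (nat ((int k - t) div w)) else 0)" for k
      unfolding \<beta>_def G_def by (rule theta) (use G0 g g_exp in \<open>auto simp: S_def\<close>)
    define T W where "T = nat t" and "W = nat w"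
    have TW: "int T = t" "int W = w" "W > 0" using t w by (auto simp: T_def W_def)
    have \<beta>G: "\<beta> (T + W * i) = G i" for i
      using w TW by (simp add: \<beta>)
    have supp: "\<exists>i. k = T + W * i" if "\<beta> k \<noteq> 0" for k
    proof -
      from that have k: "int k \<ge> t" "w dvd (int k - t)" by (auto simp: \<beta> split: if_splits)
      then obtain j where j: "int k - t = w * j" by blast
      have "j \<ge> 0" using j k(1) w by (metis diff_ge_0_iff_ge zero_le_mult_iff not_less)
      hence "int k = int (T + W * nat j)" using j TW by simp
      thus ?thesis by (metis of_nat_eq_iff)
    qed
    have lw: "\<not> int l dvd w" and ls: "\<not> int l dvd s" using l_sw by auto
    have \<beta>l: "\<beta> (l\<^sup>2 * k) = c * \<beta> k" for k
      unfolding \<beta>_def by (rule theta_coeff_mult_square) (use s l(1) ls b_mult in auto)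
    have rep: "\<exists>m. s * m\<^sup>2 = int k" if "\<beta> k \<noteq> 0" for k
    proof (rule ccontr)
      assume "\<not> ?thesis"
      hence "{m. s * m\<^sup>2 = int k} = {}" by auto
      thus False using that by (simp add: \<beta>_def theta_coeff_def)
    qed
    have pl: "prime (int l)" using l(1) by simp
    have sq: "l\<^sup>2 dvd k" if nzk: "\<beta> k \<noteq> 0" and lk: "l dvd k" for k
    proof -
      obtain m where m: "s * m\<^sup>2 = int k" using rep[OF nzk] by blast
      have "int l dvd s * m\<^sup>2" using lk m by simp
      hence "int l dvd m" using pl ls by (meson prime_dvd_multD prime_dvd_power)
      hence "int l ^ 2 dvd s * m\<^sup>2" by (intro dvd_mult dvd_power_same)
      thus ?thesis using m by (simp flip: of_nat_power)
    qed
    have Gint: "G n \<in> \<int>" for n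
      using int_fps_eta_fps[of N 1 r] N by (auto simp: int_fps_def G_def)
    have GZ: "G n \<in> Z_loc l" for n using Gint by (rule Z_loc_Ints)
    \<comment> \<open>The leading coefficient of the eta product is \<open>1\<close>, so
      \<open>c\<close> itself is the coefficient of \<open>g\<close> at \<open>l^2 T\<close>, an
      integer.\<close>
    have cZ: "c \<in> Z_loc l"
    proof -
      have "\<beta> k \<in> \<int>" for k using Gint by (simp add: \<beta>)
      moreover have "c = \<beta> (l\<^sup>2 * (T + W * 0))" unfolding \<beta>l \<beta>G using G0 by (simp add: G_def)
      ultimately show ?thesis by (metis Z_loc_Ints)
    qed
    define d where "d = (\<lambda>M p. coeff_at a (of_nat (l * (M - p)) - of_int t / of_int w * (of_nat l ^ 2 - 1)))"
    have dZ: "d M p \<in> Z_loc l" for M p using a_int by (simp add: d_def coeff_at_def)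
    have index: "rat_of_nat (l * (M - p)) - of_int t / of_int w * (of_nat l ^ 2 - 1) = of_nat n \<longleftrightarrow>
       W * n + W * (l * p) + T * l\<^sup>2 = W * (l * M) + T" if "p \<le> M" for M p n
    proof -
      have W': "rat_of_nat W > 0" "of_int w = rat_of_nat W" "of_int t = rat_of_nat T"
        using TW(3) unfolding TW(1,2)[symmetric] by simp_all
      define u where "u = (of_nat T / of_nat W :: rat)"
      have uT: "rat_of_nat T = of_nat W * u" using W'(1) by (simp add: u_def)
      have "rat_of_nat (l * (M - p)) = of_nat l * (of_nat M - of_nat p)"
        using that by (simp add: of_nat_diff)
      hence "rat_of_nat (l * (M - p)) - of_int t / of_int w * (of_nat l ^ 2 - 1) = of_nat n \<longleftrightarrow>
        of_nat l * (of_nat M - of_nat p) - u * (of_nat l ^ 2 - 1) = rat_of_nat n"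
        unfolding W'(2,3) u_def by (simp only:)
      also have "\<dots> \<longleftrightarrow> rat_of_nat n + of_nat l * of_nat p + u * of_nat l ^ 2 = of_nat l * of_nat M + u"
        by (auto simp: right_diff_distrib)
      also have "\<dots> \<longleftrightarrow> of_nat W * (rat_of_nat n + of_nat l * of_nat p + u * of_nat l ^ 2) = of_nat W * (of_nat l * of_nat M + u)"
        using W'(1) by (subst mult_left_cancel) auto
      also have "\<dots> \<longleftrightarrow> rat_of_nat (W * n + W * (l * p) + T * l\<^sup>2) = of_nat (W * (l * M) + T)"
        by (simp only: of_nat_add of_nat_mult of_nat_power uT distrib_left mult.assoc)
      finally have "rat_of_nat (l * (M - p)) - of_int t / of_int w * (of_nat l ^ 2 - 1) = of_nat n \<longleftrightarrow>
        rat_of_nat (W * n + W * (l * p) + T * l\<^sup>2) = of_nat (W * (l * M) + T)" .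
      thus ?thesis by (simp only: of_nat_eq_iff)
    qed
    define lhs where "lhs = (\<lambda>M. \<Sum>p=0..M. (if l dvd p then c * G (p div l) else 0) * d M p)"
    define rhs where "rhs = (\<lambda>M. \<Sum>i=0..l*M. a i * G (l * M - i) * (1 - of_int \<epsilon> * K i (l * M - i)))"
    have lhs_nth: "fps_nth (fps_const c * eta_fps l N r * Abs_fps (\<lambda>n. coeff_at a (of_nat (l * n) - of_int t / of_int w * (of_nat l ^ 2 - 1)))) M = lhs M" for M
    proof -
      have "l \<ge> 1" using l(2) by simp
      hence e: "fps_nth (eta_fps l N r) p = (if l dvd p then G (p div l) else 0)" for p
        unfolding eta_fps_eq_compose[OF N \<open>l \<ge> 1\<close>] fps_nth_compose_X_power G_def by simp
      show ?thesis unfolding lhs_def d_def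
        by (subst fps_mult_nth) (auto intro!: sum.cong simp: e)
    qed
    have rhs_nth: "fps_nth (U_op l P) M = rhs M" for M by (simp add: U_op_def P_def rhs_def)
    have lhsZ: "lhs M \<in> Z_loc l" for M unfolding lhs_def
      using l(1) cZ GZ dZ by (intro Z_loc_sum Z_loc_mult) (auto intro: Z_loc_mult)
    \<comment> \<open>Where \<open>G n'\<close> vanishes both sides are \<open>0\<close>; otherwise
      the exponent occurs in the theta series, which provides the \<open>m\<close> needed for
      Euler's criterion.\<close>
    have term_cong: "cong_loc l (a i * G n' * (1 - of_int \<epsilon> * K i n')) (if l dvd W * n' + T then a i * G n' else 0)"
      if "i + n' = l * M" for i n' M
    proof (cases "G n' = 0")
      case False
      hence "\<exists>m. s * m\<^sup>2 = w * int n' + t" using rep[of "T + W * n'"] TW by (simp add: \<beta>G add.commute)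
      from bracket_coeff_cong(1)[OF l(1,2) w l_sw this that]
      have "cong_loc l (1 - of_int \<epsilon> * K i n') (if int l dvd w * int n' + t then 1 else 0)"
        by (simp add: \<epsilon>_def K_def X_def)
      hence "cong_loc l (a i * G n' * (1 - of_int \<epsilon> * K i n')) (a i * G n' * (if int l dvd w * int n' + t then 1 else 0))"
        using l(1) a_int GZ by (intro cong_loc_cmult Z_loc_mult)
      moreover have "int l dvd w * int n' + t \<longleftrightarrow> l dvd W * n' + T"
        using TW by (metis int_dvd_int_iff of_nat_add of_nat_mult)
      ultimately show ?thesis by (simp split: if_splits)
    qed auto
    have KZ: "K i n' \<in> Z_loc l" if "i + n' = l * M" for i n' M
    proof -
      have X: "X \<in> Z_loc l" unfolding X_def by (rule Z_loc_divide_int[OF l(1) Z_loc_of_int lw])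
      show ?thesis unfolding K_def
        by (intro Z_loc_sum Z_loc_mult Z_loc_power Z_loc_diff Z_loc_add X Z_loc_of_nat l(1) rc_coeff_cong(1)[OF l]) auto
    qed
    have rhsZ: "rhs M \<in> Z_loc l" for M unfolding rhs_def
    proof (intro Z_loc_sum Z_loc_mult Z_loc_diff l(1) a_int GZ Z_loc_1 Z_loc_of_int)
      fix i assume "i \<in> {0..l*M}"
      thus "K i (l * M - i) \<in> Z_loc l" by (intro KZ[of _ _ M]) auto
    qed
    have "cong_loc l (rhs M) (lhs M)" for M
    proof -
      have "cong_loc l (rhs M) (\<Sum>i=0..l*M. if l dvd W * (l * M - i) + T then a i * G (l * M - i) else 0)"
        unfolding rhs_def by (intro cong_loc_sum l(1) term_cong[of _ _ M]) auto
      also have "(\<Sum>i=0..l*M. if l dvd W * (l * M - i) + T then a i * G (l * M - i) else 0) =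
        (\<Sum>n'=0..l*M. if l dvd W * n' + T then a (l * M - n') * G n' else 0)"
        by (rule sum.reindex_bij_witness[of _ "\<lambda>i. l * M - i" "\<lambda>i. l * M - i"]) auto
      also have "\<dots> = lhs M"
        unfolding lhs_def
      proof (rule sieved_sum_eq[symmetric, where \<beta> = \<beta>])
        show "W > 0" "l > 0" using TW l(2) by auto
        show "d M p = a n" if "p \<le> M" "W * n + W * (l * p) + T * l\<^sup>2 = W * (l * M) + T" for p n
          using index[OF that(1), of n] that(2) by (simp add: d_def coeff_at_of_nat)
        show "\<exists>n. W * n + W * (l * p) + T * l\<^sup>2 = W * (l * M) + T" if "p \<le> M" "d M p \<noteq> 0" for p
          using coeff_at_nonzeroE[OF that(2)[unfolded d_def]] index[OF that(1)] by metis
      qed (use \<beta>G supp \<beta>l sq in auto)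
      finally show ?thesis .
    qed
    hence "cong_loc l (lhs M) (rhs M)" for M by (rule cong_loc_sym[OF l(1)])
    thus ?thesis unfolding fps_cong_def lhs_nth rhs_nth using lhsZ rhsZ by (auto simp: cong_loc_def)
  qed
  ultimately show ?thesis unfolding \<epsilon>_def by blast
qed

theorem theorem2:
  fixes l N :: nat and s t w :: int and r :: "nat \<Rightarrow> int"
    and f g :: "complex \<Rightarrow> complex"
    and a :: "nat \<Rightarrow> complex" and b :: "int \<Rightarrow> complex" and chi :: "nat \<Rightarrow> complex"
  assumes l: "prime l" "l \<ge> 3"
    and N: "N \<ge> 1"
    and f_weak: "\<exists>M \<ge> 1. \<exists>\<nu>. weakly_holomorphic_modular_form M (3/2) \<nu> f"
    and f_exp: "\<forall>\<tau> \<in> uhp. (\<lambda>n. a n * qpow (real n - of_int t / of_int w) \<tau>) sums f \<tau>"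
    and a_int: "\<forall>n. a n \<in> Z_loc l"
    and g_eta: "\<forall>\<tau> \<in> uhp. g \<tau> = eta_quotient N r \<tau>"
    and g_weight: "eta_quotient_weight N r = 1/2"
    and fg: "(\<lambda>\<tau>. f \<tau> * g \<tau>) \<in> modular_forms 2 N"
    and g_hol: "\<exists>\<nu>. holomorphic_modular_form N (1/2) \<nu> g"
    and s_w: "coprime s w"
    and g_exp: "\<forall>\<tau> \<in> uhp. ((\<lambda>m. b m * qpow (of_int (s * m^2) / of_int w) \<tau>) has_sum g \<tau>) UNIV"
    and b_mult: "\<forall>m. b (int l * m) = chi l * b m"
    and l_sw: "\<not> int l dvd s * w"
  shows
    "((of_int t / of_int w :: rat) = (\<Sum>\<delta> | \<delta> dvd N. of_nat \<delta> * of_int (r \<delta>)) / 24 \<longrightarrow>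
       (\<exists>P. has_q_expansion
              (\<lambda>\<tau>. f \<tau> * g \<tau>
                    - of_int (Legendre (- s * w) (int l)) * rankin_cohen (3/2) (1/2) ((l - 1) div 2) f g \<tau>) P
          \<and> fps_cong l
              (fps_const (chi l) * (\<Prod>\<delta> | \<delta> dvd N. fps_qpoch (l * \<delta>) powi r \<delta>)
                * Abs_fps (\<lambda>n. coeff_at a (of_nat (l * n) - of_int t / of_int w * (of_nat l ^ 2 - 1))))
              (U_op l P)))
     \<and> rankin_cohen (3/2) (1/2) ((l - 1) div 2) f g \<in> modular_forms (l + 1) N
     \<and> ((\<lambda>\<tau>. f \<tau> * g \<tau>) \<in> cusp_forms 2 N \<longrightarrow>
          rankin_cohen (3/2) (1/2) ((l - 1) div 2) f g \<in> cusp_forms (l + 1) N)"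
proof -
  define v where "v = (l - 1) div 2"
  have "odd l" using l prime_odd_nat[of l] by auto
  hence lv: "l = 2 * v + 1" by (auto simp: v_def elim!: oddE)
  hence weight: "2 + 2 * v = l + 1" by simp
  have fhol: "f holomorphic_on uhp"
    using f_weak by (auto simp: weakly_holomorphic_modular_form_def)
  have nz: "g \<tau> \<noteq> 0" if "\<tau> \<in> uhp" for \<tau>
    using g_eta eta_quotient_nonzero[OF N that] that by simp
  obtain \<nu> where \<nu>: "holomorphic_modular_form N (1/2) \<nu> g" using g_hol by blast
  note modular = rankin_cohen_modular_form[OF N fhol \<nu> nz fg, of v, unfolded weight]
  \<comment> \<open>The premise \<open>tw\<close> identifies \<open>t/w\<close> with the leading
    exponent of the eta-quotient, so the fractional powers in the expansions of \<open>f\<close> and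
    \<open>g\<close> are opposite to each other.\<close>
  have expansion: "\<exists>P. has_q_expansion
              (\<lambda>\<tau>. f \<tau> * g \<tau> - of_int (Legendre (- s * w) (int l)) * rankin_cohen (3/2) (1/2) v f g \<tau>) P
          \<and> fps_cong l
              (fps_const (chi l) * (\<Prod>\<delta> | \<delta> dvd N. fps_qpoch (l * \<delta>) powi r \<delta>)
                * Abs_fps (\<lambda>n. coeff_at a (of_nat (l * n) - of_int t / of_int w * (of_nat l ^ 2 - 1))))
              (U_op l P)"
    if tw: "(of_int t / of_int w :: rat) = (\<Sum>\<delta> | \<delta> dvd N. of_nat \<delta> * of_int (r \<delta>)) / 24"
  proof -
    \<comment> \<open>The data depend only on the quotients \<open>s/w\<close> and \<open>t/w\<close> and on \<open>sw\<close>, so \<open>w\<close> can be taken positive.\<close>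
    define \<sigma> where "\<sigma> = sgn w"
    define s' t' w' where "s' = \<sigma> * s" and "t' = \<sigma> * t" and "w' = \<sigma> * w"
    have w0: "w \<noteq> 0" using l_sw by auto
    hence \<sigma>: "\<sigma> * \<sigma> = 1" "\<sigma> = 1 \<or> \<sigma> = -1" by (auto simp: \<sigma>_def sgn_if)
    have w': "w' > 0" using w0 by (auto simp: w'_def \<sigma>_def sgn_if)
    have quot: "of_int t' / of_int w' = (of_int t / of_int w :: 'a :: field_char_0)"
      "of_int (s' * m) / of_int w' = (of_int (s * m) / of_int w :: 'a)" for m
      using \<sigma>(2) by (auto simp: s'_def t'_def w'_def)
    have prods: "s' * w' = s * w" "- s' * w' = - s * w"
      using \<sigma>(2) by (auto simp: s'_def w'_def)
    have g_exp': "((\<lambda>m. b m * qpow (of_int (s' * m\<^sup>2) / of_int w') \<tau>) has_sum g \<tau>) UNIV" if "\<tau> \<in> uhp" for \<tau>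
      unfolding quot using g_exp that by simp
    have "s \<noteq> 0" using l_sw by auto
    hence "s' \<noteq> 0" using \<sigma>(2) by (auto simp: s'_def)
    hence s': "s' > 0" using theta_series_exponent_positive[OF w' _ N \<nu> nz g_exp'] by blast
    \<comment> \<open>The premise is an equation of rationals, whereas the exponents of
      \<open>qpow\<close> are real.\<close>
    have "real_of_int t / of_int w = of_rat (of_int t / of_int w)" by (simp add: of_rat_divide)
    also have "\<dots> = (\<Sum>\<delta> | \<delta> dvd N. real \<delta> * of_int (r \<delta>)) / 24"
      unfolding tw by (simp add: of_rat_divide of_rat_sum of_rat_mult)
    finally have rt: "real_of_int t / of_int w = (\<Sum>\<delta> | \<delta> dvd N. real \<delta> * of_int (r \<delta>)) / 24" .
    have "g \<tau> = qpow (of_int t' / of_int w') \<tau> * eta_disc 1 N r (qpow 1 \<tau>)" if "\<tau> \<in> uhp" for \<tau>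
      unfolding quot rt using g_eta that by (simp only: eta_quotient_eq[OF N])
    from rankin_cohen_congruence[OF l(1) lv N w' s' _ _ this g_exp', of a f "chi l"]
    show ?thesis using f_exp a_int b_mult l_sw
      unfolding quot prods eta_fps_def by simp
  qed
  show ?thesis
    using expansion modular unfolding v_def[symmetric] by blast
qed

end
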